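(* Let $Q$ be a finite symmetric quiver with set of vertices $I$, and let $H_Q(\{t_i\}_{i\in I},q)\in\mathbb{Z}((q^{1/2}))[[\{t_i\}_{i\in I}]]$ be the generating function of its Cohomological Hall algebra. Then there is a decomposition $$H_Q(\{t_i\}_{i\in I},q)=\prod_{\gamma\in\mathbb{Z}_{\geq 0}^I,\,k\in\mathbb{Z}}(q^{\frac{k}{2}}t^{\gamma};q)_\infty^{(-1)^{k-1}c_{\gamma,k}},$$ where $c_{\gamma,k}$ are non-negative integers. Moreover, if $c_{\gamma,k}\neq 0$, then $\gamma\neq 0$, $$k\equiv\chi_Q(\gamma,\gamma)\ \bmod 2,\qquad\text{and}\qquad\chi_Q(\gamma,\gamma)\leq k<\chi_Q(\gamma,\gamma)+2N_\gamma(Q).$$ In particular, for a fixed $\gamma$ only finitely many of the $c_{\gamma,k}$ are non-zero.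
   Context: $Q$ has $a_{ij}\in\mathbb{Z}_{\geq 0}$ arrows from $i$ to $j$ ($i,j\in I$), and is symmetric: $a_{ij}=a_{ji}$. The Euler form is $\chi_Q(\gamma_1,\gamma_2)=\sum_{i\in I}\gamma_1^i\gamma_2^i-\sum_{i,j\in I}a_{ij}\gamma_1^i\gamma_2^j$. For $\gamma\in\mathbb{Z}_{\geq 0}^I\setminus\{0\}$, $$N_\gamma(Q):=\frac12\Big(\sum_{i,j\in I,\ i\neq j}a_{ij}\gamma^i\gamma^j+\sum_{i\in I}\max(a_{ii}-1,0)\,\gamma^i(\gamma^i-1)\Big)-\sum_{i\in I}\gamma^i+2.$$ The (rational) Cohomological Hall algebra of $Q$ has underlying space $\mathcal{H}=\bigoplus_{\gamma\in\mathbb{Z}_{\geq 0}^I}\mathcal{H}_\gamma$, where $\mathcal{H}_\gamma=H^\bullet_{G_\gamma}(M_\gamma,\mathbb{Q})$ is the equivariant cohomology of the space $M_\gamma=\prod_{i,j}\mathbb{C}^{a_{ij}\gamma^i\gamma^j}$ of representations of dimension vector $\gamma$ under $G_\gamma=\prod_i GL(\gamma^i,\mathbb{C})$; equivalently $\mathcal{H}_\gamma\cong\mathbb{Q}[\{x_{i,\alpha}\}_{i\in I,1\leq\alpha\leq\gamma^i}]^{\prod_i S_{\gamma^i}}$. It is bigraded: a homogeneous polynomial in $\mathcal{H}_\gamma$ of polynomial degree $d$ (cohomological degree $2d$) has bidegree $(\gamma,2d+\chi_Q(\gamma,\gamma))$, and $\mathcal{H}_{\gamma,k}$ is the component of bidegree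 $(\gamma,k)$. The generating function is $$H_Q(\{t_i\}_{i\in I},q):=\sum_{\gamma\in\mathbb{Z}_{\geq 0}^I,\,k\in\mathbb{Z}}(-1)^k\dim(\mathcal{H}_{\gamma,k})\,t^\gamma q^{\frac{k}{2}},\qquad t^\gamma:=\prod_{i\in I}t_i^{\gamma^i},$$ and it equals $$\sum_{\gamma\in\mathbb{Z}_{\geq 0}^I}\frac{(-q^{\frac12})^{\chi_Q(\gamma,\gamma)}}{\prod_{i\in I}(1-q)(1-q^2)\cdots(1-q^{\gamma^i})}\,t^\gamma.$$ $(z;q)_\infty:=\prod_{n\in\mathbb{Z}_{\geq 0}}(1-q^n z)$ is the $q$-Pochhammer symbol. *)

theory Defs
  imports
    "HOL-Analysis.Analysis"
    "HOL-Library.Poly_Mapping"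
    "HOL-Computational_Algebra.Formal_Laurent_Series"
    "HOL-Combinatorics.Permutations"
    "HOL-Number_Theory.Cong"
    "Graph_Theory.Digraph"
begin

section \<open>Multivariate formal power series\<close>

text \<open>
  The ring \<open>A[[{t\<^sub>v}]]\<close>, with one variable \<open>t\<^sub>v\<close> for each element of the type \<open>'v\<close>.  Exponents are
  finitely supported functions \<open>'v \<Rightarrow>\<^sub>0 nat\<close>, so that the convolution sums are finite even if \<open>'v\<close>
  is infinite.  For \<open>I \<subseteq> UNIV\<close>, the ring \<open>A[[{t\<^sub>i}\<^sub>i\<^sub>\<in>\<^sub>I]]\<close> is the subring of the series supported
  on the exponents \<open>\<gamma>\<close> with \<open>keys \<gamma> \<subseteq> I\<close>.
\<close>

typedef ('v, 'a) mfps = "UNIV :: (('v \<Rightarrow>\<^sub>0 nat) \<Rightarrow> 'a) set"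
  morphisms mfps_coeff Abs_mfps ..

lemma mfps_coeff_Abs [simp]: "mfps_coeff (Abs_mfps f) = f"
  by (simp add: Abs_mfps_inverse)

lemma mfps_eqI: "(\<And>\<gamma>. mfps_coeff f \<gamma> = mfps_coeff g \<gamma>) \<Longrightarrow> f = g"
  by (metis ext mfps_coeff_inject)

definition exponent_splits :: "('v \<Rightarrow>\<^sub>0 nat) \<Rightarrow> (('v \<Rightarrow>\<^sub>0 nat) \<times> ('v \<Rightarrow>\<^sub>0 nat)) set" where
  "exponent_splits \<gamma> = {(\<alpha>, \<beta>). \<alpha> + \<beta> = \<gamma>}"

lemma finite_exponent_splits [simp]: "finite (exponent_splits \<gamma>)"
proof -
  define K where "K = Poly_Mapping.keys \<gamma>"
  define M where "M = (\<Sum>x\<in>K. Poly_Mapping.lookup \<gamma> x)"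
  let ?F = "{f. \<forall>x. (x \<in> K \<longrightarrow> f x \<in> {..M}) \<and> (x \<notin> K \<longrightarrow> f x = (0::nat))}"
  let ?S = "fst ` exponent_splits \<gamma>"
  have "finite K"
    by (simp add: K_def)
  have "Poly_Mapping.lookup \<alpha> \<in> ?F" if "\<alpha> \<in> ?S" for \<alpha>
  proof -
    have le: "Poly_Mapping.lookup \<alpha> x \<le> Poly_Mapping.lookup \<gamma> x" for x
      using that by (auto simp: exponent_splits_def lookup_add)
    have "Poly_Mapping.lookup \<gamma> x \<le> M" if "x \<in> K" for x
      unfolding M_def using \<open>finite K\<close> that by (intro member_le_sum) auto
    then have "\<forall>x\<in>K. Poly_Mapping.lookup \<alpha> x \<le> M"
      using le order.trans by blast
    moreover have "Poly_Mapping.lookup \<alpha> x = 0" if "x \<notin> K" for x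
      using that le[of x] by (simp add: K_def in_keys_iff)
    ultimately show ?thesis
      by simp
  qed
  then have "Poly_Mapping.lookup ` ?S \<subseteq> ?F"
    by (rule image_subsetI)
  moreover have "finite ?F"
    using \<open>finite K\<close> by (intro finite_set_of_finite_funs) auto
  ultimately have "finite (Poly_Mapping.lookup ` ?S)"
    using finite_subset by blast
  then have "finite ?S"
    by (rule finite_imageD) (rule inj_onI, simp add: poly_mapping_eqI)
  moreover have "exponent_splits \<gamma> \<subseteq> (\<lambda>\<alpha>. (\<alpha>, \<gamma> - \<alpha>)) ` ?S"
    by (force simp: exponent_splits_def)
  ultimately show ?thesis
    by (meson finite_imageI finite_subset)
qed

instantiation mfps :: (type, comm_ring_1) comm_ring_1
begin

definition "0 = Abs_mfps (\<lambda>_. 0)"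
definition "1 = Abs_mfps (\<lambda>\<gamma>. if \<gamma> = 0 then 1 else 0)"
definition "f + g = Abs_mfps (\<lambda>\<gamma>. mfps_coeff f \<gamma> + mfps_coeff g \<gamma>)"
definition "f - g = Abs_mfps (\<lambda>\<gamma>. mfps_coeff f \<gamma> - mfps_coeff g \<gamma>)"
definition "- f = Abs_mfps (\<lambda>\<gamma>. - mfps_coeff f \<gamma>)"
definition "f * g =
  Abs_mfps (\<lambda>\<gamma>. \<Sum>(\<alpha>, \<beta>)\<in>exponent_splits \<gamma>. mfps_coeff f \<alpha> * mfps_coeff g \<beta>)"

instance
proof
  fix f g h :: "('a, 'b) mfps"
  show "f * g * h = f * (g * h)"
  proof (rule mfps_eqI)
    fix \<gamma>
    let ?c = mfps_coeff
    have "?c (f * g * h) \<gamma> =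
        (\<Sum>p\<in>exponent_splits \<gamma>. \<Sum>q\<in>exponent_splits (fst p).
            ?c f (fst q) * ?c g (snd q) * ?c h (snd p))"
      by (simp add: times_mfps_def case_prod_beta sum_distrib_right)
    also have "\<dots> = (\<Sum>(p, q)\<in>(SIGMA p:exponent_splits \<gamma>. exponent_splits (fst p)).
            ?c f (fst q) * ?c g (snd q) * ?c h (snd p))"
      by (rule sum.Sigma) auto
    also have "\<dots> = (\<Sum>(p, q)\<in>(SIGMA p:exponent_splits \<gamma>. exponent_splits (snd p)).
            ?c f (fst p) * (?c g (fst q) * ?c h (snd q)))"
      by (rule sum.reindex_bij_witness
            [of _ "\<lambda>((a, _), (b, c)). ((a + b, c), (a, b))" "\<lambda>((_, c), (a, b)). ((a, b + c), (b, c))"])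
         (auto simp: exponent_splits_def ac_simps)
    also have "\<dots> = (\<Sum>p\<in>exponent_splits \<gamma>. \<Sum>q\<in>exponent_splits (snd p).
            ?c f (fst p) * (?c g (fst q) * ?c h (snd q)))"
      by (rule sum.Sigma[symmetric]) auto
    also have "\<dots> = ?c (f * (g * h)) \<gamma>"
      by (simp add: times_mfps_def case_prod_beta sum_distrib_left)
    finally show "?c (f * g * h) \<gamma> = ?c (f * (g * h)) \<gamma>" .
  qed
  show "f * g = g * f"
  proof (rule mfps_eqI)
    fix \<gamma>
    show "mfps_coeff (f * g) \<gamma> = mfps_coeff (g * f) \<gamma>"
      unfolding times_mfps_def mfps_coeff_Abs
      by (rule sum.reindex_bij_witness[of _ prod.swap prod.swap])
         (auto simp: exponent_splits_def add.commute mult.commute)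
  qed
  show "1 * f = f"
  proof (rule mfps_eqI)
    fix \<gamma>
    have "mfps_coeff (1 * f) \<gamma>
        = (\<Sum>p\<in>exponent_splits \<gamma>. if p = (0, \<gamma>) then mfps_coeff f \<gamma> else 0)"
      unfolding times_mfps_def mfps_coeff_Abs one_mfps_def
      by (rule sum.cong) (auto simp: exponent_splits_def split: if_splits)
    also have "\<dots> = mfps_coeff f \<gamma>"
      by (subst sum.delta[OF finite_exponent_splits]) (simp add: exponent_splits_def)
    finally show "mfps_coeff (1 * f) \<gamma> = mfps_coeff f \<gamma>" .
  qed
  show "(f + g) * h = f * h + g * h"
    by (rule mfps_eqI)
       (simp add: times_mfps_def plus_mfps_def case_prod_beta distrib_right sum.distrib)
  show "(0 :: ('a, 'b) mfps) \<noteq> 1"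
  proof
    assume "(0 :: ('a, 'b) mfps) = 1"
    then have "mfps_coeff (0 :: ('a, 'b) mfps) 0 = mfps_coeff 1 0"
      by (rule arg_cong)
    then show False
      by (simp add: zero_mfps_def one_mfps_def)
  qed
  show "f + g + h = f + (g + h)" "f + g = g + f" "0 + f = f" "- f + f = 0" "f - g = f + - g"
    by (rule mfps_eqI; simp add: plus_mfps_def minus_mfps_def uminus_mfps_def zero_mfps_def ac_simps)+
qed

end

instantiation mfps :: (type, comm_ring_1) inverse
begin

text \<open>The inverse of a unit of the ring, and \<open>0\<close> for non-units.\<close>

definition "inverse f =
  (if \<exists>g. f * g = (1 :: ('a, 'b) mfps) then (THE g. f * g = 1) else 0)"
definition "f div g = f * inverse (g :: ('a, 'b) mfps)"

instance ..

end

lemma mfps_inverse_unique: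
  fixes f g :: "('v, 'a :: comm_ring_1) mfps"
  assumes "f * g = 1"
  shows "inverse f = g"
proof -
  have "h = g" if "f * h = 1" for h
  proof -
    have "h = (f * g) * h"
      by (simp add: assms)
    also have "\<dots> = (f * h) * g"
      by (simp only: ac_simps)
    finally show ?thesis
      by (simp add: that)
  qed
  then have "(THE g. f * g = 1) = g"
    using assms by (intro the_equality)
  then show ?thesis
    using assms unfolding inverse_mfps_def by (subst if_P) auto
qed

definition mfps_monom :: "'a :: zero \<Rightarrow> ('v \<Rightarrow>\<^sub>0 nat) \<Rightarrow> ('v, 'a) mfps" where
  "mfps_monom a \<gamma> = Abs_mfps (\<lambda>\<delta>. if \<delta> = \<gamma> then a else 0)"

text \<open>
  Infinite products of families, unconditionally convergent: the net of all finite subproducts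
  converges coefficientwise, where the coefficients carry their own topology.
\<close>

definition has_mfps_prod ::
  "('b \<Rightarrow> ('v, 'a :: {comm_ring_1, topological_space}) mfps) \<Rightarrow> 'b set \<Rightarrow> ('v, 'a) mfps \<Rightarrow> bool" where
  "has_mfps_prod f A P \<longleftrightarrow>
     (\<forall>\<gamma>. ((\<lambda>F. mfps_coeff (\<Prod>x\<in>F. f x) \<gamma>) \<longlongrightarrow> mfps_coeff P \<gamma>) (finite_subsets_at_top A))"

lemma has_mfps_prod_unique:
  fixes f :: "'b \<Rightarrow> ('v, 'a :: {comm_ring_1, t2_space}) mfps"
  assumes "has_mfps_prod f A P" "has_mfps_prod f A P'"
  shows "P = P'"
  using assms unfolding has_mfps_prod_def
  by (intro mfps_eqI) (blast intro: tendsto_unique[OF finite_subsets_at_top_neq_bot])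


section \<open>The \<open>q\<close>-Pochhammer symbol\<close>

text \<open>
  Laurent series in \<open>q\<^sup>1\<^sup>/\<^sup>2\<close>, with the topology of the library: the variable \<open>fls_X\<close> is
  \<open>q\<^sup>1\<^sup>/\<^sup>2\<close>, thus \<open>q\<close> is \<open>fls_X\<^sup>2\<close> and \<open>q\<^sup>k\<^sup>/\<^sup>2\<close> is \<open>fls_X_intpow k\<close>.
\<close>

definition qhalf_monom :: "int \<Rightarrow> ('v \<Rightarrow>\<^sub>0 nat) \<Rightarrow> ('v, int fls) mfps" where
  "qhalf_monom k \<gamma> = mfps_monom (fls_X_intpow k) \<gamma>"

definition qpochhammer_inf :: "('v, int fls) mfps \<Rightarrow> ('v, int fls) mfps" where
  "qpochhammer_inf z =
     (THE P. has_mfps_prod (\<lambda>n. 1 - mfps_monom (fls_X ^ 2) 0 ^ n * z) (UNIV :: nat set) P)"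


section \<open>Symmetric quivers\<close>

text \<open>
  A finite quiver is a finite directed multigraph, loops allowed.  The predicate \<^const>\<open>symmetric\<close>
  of the graph library disregards multiplicities and is not the notion needed here.
\<close>

definition num_arrows :: "('v, 'e) pre_digraph \<Rightarrow> 'v \<Rightarrow> 'v \<Rightarrow> nat" where
  "num_arrows Q i j = card {e \<in> arcs Q. tail Q e = i \<and> head Q e = j}"

definition symmetric_quiver :: "('v, 'e) pre_digraph \<Rightarrow> bool" where
  "symmetric_quiver Q \<longleftrightarrow> (\<forall>i\<in>verts Q. \<forall>j\<in>verts Q. num_arrows Q i j = num_arrows Q j i)"

definition dim_vectors :: "('v, 'e) pre_digraph \<Rightarrow> ('v \<Rightarrow>\<^sub>0 nat) set" where
  "dim_vectors Q = {\<gamma>. Poly_Mapping.keys \<gamma> \<subseteq> verts Q}"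

definition euler_form :: "('v, 'e) pre_digraph \<Rightarrow> ('v \<Rightarrow>\<^sub>0 nat) \<Rightarrow> ('v \<Rightarrow>\<^sub>0 nat) \<Rightarrow> int" where
  "euler_form Q \<gamma>1 \<gamma>2 =
     (\<Sum>i\<in>verts Q. int (Poly_Mapping.lookup \<gamma>1 i) * int (Poly_Mapping.lookup \<gamma>2 i))
     - (\<Sum>i\<in>verts Q. \<Sum>j\<in>verts Q.
          int (num_arrows Q i j) * int (Poly_Mapping.lookup \<gamma>1 i) * int (Poly_Mapping.lookup \<gamma>2 j))"

definition N_bound :: "('v, 'e) pre_digraph \<Rightarrow> ('v \<Rightarrow>\<^sub>0 nat) \<Rightarrow> rat" where
  "N_bound Q \<gamma> =
     1 / 2 * of_int
       ((\<Sum>i\<in>verts Q. \<Sum>j\<in>verts Q - {i}.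
           int (num_arrows Q i j) * int (Poly_Mapping.lookup \<gamma> i) * int (Poly_Mapping.lookup \<gamma> j))
        + (\<Sum>i\<in>verts Q. max (int (num_arrows Q i i) - 1) 0
             * int (Poly_Mapping.lookup \<gamma> i) * (int (Poly_Mapping.lookup \<gamma> i) - 1)))
     - of_int (\<Sum>i\<in>verts Q. int (Poly_Mapping.lookup \<gamma> i)) + 2"


section \<open>The bigraded space underlying the Cohomological Hall algebra\<close>

text \<open>
  Polynomials over \<open>\<rat>\<close> in the variables \<open>x\<^sub>i\<^sub>,\<^sub>\<alpha>\<close>: a monomial is a finitely supported exponent
  function on \<open>'v \<times> nat\<close>, and a polynomial is a finitely supported function on monomials.
\<close>

type_synonym 'v coha_poly = "('v \<times> nat \<Rightarrow>\<^sub>0 nat) \<Rightarrow>\<^sub>0 rat"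

interpretation coha: vector_space
  "\<lambda>(c :: rat) (p :: 'v coha_poly). Poly_Mapping.map ((*) c) p"
proof unfold_locales
  fix a b :: rat and x y :: "'v coha_poly"
  show "Poly_Mapping.map ((*) a) (x + y) = Poly_Mapping.map ((*) a) x + Poly_Mapping.map ((*) a) y"
    by (rule poly_mapping_eqI) (auto simp: lookup_add map.rep_eq when_def simp flip: distrib_left)
  show "Poly_Mapping.map ((*) (a + b)) x = Poly_Mapping.map ((*) a) x + Poly_Mapping.map ((*) b) x"
    by (rule poly_mapping_eqI) (auto simp: lookup_add map.rep_eq when_def simp flip: distrib_right)
  show "Poly_Mapping.map ((*) a) (Poly_Mapping.map ((*) b) x) = Poly_Mapping.map ((*) (a * b)) x"
    by (rule poly_mapping_eqI) (auto simp: map.rep_eq when_def)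
  show "Poly_Mapping.map ((*) 1) x = x"
    by (rule poly_mapping_eqI) (auto simp: map.rep_eq when_def)
qed

text \<open>
  \<open>\<H>\<^sub>\<gamma> = H\<^sub>G\<^sub>\<gamma>(M\<^sub>\<gamma>, \<rat>)\<close> in its polynomial model: since \<open>M\<^sub>\<gamma>\<close> is equivariantly contractible, this is
  \<open>H(BG\<^sub>\<gamma>, \<rat>)\<close>, the algebra of polynomials in \<open>x\<^sub>i\<^sub>,\<^sub>\<alpha>\<close> \<open>(1 \<le> \<alpha> \<le> \<gamma>\<^sub>i)\<close> invariant under
  \<open>\<Prod>\<^sub>i S\<^sub>\<gamma>\<^sub>i\<close>.  The monomial \<open>map_key (\<lambda>(i, \<alpha>). (i, \<sigma> i \<alpha>)) m\<close> is \<open>m\<close> with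
  its variables permuted: its exponent at \<open>(i, \<alpha>)\<close> is that of \<open>m\<close> at \<open>(i, \<sigma> i \<alpha>)\<close>.
\<close>

definition coha_comp :: "('v \<Rightarrow>\<^sub>0 nat) \<Rightarrow> 'v coha_poly set" where
  "coha_comp \<gamma> = {p.
     (\<forall>m\<in>Poly_Mapping.keys p.
        Poly_Mapping.keys m \<subseteq> {(i, \<alpha>). 1 \<le> \<alpha> \<and> \<alpha> \<le> Poly_Mapping.lookup \<gamma> i}) \<and>
     (\<forall>\<sigma>. (\<forall>i. \<sigma> i permutes {1..Poly_Mapping.lookup \<gamma> i}) \<longrightarrow>
        (\<forall>m. Poly_Mapping.lookup p (Poly_Mapping.map_key (\<lambda>(i, \<alpha>). (i, \<sigma> i \<alpha>)) m)
              = Poly_Mapping.lookup p m))}"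

definition monom_degree :: "('v \<times> nat \<Rightarrow>\<^sub>0 nat) \<Rightarrow> nat" where
  "monom_degree m = (\<Sum>x\<in>Poly_Mapping.keys m. Poly_Mapping.lookup m x)"

definition coha_bigraded ::
  "('v, 'e) pre_digraph \<Rightarrow> ('v \<Rightarrow>\<^sub>0 nat) \<Rightarrow> int \<Rightarrow> 'v coha_poly set" where
  "coha_bigraded Q \<gamma> k = {p \<in> coha_comp \<gamma>.
     \<forall>m\<in>Poly_Mapping.keys p. 2 * int (monom_degree m) + euler_form Q \<gamma> \<gamma> = k}"

lemma subspace_coha_bigraded: "coha.subspace (coha_bigraded Q \<gamma> k)"
proof (rule coha.subspaceI)
  show "0 \<in> coha_bigraded Q \<gamma> k"
    by (auto simp: coha_bigraded_def coha_comp_def)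
  fix x y assume xy: "x \<in> coha_bigraded Q \<gamma> k" "y \<in> coha_bigraded Q \<gamma> k"
  have "Poly_Mapping.keys (x + y) \<subseteq> Poly_Mapping.keys x \<union> Poly_Mapping.keys y"
    by (rule Poly_Mapping.keys_add)
  then show "x + y \<in> coha_bigraded Q \<gamma> k"
    using xy unfolding coha_bigraded_def coha_comp_def by (auto simp: lookup_add subset_iff)
next
  fix c x assume x: "x \<in> coha_bigraded Q \<gamma> k"
  have "Poly_Mapping.keys (Poly_Mapping.map ((*) c) x) \<subseteq> Poly_Mapping.keys x"
    by (auto simp: in_keys_iff map.rep_eq when_def)
  then show "Poly_Mapping.map ((*) c) x \<in> coha_bigraded Q \<gamma> k"
    using x unfolding coha_bigraded_def coha_comp_def
    by (auto simp: map.rep_eq when_def subset_iff)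
qed

definition coha_dim :: "('v, 'e) pre_digraph \<Rightarrow> ('v \<Rightarrow>\<^sub>0 nat) \<Rightarrow> int \<Rightarrow> nat" where
  "coha_dim Q \<gamma> k = coha.dim (coha_bigraded Q \<gamma> k)"

definition coha_series :: "('v, 'e) pre_digraph \<Rightarrow> ('v, int fls) mfps" where
  "coha_series Q = Abs_mfps (\<lambda>\<gamma>.
     if \<gamma> \<in> dim_vectors Q
     then Abs_fls (\<lambda>k. (if even k then 1 else - 1) * int (coha_dim Q \<gamma> k))
     else 0)"

text \<open>
  The coefficient functions are bounded below, so that \<^const>\<open>Abs_fls\<close> is used within its domain.
\<close>

lemma coha_dim_eq_0:
  assumes "k < euler_form Q \<gamma> \<gamma>"
  shows "coha_dim Q \<gamma> k = 0"
proof -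
  have "coha_bigraded Q \<gamma> k \<subseteq> {0}"
  proof
    fix p assume "p \<in> coha_bigraded Q \<gamma> k"
    then have "Poly_Mapping.keys p = {}"
      using assms by (auto simp: coha_bigraded_def)
    then show "p \<in> {0}" by simp
  qed
  then have "coha_bigraded Q \<gamma> k \<subseteq> coha.span {}"
    by simp
  then have "coha.dim (coha_bigraded Q \<gamma> k) \<le> card ({} :: 'a coha_poly set)"
    by (intro coha.dim_le_card) auto
  then show ?thesis
    by (simp add: coha_dim_def)
qed

lemma coha_series_nth:
  assumes "\<gamma> \<in> dim_vectors Q"
  shows "fls_nth (mfps_coeff (coha_series Q) \<gamma>) k = (if even k then 1 else - 1) * int (coha_dim Q \<gamma> k)"
proof -
  have "\<forall>n < euler_form Q \<gamma> \<gamma>. (if even n then 1 else - 1) * int (coha_dim Q \<gamma> n) = 0"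
    by (simp add: coha_dim_eq_0)
  from nth_Abs_fls_lower_bound[OF this] show ?thesis
    using assms by (simp add: coha_series_def)
qed

end

theory Submission
  imports Defs
begin

text \<open>
  By the dimension count for symmetric polynomials, the series is
  \<open>\<Sum>\<^sub>d (-q\<^sup>1\<^sup>/\<^sup>2)\<^bsup>\<chi>(d,d)\<^esup> t\<^sup>d / (q)\<^sub>d\<close>, where \<open>(q)\<^sub>d\<close> is the product over the vertices of the
  \<open>q\<close>-factorials \<open>(1 - q) \<cdots> (1 - q\<^bsup>d i\<^esup>)\<close> (\<open>coha_series_coeff\<close>).  If \<open>\<chi>\<close> were diagonal with entries \<open>0\<close> and \<open>1\<close>, this
  sum would factor over the vertices, and by Euler's expansions each factor would be \<open>1 / (z; q)\<^sub>\<infinity>\<close> or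
  \<open>(z; q)\<^sub>\<infinity>\<close> (\<open>qpochhammer_powi\<close>).  The proof reaches this situation by two moves that
  trade arrows of the quiver for new vertices, without changing the series:

  \<^item> Unlinking (\<open>unlink_refines\<close>): an arrow between different vertices \<open>i\<close> and \<open>j\<close> is removed, together with the
    opposite one, and a vertex for the bound state \<open>i + j\<close> is added.  This rests on the Durfee rectangle identity.
  \<^item> Splitting (\<open>split_refines\<close>): a vertex with at least two loops loses two of them, and vertices for its
    bound states with \<open>2, 3, \<dots>\<close> constituents are added.  This rests on Hall's identity for partitions.

  A bound state has a dimension vector, its charge, and both moves create only vertices whose
  charge is at least as heavy as everything that has been dealt with before.  Doing all moves of weight
  \<open>1, 2, 3, \<dots>\<close> in turn therefore decouples the vertices up to any given weight after finitely many
  steps (\<open>decoupling_sequence\<close>), and afterwards the number of vertices of a given charge and degree up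
  to that weight is constant, where the degree of a decoupled vertex of charge \<open>\<gamma>\<close> is the \<open>k\<close> with
  \<open>z = q\<^sup>k\<^sup>/\<^sup>2 t\<^sup>\<gamma>\<close> in its factor.  This number is \<open>c \<gamma> k\<close>; as a number of vertices it is not negative.

  The bounds on \<open>k\<close> are invariants of the moves (\<open>unlink_admissible\<close>, \<open>split_admissible\<close>).  The entries of
  the form never fall below those of \<open>\<chi>\<close>, which gives \<open>k \<ge> \<chi>(\<gamma>,\<gamma>)\<close>.  A vertex \<open>i\<close> of the quiver has
  \<open>k - 2 = \<chi>(i,i) - 2\<close>, and under both moves \<open>k - 2\<close> is subadditive in the constituents of a bound state.  Hence
  \<open>k - 2 \<le> \<Sum>\<^sub>i \<gamma>\<^sub>i (\<chi>(i,i) - 2)\<close>, which implies the asserted upper bound (\<open>degree_bound\<close>).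
\<close>

abbreviation (input) "keys \<equiv> Poly_Mapping.keys"
abbreviation (input) "lookup \<equiv> Poly_Mapping.lookup"
abbreviation (input) "single \<equiv> Poly_Mapping.single"

section \<open>Inverse \<open>q\<close>-factorials\<close>

text \<open>
  The monomial \<open>(-q\<^sup>1\<^sup>/\<^sup>2)\<^sup>k\<close>, for \<open>q\<^sup>1\<^sup>/\<^sup>2 = fls_X\<close>.  It is multiplicative in \<open>k\<close>, so that the signs
  of the theorem need no bookkeeping of their own.
\<close>

definition signed_pow :: "int \<Rightarrow> int fls" where
  "signed_pow k = (if even k then 1 else - 1) * fls_X_intpow k"

abbreviation qpow :: "int \<Rightarrow> int fls" where
  "qpow n \<equiv> signed_pow (2 * n)"

lemma signed_pow_0 [simp]: "signed_pow 0 = 1"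
  by (simp add: signed_pow_def)

lemma signed_pow_add: "signed_pow (a + b) = signed_pow a * signed_pow b"
  unfolding signed_pow_def
  by (auto simp: fls_X_intpow_times_fls_X_intpow)

lemma signed_pow_nth: "fls_nth (signed_pow k * f) n = (if even k then 1 else - 1) * fls_nth f (n - k)"
  unfolding signed_pow_def by (auto simp: fls_X_intpow_times_conv_shift)

lemma finite_multisets_size_sum:
  "finite {M :: nat multiset. size M = n \<and> 2 * sum_mset M = j}"
proof (rule finite_subset)
  show "{M :: nat multiset. size M = n \<and> 2 * sum_mset M = j}
      \<subseteq> mset ` {xs. set xs \<subseteq> {..j} \<and> length xs = n}"
  proof
    fix M :: "nat multiset"
    assume M: "M \<in> {M. size M = n \<and> 2 * sum_mset M = j}"
    obtain xs where xs: "M = mset xs" by (metis ex_mset)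
    have "x \<le> j" if "x \<in> set xs" for x
    proof -
      have "x \<le> sum_list xs" using that by (intro member_le_sum_list) auto
      then show ?thesis using M xs by (simp add: sum_mset_sum_list)
    qed
    then show "M \<in> mset ` {xs. set xs \<subseteq> {..j} \<and> length xs = n}"
      using M xs by auto
  qed
qed (intro finite_imageI finite_lists_length_eq, simp)

text \<open>
  Twice the sum is counted because the coefficients of a Laurent series here belong to powers of
  \<open>q\<^sup>1\<^sup>/\<^sup>2\<close>.
\<close>

definition num_multisets :: "nat \<Rightarrow> nat \<Rightarrow> nat" where
  "num_multisets n j = card {M :: nat multiset. size M = n \<and> 2 * sum_mset M = j}"

lemma num_multisets_0: "num_multisets 0 j = (if j = 0 then 1 else 0)"
proof -
  have "{M :: nat multiset. size M = 0 \<and> 2 * sum_mset M = j} = (if j = 0 then {{#}} else {})"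
    by auto
  then show ?thesis by (simp add: num_multisets_def)
qed

text \<open>
  Either \<open>0\<close> occurs and one copy is removed, or every entry can be lowered by one.
\<close>

lemma num_multisets_Suc:
  "num_multisets (Suc n) j =
     num_multisets n j + (if 2 * Suc n \<le> j then num_multisets (Suc n) (j - 2 * Suc n) else 0)"
proof -
  let ?S = "\<lambda>n j. {M :: nat multiset. size M = n \<and> 2 * sum_mset M = j}"
  let ?B = "if 2 * Suc n \<le> j then ?S (Suc n) (j - 2 * Suc n) else {}"
  have sum_Suc: "sum_mset (image_mset Suc M) = sum_mset M + size M" for M
    by (induction M) auto
  have eq: "?S (Suc n) j = add_mset 0 ` ?S n j \<union> image_mset Suc ` ?B" (is "?L = ?R")
  proof
    show "?R \<subseteq> ?L" by (auto simp: sum_Suc)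
    show "?L \<subseteq> ?R"
    proof
      fix M assume M: "M \<in> ?L"
      show "M \<in> ?R"
      proof (cases "0 \<in># M")
        case True
        then obtain M' where "M = add_mset 0 M'" by (metis mset_add)
        then show ?thesis using M by auto
      next
        case False
        define M' where "M' = image_mset (\<lambda>x. x - 1) M"
        have "image_mset Suc M' = image_mset (\<lambda>x. x) M"
          unfolding M'_def multiset.map_comp
          by (rule image_mset_cong) (use False in \<open>auto simp: gr0_conv_Suc intro: Suc_pred\<close>,
             metis False Suc_pred gr0I)
        then have M_eq: "M = image_mset Suc M'" by simp
        then have "size M' = Suc n" "2 * sum_mset M' + 2 * Suc n = j"
          using M by (auto simp: sum_Suc)
        then have "M' \<in> ?B" by auto
        then show ?thesis using M_eq by blast
      qed
    qed
  qed
  have fin: "finite (?S n j)" "finite ?B"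
    using finite_multisets_size_sum by auto
  have inj: "inj_on (image_mset Suc) ?B"
    using multiset.inj_map[OF inj_Suc] subset_UNIV by (rule inj_on_subset)
  have "card (?S (Suc n) j) = card (add_mset 0 ` ?S n j) + card (image_mset Suc ` ?B)"
    unfolding eq
  proof (rule card_Un_disjoint)
    have "False" if "add_mset 0 M = image_mset Suc M'" for M M'
      using arg_cong[OF that, of "\<lambda>M. 0 \<in># M"] by auto
    then show "add_mset 0 ` ?S n j \<inter> image_mset Suc ` ?B = {}" by fast
    show "finite (add_mset 0 ` ?S n j)" using fin(1) by (rule finite_imageI)
    show "finite (image_mset Suc ` ?B)" using fin(2) by (rule finite_imageI)
  qed
  also have "card (add_mset 0 ` ?S n j) = card (?S n j)"
    by (rule card_image) (rule inj_onI, simp only: add_mset_add_mset_same_iff)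
  also have "card (image_mset Suc ` ?B) = card ?B"
    using inj by (rule card_image)
  finally show ?thesis
    by (simp add: num_multisets_def)
qed

text \<open>
  This is \<open>1 / ((1 - q) (1 - q\<^sup>2) \<cdots> (1 - q\<^sup>n))\<close>, which enumerates the \<open>n\<close>-element multisets of
  natural numbers by their sum.  With the value \<open>0\<close> at negative arguments the recursion
  \<open>inv_qfact_rec\<close> holds for all integers, and terms of a sum that lie outside the meaningful
  range vanish by themselves.
\<close>

definition inv_qfact :: "int \<Rightarrow> int fls" where
  "inv_qfact n =
     (if n < 0 then 0 else fps_to_fls (Abs_fps (\<lambda>j. int (num_multisets (nat n) j))))"

lemma inv_qfact_neg [simp]: "n < 0 \<Longrightarrow> inv_qfact n = 0"
  by (simp add: inv_qfact_def)

lemma inv_qfact_0 [simp]: "inv_qfact 0 = 1"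
proof -
  have "Abs_fps (\<lambda>j. int (num_multisets 0 j)) = 1"
    by (rule fps_ext) (simp add: num_multisets_0)
  then show ?thesis by (simp add: inv_qfact_def)
qed

lemma inv_qfact_nth:
  "fls_nth (inv_qfact (int n)) k = (if k < 0 then 0 else int (num_multisets n (nat k)))"
  by (simp add: inv_qfact_def)

lemma inv_qfact_rec: "(1 - signed_pow (2 * n)) * inv_qfact n = inv_qfact (n - 1)"
proof (cases "n \<le> 0")
  case True
  then show ?thesis by (cases "n = 0") auto
next
  case False
  then obtain m where m: "n = int (Suc m)"
    by (metis not_le_imp_less pos_int_cases Suc_pred' )
  show ?thesis
  proof (rule fls_eqI)
    fix k
    have "fls_nth ((1 - signed_pow (2 * n)) * inv_qfact n) k
        = fls_nth (inv_qfact n) k - fls_nth (inv_qfact n) (k - 2 * n)"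
      by (simp add: left_diff_distrib signed_pow_nth)
    also have "\<dots> = fls_nth (inv_qfact (int m)) k"
    proof (cases "k < 0")
      case False
      then obtain j where j: "k = int j" by (metis nonneg_int_cases not_less)
      have nat_eq: "nat (int j - (2 + 2 * int m)) = j - (2 + 2 * m)" by arith
      show ?thesis
        unfolding m inv_qfact_nth j using num_multisets_Suc[of m j]
        by (auto simp: nat_eq)
    qed (use m in \<open>simp add: inv_qfact_nth del: of_nat_Suc\<close>)
    finally show "fls_nth ((1 - signed_pow (2 * n)) * inv_qfact n) k = fls_nth (inv_qfact (n - 1)) k"
      by (simp add: m)
  qed
qed

lemma one_minus_signed_pow_nonzero: "n > 0 \<Longrightarrow> 1 - signed_pow (2 * n) \<noteq> 0"
proof
  assume n: "n > 0" and "1 - signed_pow (2 * n) = 0"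
  then have "fls_nth (1 - signed_pow (2 * n) * 1) 0 = 0" by simp
  then show False using n by (subst (asm) fls_minus_nth, subst (asm) signed_pow_nth) auto
qed

definition qfact :: "nat \<Rightarrow> int fls" where
  "qfact n = (\<Prod>j=1..n. 1 - qpow (int j))"

lemma qfact_0 [simp]: "qfact 0 = 1"
  and qfact_Suc: "qfact (Suc n) = qfact n * (1 - signed_pow (2 * int (Suc n)))"
  by (simp_all add: qfact_def)

lemma inv_qfact_qfact: "inv_qfact (int n) * qfact n = 1"
proof (induction n)
  case (Suc n)
  have "inv_qfact (int (Suc n)) * qfact (Suc n)
      = ((1 - signed_pow (2 * int (Suc n))) * inv_qfact (int (Suc n))) * qfact n"
    unfolding qfact_Suc by (simp only: mult_ac)
  also have "\<dots> = 1"
    unfolding inv_qfact_rec using Suc by simp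
  finally show ?case .
qed simp

section \<open>Two \<open>q\<close>-Vandermonde identities\<close>

text \<open>
  The identity behind both summation formulas is
  \<open>1 - q\<^sup>a = (1 - q\<^sup>a\<^sup>-\<^sup>r) + q\<^sup>a\<^sup>-\<^sup>r (1 - q\<^sup>r)\<close>: the first summand lowers the argument \<open>a - r\<close> of
  an inverse factorial, the second the argument \<open>r\<close>.  After a shift of \<open>r\<close> in the second half,
  both halves have the shape of the sum for \<open>a - 1\<close>, and only the factor that depends on the further
  parameters, called \<open>w r\<close> in \<open>vandermonde_split_sum\<close>, has to be recombined.
\<close>

lemma vandermonde_split:
  fixes x :: "'a :: comm_ring_1"
  assumes "(1 - x) * PA = Pa" "(1 - y) * Pr = Pr1" "e1 = z * e0"
  shows "(1 - x * y) * (e1 * Pr * PA * w) = z * (e0 * Pr * Pa * w) + e1 * x * Pr1 * PA * w"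
  unfolding assms(1)[symmetric] assms(2)[symmetric] assms(3) by (simp add: algebra_simps)

lemma vandermonde_split_sum:
  fixes w :: "nat \<Rightarrow> int fls" and b :: int
  shows "(1 - signed_pow (2 * int (Suc a))) *
      (\<Sum>r\<le>Suc a. qpow ((int (Suc a) - int r) * (b - int r))
         * inv_qfact (int r) * inv_qfact (int (Suc a) - int r) * w r)
    = (\<Sum>r\<le>a. qpow ((int a - int r) * (b - int r)) * inv_qfact (int r) * inv_qfact (int a - int r)
         * (qpow (b - int r) * w r + w (Suc r)))"
proof -
  let ?s = qpow
  let ?A = "int (Suc a)"
  let ?e = "\<lambda>r. ?s ((?A - int r) * (b - int r))"
  let ?f = "\<lambda>r. ?s ((int a - int r) * (b - int r))"
  have split: "(1 - ?s ?A) * (?e r * inv_qfact (int r) * inv_qfact (?A - int r) * w r) =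
       ?s (b - int r) * (?f r * inv_qfact (int r) * inv_qfact (int a - int r) * w r)
     + ?e r * ?s (?A - int r) * inv_qfact (int r - 1) * inv_qfact (?A - int r) * w r" for r
  proof -
    have *: "?s ?A = ?s (?A - int r) * ?s (int r)"
      by (simp add: algebra_simps flip: signed_pow_add)
    show ?thesis
      unfolding *
    proof (rule vandermonde_split)
      show "(1 - ?s (?A - int r)) * inv_qfact (?A - int r) = inv_qfact (int a - int r)"
        unfolding inv_qfact_rec by (simp add: algebra_simps)
      show "(1 - ?s (int r)) * inv_qfact (int r) = inv_qfact (int r - 1)"
        by (rule inv_qfact_rec)
      show "?e r = ?s (b - int r) * ?f r"
        by (simp add: algebra_simps flip: signed_pow_add)
    qed
  qed
  have shift: "?e (Suc r) * ?s (?A - int (Suc r)) = ?f r" for r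
    by (simp add: algebra_simps flip: signed_pow_add)
  have "(1 - ?s ?A) * (\<Sum>r\<le>Suc a. ?e r * inv_qfact (int r) * inv_qfact (?A - int r) * w r)
      = (\<Sum>r\<le>Suc a. (1 - ?s ?A) * (?e r * inv_qfact (int r) * inv_qfact (?A - int r) * w r))"
    by (rule sum_distrib_left)
  also have "\<dots> = (\<Sum>r\<le>Suc a. ?s (b - int r) * (?f r * inv_qfact (int r) * inv_qfact (int a - int r) * w r))
      + (\<Sum>r\<le>Suc a. ?e r * ?s (?A - int r) * inv_qfact (int r - 1) * inv_qfact (?A - int r) * w r)"
    unfolding split by (rule sum.distrib)
  also have "(\<Sum>r\<le>Suc a. ?s (b - int r) * (?f r * inv_qfact (int r) * inv_qfact (int a - int r) * w r))
      = (\<Sum>r\<le>a. ?s (b - int r) * (?f r * inv_qfact (int r) * inv_qfact (int a - int r) * w r))"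
    by simp
  also have "(\<Sum>r\<le>Suc a. ?e r * ?s (?A - int r) * inv_qfact (int r - 1) * inv_qfact (?A - int r) * w r)
     = (\<Sum>r\<le>a. ?f r * inv_qfact (int r) * inv_qfact (int a - int r) * w (Suc r))"
    unfolding sum.atMost_Suc_shift shift by simp
  also have "(\<Sum>r\<le>a. ?s (b - int r) * (?f r * inv_qfact (int r) * inv_qfact (int a - int r) * w r))
      + (\<Sum>r\<le>a. ?f r * inv_qfact (int r) * inv_qfact (int a - int r) * w (Suc r))
     = (\<Sum>r\<le>a. ?f r * inv_qfact (int r) * inv_qfact (int a - int r) * (?s (b - int r) * w r + w (Suc r)))"
    unfolding sum.distrib[symmetric] by (simp only: distrib_left mult_ac)
  finally show ?thesis .
qed

text \<open>
  For \<open>b \<ge> 0\<close> this counts pairs of partitions by the size of a Durfee rectangle.  It says that \<open>a\<close>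
  particles of one kind and \<open>b\<close> of another may be regrouped: \<open>r\<close> pairs are bound together, and the
  unpaired rest interacts with the extra weight \<open>q\<^sup>(\<^sup>a\<^sup>-\<^sup>r\<^sup>)\<^sup>(\<^sup>b\<^sup>-\<^sup>r\<^sup>)\<close>.
\<close>

lemma durfee_identity:
  "(\<Sum>r\<le>a. qpow ((int a - int r) * (b - int r))
       * inv_qfact (int r) * inv_qfact (int a - int r) * inv_qfact (b - int r))
   = inv_qfact (int a) * inv_qfact b"
proof (induction a)
  case (Suc a)
  let ?s = qpow
  let ?A = "int (Suc a)"
  have w: "?s (b - int r) * inv_qfact (b - int r) + inv_qfact (b - int (Suc r)) = inv_qfact (b - int r)" for r
    using inv_qfact_rec[of "b - int r"] by (simp add: algebra_simps)
  have "(1 - ?s ?A) * (\<Sum>r\<le>Suc a. ?s ((?A - int r) * (b - int r))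
       * inv_qfact (int r) * inv_qfact (?A - int r) * inv_qfact (b - int r))
      = inv_qfact (int a) * inv_qfact b"
    unfolding vandermonde_split_sum w by (rule Suc.IH)
  also have "\<dots> = (1 - ?s ?A) * (inv_qfact ?A * inv_qfact b)"
    using inv_qfact_rec[of ?A] by (simp add: mult.assoc[symmetric])
  finally have "(1 - ?s ?A) * (\<Sum>r\<le>Suc a. ?s ((?A - int r) * (b - int r))
       * inv_qfact (int r) * inv_qfact (?A - int r) * inv_qfact (b - int r))
      = (1 - ?s ?A) * (inv_qfact ?A * inv_qfact b)" .
  moreover have "1 - ?s ?A \<noteq> 0" by (rule one_minus_signed_pow_nonzero) simp
  ultimately show ?case by (rule mult_left_cancel[THEN iffD1, rotated])
qed simp

text \<open>
  The recursion changes \<open>c\<close> to \<open>c + 1\<close>, hence the induction is over all \<open>c\<close> at once.  In the limit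
  \<open>c \<rightarrow> \<infinity>\<close> both sides become those of \<open>durfee_identity\<close>, multiplied by a common factor.
\<close>

lemma q_vandermonde:
  "(\<Sum>r\<le>a. qpow ((int a - int r) * (int b - int r))
       * inv_qfact (int r) * inv_qfact (int a - int r) * (inv_qfact (int b - int r) * inv_qfact (int c + int r)))
   = inv_qfact (int a) * inv_qfact (int b) * inv_qfact (int (a + c)) * inv_qfact (int (b + c)) * qfact (a + b + c)"
proof (induction a arbitrary: c)
  case 0
  have "inv_qfact (int (b + c)) * qfact (b + c) = 1"
    by (rule inv_qfact_qfact)
  then show ?case by (simp add: mult.assoc)
next
  case (Suc a)
  let ?s = qpow
  let ?A = "int (Suc a)"
  let ?w = "\<lambda>r. inv_qfact (int b - int r) * inv_qfact (int c + int r)"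
  let ?w' = "\<lambda>r. inv_qfact (int b - int r) * inv_qfact (int (Suc c) + int r)"
  have w: "?s (int b - int r) * ?w r + ?w (Suc r) = (1 - ?s (int (Suc (b + c)))) * ?w' r" for r
  proof -
    have 1: "inv_qfact (int b - int (Suc r)) = (1 - ?s (int b - int r)) * inv_qfact (int b - int r)"
      unfolding inv_qfact_rec by (simp add: algebra_simps)
    have 2: "inv_qfact (int c + int r) = (1 - ?s (int (Suc c) + int r)) * inv_qfact (int (Suc c) + int r)"
      unfolding inv_qfact_rec by (simp add: algebra_simps)
    have 3: "int c + int (Suc r) = int (Suc c) + int r" by simp
    have 4: "?s (int (Suc (b + c))) = ?s (int b - int r) * ?s (int (Suc c) + int r)"
      by (simp add: algebra_simps flip: signed_pow_add)
    show ?thesis unfolding 1 3 4 2 by (simp add: algebra_simps)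
  qed
  have "(1 - ?s ?A) * (\<Sum>r\<le>Suc a. ?s ((?A - int r) * (int b - int r))
       * inv_qfact (int r) * inv_qfact (?A - int r) * ?w r)
      = (\<Sum>r\<le>a. ?s ((int a - int r) * (int b - int r)) * inv_qfact (int r) * inv_qfact (int a - int r)
         * ((1 - ?s (int (Suc (b + c)))) * ?w' r))"
    unfolding vandermonde_split_sum w ..
  also have "\<dots> = (1 - ?s (int (Suc (b + c)))) * (\<Sum>r\<le>a. ?s ((int a - int r) * (int b - int r)) * inv_qfact (int r) * inv_qfact (int a - int r) * ?w' r)"
    by (simp add: sum_distrib_left mult_ac)
  also have "\<dots> = (1 - ?s (int (Suc (b + c)))) * (inv_qfact (int a) * inv_qfact (int b) * inv_qfact (int (a + Suc c))
         * inv_qfact (int (b + Suc c)) * qfact (a + b + Suc c))"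
    unfolding Suc.IH ..
  also have "\<dots> = ((1 - ?s (int (Suc (b + c)))) * inv_qfact (int (Suc (b + c)))) * inv_qfact (int a) * inv_qfact (int b)
         * inv_qfact (int (Suc a + c)) * qfact (Suc a + b + c)"
    by (simp add: mult_ac)
  also have "\<dots> = ((1 - ?s ?A) * inv_qfact ?A) * inv_qfact (int b) * inv_qfact (int (Suc a + c))
      * inv_qfact (int (b + c)) * qfact (Suc a + b + c)"
    unfolding inv_qfact_rec by (simp add: mult_ac)
  finally have "(1 - ?s ?A) * (\<Sum>r\<le>Suc a. ?s ((?A - int r) * (int b - int r))
       * inv_qfact (int r) * inv_qfact (?A - int r) * ?w r)
     = (1 - ?s ?A) * (inv_qfact ?A * inv_qfact (int b) * inv_qfact (int (Suc a + c))
      * inv_qfact (int (b + c)) * qfact (Suc a + b + c))"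
    by (simp only: mult.assoc)
  moreover have "1 - ?s ?A \<noteq> 0" by (rule one_minus_signed_pow_nonzero) simp
  ultimately show ?case by (rule mult_left_cancel[THEN iffD1, rotated])
qed

section \<open>Hall's identity for partitions\<close>

text \<open>
  Partitions of \<open>n\<close> into parts of size at most \<open>p\<close>, given by multiplicities: \<open>m i\<close> is the number of
  parts of size \<open>i + 1\<close>.
\<close>

definition part_mults :: "nat \<Rightarrow> nat \<Rightarrow> (nat \<Rightarrow> nat) set" where
  "part_mults p n = {m. (\<forall>i\<ge>p. m i = 0) \<and> (\<Sum>i<p. Suc i * m i) = n}"

lemma finite_part_mults [simp]: "finite (part_mults p n)"
proof (rule finite_subset)
  show "part_mults p n \<subseteq> {m. \<forall>i. (i \<in> {..<p} \<longrightarrow> m i \<in> {..n}) \<and> (i \<notin> {..<p} \<longrightarrow> m i = 0)}"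
  proof (clarsimp simp: part_mults_def not_less)
    fix m :: "nat \<Rightarrow> nat" and i assume "i < p"
    have "m i \<le> Suc i * m i" by simp
    also have "\<dots> \<le> (\<Sum>i<p. Suc i * m i)"
      using \<open>i < p\<close> by (intro member_le_sum) auto
    finally show "m i \<le> (\<Sum>i<p. m i + i * m i)" by simp
  qed
qed (intro finite_set_of_finite_funs; simp)

lemma part_mults_0: "part_mults p 0 = {\<lambda>_. 0}"
proof
  show "part_mults p 0 \<subseteq> {\<lambda>_. 0}"
  proof
    fix m assume m: "m \<in> part_mults p 0"
    have "m i = 0" for i
      using m by (cases "i < p") (auto simp: part_mults_def)
    then show "m \<in> {\<lambda>_. 0}" by auto
  qed
qed (simp add: part_mults_def)

text \<open>
  The sum of the squares of the parts of the conjugate partition.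
\<close>

definition min_form :: "nat \<Rightarrow> (nat \<Rightarrow> nat) \<Rightarrow> int" where
  "min_form p m = (\<Sum>i<p. \<Sum>j<p. int (min (Suc i) (Suc j)) * int (m i) * int (m j))"

definition hall_term :: "nat \<Rightarrow> (nat \<Rightarrow> nat) \<Rightarrow> int fls" where
  "hall_term p m = qpow (min_form p m) * (\<Prod>i<p. inv_qfact (int (m i)))"

text \<open>
  Removing the first column of the Young diagram, of length \<open>\<Sum> m i\<close>, lowers all parts by one.
\<close>

lemma min_form_Suc:
  "min_form (Suc p) m = (int (\<Sum>i<Suc p. m i))\<^sup>2 + min_form p (\<lambda>i. m (Suc i))"
proof -
  let ?c = "\<lambda>i j. int (m i) * int (m j)"
  have "min_form (Suc p) m
      = (\<Sum>i<Suc p. \<Sum>j<Suc p. ?c i j + int (min i j) * int (m i) * int (m j))"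
    unfolding min_form_def by (simp add: distrib_right)
  also have "\<dots> = (\<Sum>i<Suc p. \<Sum>j<Suc p. ?c i j) + (\<Sum>i<Suc p. \<Sum>j<Suc p. int (min i j) * int (m i) * int (m j))"
    by (simp only: sum.distrib)
  also have "(\<Sum>i<Suc p. \<Sum>j<Suc p. ?c i j) = (int (\<Sum>i<Suc p. m i))\<^sup>2"
    by (simp only: power2_eq_square sum_product of_nat_sum)
  also have "(\<Sum>i<Suc p. \<Sum>j<Suc p. int (min i j) * int (m i) * int (m j)) = min_form p (\<lambda>i. m (Suc i))"
    unfolding min_form_def by (simp only: sum.lessThan_Suc_shift) simp
  finally show ?thesis .
qed

lemma part_weight_Suc:
  "(\<Sum>i<Suc p. Suc i * m i) = (\<Sum>i<Suc p. m i) + (\<Sum>i<p. Suc i * m (Suc i))"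
proof -
  have "(\<Sum>i<Suc p. Suc i * m i) = (\<Sum>i<Suc p. m i + i * m i)" by simp
  also have "\<dots> = (\<Sum>i<Suc p. m i) + (\<Sum>i<Suc p. i * m i)" by (rule sum.distrib)
  also have "(\<Sum>i<Suc p. i * m i) = (\<Sum>i<p. Suc i * m (Suc i))"
    by (simp only: sum.lessThan_Suc_shift mult_0 add_0)
  finally show ?thesis .
qed

text \<open>
  The factor in front makes the sum recursive: when a first column of length \<open>r\<close> is put in
  front of a partition of length \<open>l\<close>, the number of parts of size \<open>1\<close> is \<open>r - l\<close>, and no such
  column exists if \<open>l > r\<close>.
\<close>

definition length_gf :: "nat \<Rightarrow> nat \<Rightarrow> int \<Rightarrow> int fls" where
  "length_gf p n r = (\<Sum>m\<in>part_mults p n. inv_qfact (r - int (\<Sum>i<p. m i)) * hall_term p m)"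

lemma sum_by_length:
  fixes w :: "nat \<Rightarrow> int fls"
  assumes "n > 0"
  shows "(\<Sum>m\<in>part_mults (Suc p) n. w (\<Sum>i<Suc p. m i) * hall_term (Suc p) m)
    = (\<Sum>s=1..n. w s * qpow ((int s)\<^sup>2) * length_gf p (n - s) (int s))"
proof -
  let ?shift = "\<lambda>m. (\<Sum>i<Suc p. m i, \<lambda>i. m (Suc i))"
  let ?unshift = "\<lambda>(s, m). case_nat (s - (\<Sum>i<p. m i)) m"
  let ?A = "SIGMA s:{1..n}. part_mults p (n - s)"
  let ?T = "{(s, m) \<in> ?A. (\<Sum>i<p. m i) \<le> s}"
  let ?f = "\<lambda>(s, m). w s * qpow ((int s)\<^sup>2) * (inv_qfact (int s - int (\<Sum>i<p. m i)) * hall_term p m)"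
  have "(\<Sum>s=1..n. w s * qpow ((int s)\<^sup>2) * length_gf p (n - s) (int s)) = (\<Sum>x\<in>?A. ?f x)"
    unfolding length_gf_def sum_distrib_left by (rule sum.Sigma) auto
  also have "\<dots> = (\<Sum>x\<in>?T. ?f x)"
  proof (rule sum.mono_neutral_right)
    show "\<forall>x\<in>?A - ?T. ?f x = 0"
    proof
      fix x assume "x \<in> ?A - ?T"
      then have "int (fst x) - int (\<Sum>i<p. snd x i) < 0" by (cases x) (auto simp flip: of_nat_sum)
      then have "inv_qfact (int (fst x) - int (\<Sum>i<p. snd x i)) = 0" by (rule inv_qfact_neg)
      then show "?f x = 0" by (cases x) (simp only: prod.case fst_conv snd_conv mult_zero_left mult_zero_right)
    qed
  qed auto
  also have "\<dots> = (\<Sum>m\<in>part_mults (Suc p) n. w (\<Sum>i<Suc p. m i) * hall_term (Suc p) m)"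
  proof (rule sum.reindex_bij_witness[where i = ?shift and j = ?unshift])
    fix a assume "a \<in> ?T"
    then obtain s m where a: "a = (s, m)" "1 \<le> s" "s \<le> n" "m \<in> part_mults p (n - s)" "(\<Sum>i<p. m i) \<le> s"
      by auto
    let ?m = "case_nat (s - (\<Sum>i<p. m i)) m"
    have s: "(\<Sum>i<Suc p. ?m i) = s"
      unfolding sum.lessThan_Suc_shift using a by simp
    show "?shift (?unshift a) = a"
      using a s by simp
    show "?unshift a \<in> part_mults (Suc p) n"
      unfolding part_mults_def mem_Collect_eq part_weight_Suc a(1) prod.case s
      using a by (auto simp: part_mults_def split: nat.splits)
    have "hall_term (Suc p) ?m = qpow ((int s)\<^sup>2) * (inv_qfact (int s - int (\<Sum>i<p. m i)) * hall_term p m)"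
      unfolding hall_term_def min_form_Suc s prod.lessThan_Suc_shift
      using a by (simp add: signed_pow_add distrib_left of_nat_diff mult_ac)
    then show "w (\<Sum>i<Suc p. ?unshift a i)
        * hall_term (Suc p) (?unshift a) = ?f a"
      unfolding a(1) prod.case s by (simp only: mult.assoc)
  next
    fix m assume m: "m \<in> part_mults (Suc p) n"
    let ?s = "\<Sum>i<Suc p. m i"
    have s: "?s = m 0 + (\<Sum>i<p. m (Suc i))"
      by (rule sum.lessThan_Suc_shift)
    have n: "n = ?s + (\<Sum>i<p. Suc i * m (Suc i))"
      using m unfolding part_mults_def part_weight_Suc by simp
    have "?s \<noteq> 0"
    proof
      assume "?s = 0"
      then have "m i = 0" if "i < Suc p" for i using that less_Suc_eq by auto
      then show False using n assms by simp
    qed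
    moreover have "(\<lambda>i. m (Suc i)) \<in> part_mults p (n - ?s)"
    proof -
      have "n - ?s = (\<Sum>i<p. Suc i * m (Suc i))" using n by linarith
      moreover have "\<forall>i\<ge>p. m (Suc i) = 0" using m by (simp add: part_mults_def)
      ultimately show ?thesis unfolding part_mults_def mem_Collect_eq by simp
    qed
    moreover have "?s \<le> n" "(\<Sum>i<p. m (Suc i)) \<le> ?s"
      using n s by linarith+
    ultimately show "?shift m \<in> ?T"
      unfolding mem_Collect_eq prod.case mem_Sigma_iff atLeastAtMost_iff by linarith
    have "?s - (\<Sum>i<p. m (Suc i)) = m 0" using s by simp
    then show "?unshift (?shift m) = m"
      unfolding prod.case by (auto simp: fun_eq_iff split: nat.split)
  qed
  finally show ?thesis ..
qed

text \<open>
  Grouping the partitions of \<open>n\<close> by their length \<open>t\<close> produces the factor \<open>length_coeff n t\<close>; the two sums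
  over \<open>t\<close> that arise are the identities above with the summation index reversed.
\<close>

definition length_coeff :: "nat \<Rightarrow> nat \<Rightarrow> int fls" where
  "length_coeff n t = qpow (int t * (int t - 1)) * inv_qfact (int t) * inv_qfact (int t - 1) * inv_qfact (int n - int t)"

lemma durfee_reversed: "(\<Sum>t\<le>n. length_coeff n t) = inv_qfact (int n) * inv_qfact (int n - 1)"
proof -
  have "(\<Sum>t\<le>n. length_coeff n t) = (\<Sum>k\<le>n. qpow ((int n - int k) * (int n - 1 - int k))
       * inv_qfact (int k) * inv_qfact (int n - int k) * inv_qfact (int n - 1 - int k))"
    by (rule sum.reindex_bij_witness[where i = "\<lambda>k. n - k" and j = "\<lambda>k. n - k"])
       (auto simp: length_coeff_def of_nat_diff algebra_simps)
  then show ?thesis unfolding durfee_identity .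
qed

text \<open>
  The sum is symmetric in \<open>n\<close> and \<open>r\<close>, so the parameter \<open>c = r - n\<close> may be taken non-negative.
\<close>

lemma q_vandermonde_reversed:
  assumes "n \<ge> 1" "r \<ge> 1"
  shows "(\<Sum>t\<le>n. inv_qfact (int r - int t) * length_coeff n t)
    = inv_qfact (int n) * inv_qfact (int r) * inv_qfact (int n - 1) * inv_qfact (int r - 1) * qfact (n + r - 1)"
    (is "?S n r = ?R n r")
proof -
  have le: "?S n r = ?R n r" if "1 \<le> n" "n \<le> r" for n r
  proof -
    have "?S n r = (\<Sum>k\<le>n. qpow ((int n - int k) * (int (n - 1) - int k))
       * inv_qfact (int k) * inv_qfact (int n - int k) * (inv_qfact (int (n - 1) - int k) * inv_qfact (int (r - n) + int k)))"
      by (rule sum.reindex_bij_witness[where i = "\<lambda>k. n - k" and j = "\<lambda>k. n - k"])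
         (use that in \<open>auto simp: length_coeff_def of_nat_diff algebra_simps\<close>)
    also have "\<dots> = ?R n r"
      unfolding q_vandermonde using that by (simp add: of_nat_diff mult_ac)
    finally show ?thesis .
  qed
  show ?thesis
  proof (cases "n \<le> r")
    case True
    then show ?thesis using assms le by simp
  next
    case False
    have "?S n r = (\<Sum>t\<le>r. inv_qfact (int r - int t) * length_coeff n t)"
      by (rule sum.mono_neutral_right) (use False in auto)
    also have "\<dots> = ?S r n"
      unfolding length_coeff_def by (simp only: mult_ac)
    also have "\<dots> = ?R r n"
      using False assms by (intro le) auto
    finally show ?thesis by (simp add: mult_ac add.commute)
  qed
qed

text \<open>
  In terms of the Gaussian binomial, \<open>q\<^sup>n [n + r - 1, n] / (q; q)\<^sub>r\<close>.
\<close>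

definition length_gf_value :: "nat \<Rightarrow> nat \<Rightarrow> int fls" where
  "length_gf_value n r = qpow (int n) * inv_qfact (int n) * inv_qfact (int r) * inv_qfact (int r - 1) * qfact (n + r - 1)"

lemma sum_by_length_value:
  assumes "n > 0" and closed: "\<And>t. t \<in> {1..n} \<Longrightarrow> length_gf p (n - t) (int t) = length_gf_value (n - t) t"
  shows "(\<Sum>m\<in>part_mults (Suc p) n. w (\<Sum>i<Suc p. m i) * hall_term (Suc p) m)
    = qpow (int n) * qfact (n - 1) * (\<Sum>t\<le>n. w t * length_coeff n t)"
proof -
  have "(\<Sum>m\<in>part_mults (Suc p) n. w (\<Sum>i<Suc p. m i) * hall_term (Suc p) m)
      = (\<Sum>t=1..n. qpow (int n) * qfact (n - 1) * (w t * length_coeff n t))"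
    unfolding sum_by_length[OF assms(1)]
  proof (rule sum.cong[OF refl])
    fix t assume t: "t \<in> {1..n}"
    have q: "qpow ((int t)\<^sup>2) * qpow (int (n - t)) = qpow (int n) * qpow (int t * (int t - 1))"
      using t by (simp add: of_nat_diff algebra_simps power2_eq_square flip: signed_pow_add)
    have "w t * qpow ((int t)\<^sup>2) * length_gf p (n - t) (int t) = (qpow ((int t)\<^sup>2) * qpow (int (n - t))) * w t
        * inv_qfact (int (n - t)) * inv_qfact (int t) * inv_qfact (int t - 1) * qfact (n - t + t - 1)"
      unfolding closed[OF t] length_gf_value_def by (simp only: mult_ac)
    also have "\<dots> = qpow (int n) * qfact (n - 1) * (w t * length_coeff n t)"
      unfolding q length_coeff_def using t by (simp add: of_nat_diff mult_ac)
    finally show "w t * qpow ((int t)\<^sup>2) * length_gf p (n - t) (int t) = \<dots>" .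
  qed
  also have "\<dots> = (\<Sum>t\<le>n. qpow (int n) * qfact (n - 1) * (w t * length_coeff n t))"
    by (rule sum.mono_neutral_left) (auto simp: not_le length_coeff_def)
  finally show ?thesis by (simp only: sum_distrib_left)
qed

lemma length_gf_closed:
  assumes "n \<le> p" "r \<ge> 1"
  shows "length_gf p n (int r) = length_gf_value n r"
  using assms
proof (induction p arbitrary: n r)
  case (Suc p)
  show ?case
  proof (cases "n = 0")
    case True
    then show ?thesis
      using inv_qfact_qfact[of "r - 1"] Suc.prems
      by (simp add: of_nat_diff part_mults_0 length_gf_def length_gf_value_def hall_term_def min_form_def mult.assoc)
  next
    case False
    have "length_gf (Suc p) n (int r) = qpow (int n) * qfact (n - 1) * (\<Sum>t\<le>n. inv_qfact (int r - int t) * length_coeff n t)"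
      unfolding length_gf_def[of "Suc p"] by (rule sum_by_length_value) (use False Suc in auto)
    also have "\<dots> = (inv_qfact (int (n - 1)) * qfact (n - 1)) * length_gf_value n r"
      using False Suc.prems
      by (subst q_vandermonde_reversed) (auto simp: length_gf_value_def of_nat_diff mult_ac)
    finally show ?thesis
      unfolding inv_qfact_qfact by simp
  qed
next
  case 0
  then show ?case
    using inv_qfact_qfact[of "r - 1"]
    by (simp add: of_nat_diff part_mults_0 length_gf_def length_gf_value_def hall_term_def min_form_def mult.assoc)
qed

text \<open>
  Philip Hall's identity: \<open>n\<close> identical particles may be regrouped into clusters of sizes
  \<open>1, 2, 3, \<dots>\<close> that interact by \<open>min\<close>.  The factor \<open>q\<^sup>n\<close> on the right is a rescaling of the variable.
\<close>

lemma hall_identity: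
  assumes "n \<le> p"
  shows "(\<Sum>m\<in>part_mults p n. hall_term p m) = qpow (int n) * inv_qfact (int n)"
proof (cases "n = 0")
  case True
  then show ?thesis by (simp add: part_mults_0 hall_term_def min_form_def)
next
  case False
  then obtain p' where p: "p = Suc p'" using assms by (cases p) auto
  have "(\<Sum>m\<in>part_mults p n. hall_term p m) = qpow (int n) * qfact (n - 1) * (\<Sum>t\<le>n. length_coeff n t)"
  proof -
    have "length_gf p' (n - t) (int t) = length_gf_value (n - t) t" if "t \<in> {1..n}" for t
      using that assms p by (intro length_gf_closed) auto
    then show ?thesis
      using sum_by_length_value[of n p' "\<lambda>_. 1"] False unfolding p by simp
  qed
  also have "\<dots> = (inv_qfact (int (n - 1)) * qfact (n - 1)) * (qpow (int n) * inv_qfact (int n))"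
    unfolding durfee_reversed using False by (simp add: of_nat_diff mult_ac)
  finally show ?thesis
    unfolding inv_qfact_qfact by simp
qed

section \<open>Linear and bilinear extension\<close>

text \<open>
  A configuration \<open>d\<close> of particles counts how often each label occurs.  The functions \<open>lin f\<close>,
  \<open>push g\<close> and \<open>bil B\<close> are the additive extensions of functions on labels to configurations, with values
  in the integers and in another monoid of configurations, and of functions on pairs of labels.
\<close>

definition lin :: "('l \<Rightarrow> int) \<Rightarrow> ('l \<Rightarrow>\<^sub>0 nat) \<Rightarrow> int" where
  "lin f d = (\<Sum>x\<in>keys d. int (lookup d x) * f x)"

lemma lin_superset:
  assumes "finite A" "keys d \<subseteq> A"
  shows "lin f d = (\<Sum>x\<in>A. int (lookup d x) * f x)"
  unfolding lin_def using assms by (intro sum.mono_neutral_left) (auto simp: in_keys_iff)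

lemma lin_0 [simp]: "lin f 0 = 0"
  by (simp add: lin_def)

lemma lin_add: "lin f (d + e) = lin f d + lin f e"
proof -
  let ?A = "keys d \<union> keys e"
  have "keys (d + e) \<subseteq> ?A" by (rule Poly_Mapping.keys_add)
  then show ?thesis
    by (simp add: lin_superset[of ?A] lookup_add distrib_right sum.distrib)
qed

lemma lin_single [simp]: "lin f (single x n) = int n * f x"
  by (cases "n = 0") (auto simp: lin_def)

lemma lin_fun_add: "lin (\<lambda>x. f x + g x) d = lin f d + lin g d"
  by (simp add: lin_def distrib_left sum.distrib)

lemma lin_fun_scale: "lin (\<lambda>x. c * f x) d = c * lin f d"
  by (simp add: lin_def sum_distrib_left mult_ac)

lemma lin_cong: "(\<And>x. x \<in> keys d \<Longrightarrow> f x = g x) \<Longrightarrow> lin f d = lin g d"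
  by (simp add: lin_def)

lemma lin_swap: "lin (\<lambda>x. lin (\<lambda>y. h x y) e) d = lin (\<lambda>y. lin (\<lambda>x. h x y) d) e"
  unfolding lin_def sum_distrib_left by (subst sum.swap) (simp add: mult_ac)

definition nscale :: "nat \<Rightarrow> ('a \<Rightarrow>\<^sub>0 nat) \<Rightarrow> ('a \<Rightarrow>\<^sub>0 nat)" where
  "nscale n d = Poly_Mapping.map ((*) n) d"

lemma lookup_scale [simp]: "lookup (nscale n d) x = n * lookup d x"
  by (simp add: nscale_def map.rep_eq when_def)

lemma scale_0 [simp]: "nscale 0 d = 0"
  by (rule poly_mapping_eqI) simp

lemma scale_1 [simp]: "nscale (Suc 0) d = d"
  by (rule poly_mapping_eqI) simp

lemma scale_add: "nscale (m + n) d = nscale m d + nscale n d"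
  by (rule poly_mapping_eqI) (simp add: lookup_add distrib_right)

lemma scale_single: "nscale n (single x m) = single x (n * m)"
  by (rule poly_mapping_eqI) (simp add: lookup_single when_def)

lemma scale_eq_0_iff [simp]: "nscale n d = 0 \<longleftrightarrow> n = 0 \<or> d = 0"
  by (auto simp: poly_mapping_eq_iff fun_eq_iff)

lemma keys_scale: "keys (nscale n d) \<subseteq> keys d"
  by (auto simp: in_keys_iff)

lemma lin_scale [simp]: "lin f (nscale n d) = int n * lin f d"
proof -
  have "lin f (nscale n d) = (\<Sum>x\<in>keys d. int (lookup (nscale n d) x) * f x)"
    by (rule lin_superset) (auto simp: in_keys_iff)
  then show ?thesis by (simp add: lin_def sum_distrib_left mult_ac)
qed

definition push :: "('l \<Rightarrow> 'a \<Rightarrow>\<^sub>0 nat) \<Rightarrow> ('l \<Rightarrow>\<^sub>0 nat) \<Rightarrow> ('a \<Rightarrow>\<^sub>0 nat)" where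
  "push g d = (\<Sum>x\<in>keys d. nscale (lookup d x) (g x))"

lemma lookup_push: "int (lookup (push g d) v) = lin (\<lambda>x. int (lookup (g x) v)) d"
  by (simp add: push_def lookup_sum lin_def)

lemma push_eqI:
  assumes "\<And>v. int (lookup c v) = lin (\<lambda>x. int (lookup (g x) v)) d"
  shows "push g d = c"
  by (rule poly_mapping_eqI) (metis assms lookup_push of_nat_eq_iff)

lemma lin_push: "lin f (push g d) = lin (\<lambda>x. lin f (g x)) d"
proof -
  have lin_sum: "lin f (sum h A) = (\<Sum>x\<in>A. lin f (h x))" if "finite A" for h A
    using that by (induction A) (auto simp: lin_add)
  show ?thesis
    unfolding push_def lin_def[of "\<lambda>x. lin f (g x)"] by (simp add: lin_sum)
qed

lemma push_push: "push g (push p d) = push (\<lambda>x. push g (p x)) d"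
  by (rule push_eqI) (simp add: lookup_push lin_push)

lemma push_0 [simp]: "push g 0 = 0"
  by (simp add: push_def)

lemma push_single [simp]: "push g (single x n) = nscale n (g x)"
  by (rule push_eqI) simp

lemma push_add: "push g (d + e) = push g d + push g e"
  by (rule push_eqI) (simp add: lin_add lookup_add lookup_push)

lemma push_cong: "(\<And>x. x \<in> keys d \<Longrightarrow> f x = g x) \<Longrightarrow> push f d = push g d"
  by (simp add: push_def)

lemma keys_push: "keys (push g d) \<subseteq> (\<Union>x\<in>keys d. keys (g x))"
proof
  fix v assume "v \<in> keys (push g d)"
  then have "(\<Sum>x\<in>keys d. lookup d x * lookup (g x) v) \<noteq> 0"
    by (simp add: in_keys_iff push_def lookup_sum)
  then obtain x where "x \<in> keys d" "lookup (g x) v \<noteq> 0"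
    by (metis (no_types, lifting) mult_is_0 sum.neutral)
  then show "v \<in> (\<Union>x\<in>keys d. keys (g x))"
    by (auto simp: in_keys_iff)
qed

abbreviation bil :: "('l \<Rightarrow> 'l \<Rightarrow> int) \<Rightarrow> ('l \<Rightarrow>\<^sub>0 nat) \<Rightarrow> ('l \<Rightarrow>\<^sub>0 nat) \<Rightarrow> int" where
  "bil B d e \<equiv> lin (\<lambda>x. lin (B x) e) d"

lemma bil_push: "bil B (push p d) (push p e) = bil (\<lambda>x y. bil B (p x) (p y)) d e"
  unfolding lin_push
proof (rule arg_cong[of _ _ "\<lambda>f. lin f d"], rule ext)
  fix x
  show "lin (\<lambda>z. lin (\<lambda>y. lin (B z) (p y)) e) (p x) = lin (\<lambda>y. lin (\<lambda>z. lin (B z) (p y)) (p x)) e"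
    by (rule lin_swap)
qed

lemma bil_cong:
  assumes "\<And>x y. x \<in> keys d \<Longrightarrow> y \<in> keys e \<Longrightarrow> B x y = B' x y"
  shows "bil B d e = bil B' d e"
  by (intro lin_cong) (simp add: assms)

lemma bil_sym:
  assumes "\<And>x y. x \<in> keys d \<Longrightarrow> y \<in> keys e \<Longrightarrow> B x y = B y x"
  shows "bil B d e = bil B e d"
proof -
  have "bil B d e = bil (\<lambda>x y. B y x) d e" by (rule bil_cong) (rule assms)
  also have "\<dots> = bil B e d" by (rule lin_swap)
  finally show ?thesis .
qed

definition weight :: "('a \<Rightarrow>\<^sub>0 nat) \<Rightarrow> nat" where
  "weight d = (\<Sum>x\<in>keys d. lookup d x)"

lemma int_weight: "int (weight d) = lin (\<lambda>_. 1) d"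
  by (simp add: weight_def lin_def)

lemma weight_0 [simp]: "weight 0 = 0"
  by (simp add: weight_def)

lemma weight_eq_0_iff [simp]: "weight d = 0 \<longleftrightarrow> d = 0"
  by (auto simp: weight_def poly_mapping_eq_iff fun_eq_iff in_keys_iff)

lemma weight_add: "weight (d + e) = weight d + weight e"
  by (metis int_weight lin_add of_nat_add of_nat_eq_iff)

lemma weight_scale: "weight (nscale n d) = n * weight d"
  by (metis int_weight lin_scale of_nat_mult of_nat_eq_iff)

lemma lookup_le_weight: "lookup d x \<le> weight d"
  unfolding weight_def by (cases "x \<in> keys d") (auto intro: member_le_sum simp: in_keys_iff)

lemma int_weight_push: "int (weight (push g d)) = lin (\<lambda>x. int (weight (g x))) d"
  by (simp add: int_weight lin_push)

lemma scale_le_weight_push: "lookup d x * weight (g x) \<le> weight (push g d)"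
proof (cases "x \<in> keys d")
  case True
  have "weight (push g d) = (\<Sum>x\<in>keys d. lookup d x * weight (g x))"
    using int_weight_push[of g d] unfolding lin_def by (simp flip: of_nat_mult of_nat_sum)
  with True show ?thesis
    using member_le_sum[of x "keys d" "\<lambda>x. lookup d x * weight (g x)"] by simp
qed (simp add: in_keys_iff)

lemma finite_bounded_supported:
  assumes "finite A"
  shows "finite {d :: 'l \<Rightarrow>\<^sub>0 nat. keys d \<subseteq> A \<and> (\<forall>x. lookup d x \<le> N)}"
    (is "finite ?S")
proof (rule finite_imageD)
  have "lookup ` ?S \<subseteq> {f. \<forall>x. (x \<in> A \<longrightarrow> f x \<in> {..N}) \<and> (x \<notin> A \<longrightarrow> f x = 0)}"
  proof (intro image_subsetI)
    fix d assume "d \<in> ?S"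
    then show "lookup d \<in> {f. \<forall>x. (x \<in> A \<longrightarrow> f x \<in> {..N}) \<and> (x \<notin> A \<longrightarrow> f x = 0)}"
      using in_keys_iff[of _ d] by blast
  qed
  then show "finite (lookup ` ?S)"
    by (rule finite_subset) (intro finite_set_of_finite_funs assms; simp)
  show "inj_on lookup ?S"
    by (rule inj_onI) (rule poly_mapping_eq_iff[THEN iffD2])
qed

lemma weight_le_finite:
  assumes "finite A"
  shows "finite {d :: 'l \<Rightarrow>\<^sub>0 nat. keys d \<subseteq> A \<and> weight d \<le> N}"
proof (rule finite_subset[OF _ finite_bounded_supported[OF assms, of N]], intro subsetI)
  fix d :: "'l \<Rightarrow>\<^sub>0 nat" assume d: "d \<in> {d. keys d \<subseteq> A \<and> weight d \<le> N}"
  then have "lookup d x \<le> N" for x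
    using lookup_le_weight[of d x] by simp
  with d show "d \<in> {d. keys d \<subseteq> A \<and> (\<forall>x. lookup d x \<le> N)}" by simp
qed

section \<open>Systems of interacting particles\<close>

text \<open>
  The data of a symmetric quiver whose vertices, the labels, may be infinite in number: \<open>form\<close> is its
  Euler form, the vertex \<open>x\<close> has the variable \<open>t\<^bsup>charge x\<^esup> (-q\<^sup>1\<^sup>/\<^sup>2)\<^bsup>shift x\<^esup>\<close>, and
  \<open>partition_fun\<close> gives the coefficients of its generating function.  For the original quiver the
  charges are the unit vectors and all shifts vanish.
\<close>

record ('l, 'v) particle_system =
  labels :: "'l set"
  charge :: "'l \<Rightarrow> 'v \<Rightarrow>\<^sub>0 nat"
  form :: "'l \<Rightarrow> 'l \<Rightarrow> int"
  shift :: "'l \<Rightarrow> int"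

definition configs :: "('l, 'v) particle_system \<Rightarrow> ('v \<Rightarrow>\<^sub>0 nat) \<Rightarrow> ('l \<Rightarrow>\<^sub>0 nat) set" where
  "configs P \<gamma> = {d. keys d \<subseteq> labels P \<and> push (charge P) d = \<gamma>}"

definition inv_qfacts :: "('l \<Rightarrow>\<^sub>0 nat) \<Rightarrow> int fls" where
  "inv_qfacts d = (\<Prod>x\<in>keys d. inv_qfact (int (lookup d x)))"

definition partition_fun :: "('l, 'v) particle_system \<Rightarrow> ('v \<Rightarrow>\<^sub>0 nat) \<Rightarrow> int fls" where
  "partition_fun P \<gamma> =
     (\<Sum>d\<in>configs P \<gamma>. signed_pow (bil (form P) d d + lin (shift P) d) * inv_qfacts d)"

lemma inv_qfacts_superset:
  assumes "finite A" "keys d \<subseteq> A"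
  shows "inv_qfacts d = (\<Prod>x\<in>A. inv_qfact (int (lookup d x)))"
  unfolding inv_qfacts_def using assms by (intro prod.mono_neutral_left) (auto simp: in_keys_iff)

definition locally_finite :: "('l, 'v) particle_system \<Rightarrow> bool" where
  "locally_finite P \<longleftrightarrow> (\<forall>x\<in>labels P. charge P x \<noteq> 0) \<and> (\<forall>N. finite {x \<in> labels P. weight (charge P x) \<le> N})"

lemma configs_bounds:
  assumes "locally_finite P" "d \<in> configs P \<gamma>" "x \<in> keys d"
  shows "lookup d x \<le> weight \<gamma>" "weight (charge P x) \<le> weight \<gamma>"
proof -
  have le: "lookup d x * weight (charge P x) \<le> weight \<gamma>"
    using assms scale_le_weight_push[of d x "charge P"] by (simp add: configs_def)
  have "0 < lookup d x" using assms(3) by (simp add: in_keys_iff)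
  moreover have "0 < weight (charge P x)"
    using assms weight_eq_0_iff[of "charge P x"] by (auto simp: configs_def locally_finite_def simp del: weight_eq_0_iff)
  ultimately have "lookup d x \<le> lookup d x * weight (charge P x)"
    "weight (charge P x) \<le> lookup d x * weight (charge P x)" by auto
  with le show "lookup d x \<le> weight \<gamma>" "weight (charge P x) \<le> weight \<gamma>"
    by linarith+
qed

lemma finite_configs:
  assumes "locally_finite P"
  shows "finite (configs P \<gamma>)"
proof (rule finite_subset)
  let ?A = "{x \<in> labels P. weight (charge P x) \<le> weight \<gamma>}"
  show "configs P \<gamma> \<subseteq> {d. keys d \<subseteq> ?A \<and> (\<forall>x. lookup d x \<le> weight \<gamma>)}"
  proof
    fix d assume d: "d \<in> configs P \<gamma>"
    have "lookup d x \<le> weight \<gamma>" for x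
      using configs_bounds(1)[OF assms d, of x] by (cases "x \<in> keys d") (auto simp: in_keys_iff)
    moreover have "keys d \<subseteq> ?A"
      using configs_bounds(2)[OF assms d] d by (auto simp: configs_def)
    ultimately show "d \<in> {d. keys d \<subseteq> ?A \<and> (\<forall>x. lookup d x \<le> weight \<gamma>)}"
      by simp
  qed
  show "finite {d. keys d \<subseteq> ?A \<and> (\<forall>x. lookup d x \<le> weight \<gamma>)}"
    by (rule finite_bounded_supported) (use assms in \<open>simp add: locally_finite_def\<close>)
qed

text \<open>
  The labels of \<open>P'\<close> are bound states of labels of \<open>P\<close>: the label \<open>x\<close> consists of the particles
  \<open>p x\<close> and inherits charge, form and shift from them, up to the corrections \<open>K\<close> and \<open>s\<close>.  The last
  clause is the identity that justifies the corrections: all ways to assemble a given configuration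
  \<open>d\<close> from bound states carry together the weight \<open>1 / (q)\<^sub>d\<close> of \<open>d\<close> itself.
\<close>

definition refines ::
  "('l, 'v) particle_system \<Rightarrow> ('m \<Rightarrow> 'l \<Rightarrow>\<^sub>0 nat) \<Rightarrow> ('m \<Rightarrow> 'm \<Rightarrow> int) \<Rightarrow> ('m \<Rightarrow> int)
     \<Rightarrow> ('m, 'v) particle_system \<Rightarrow> bool" where
  "refines P p K s P' \<longleftrightarrow>
     (\<forall>x\<in>labels P'. keys (p x) \<subseteq> labels P \<and> charge P' x = push (charge P) (p x) \<and>
        shift P' x = lin (shift P) (p x) + s x) \<and>
     (\<forall>x\<in>labels P'. \<forall>y\<in>labels P'. form P' x y = bil (form P) (p x) (p y) + K x y) \<and>
     (\<forall>d. keys d \<subseteq> labels P \<longrightarrow>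
        (\<Sum>e | keys e \<subseteq> labels P' \<and> push p e = d. signed_pow (bil K e e + lin s e) * inv_qfacts e)
          = inv_qfacts d)"

text \<open>
  Group the configurations of bound states by their content.  Within a group the exponent of
  \<open>-q\<^sup>1\<^sup>/\<^sup>2\<close> exceeds that of the content by the correction term only.
\<close>

lemma partition_fun_refines:
  assumes ref: "refines P p K s P'" and fin: "locally_finite P" "locally_finite P'"
  shows "partition_fun P' \<gamma> = partition_fun P \<gamma>"
proof -
  have charge: "push (charge P') e = push (charge P) (push p e)" if "keys e \<subseteq> labels P'" for e
  proof -
    have "push (charge P') e = push (\<lambda>x. push (charge P) (p x)) e"
      using that ref by (intro push_cong) (auto simp: refines_def)
    then show ?thesis by (simp add: push_push)
  qed
  have keys: "keys (push p e) \<subseteq> labels P" if "keys e \<subseteq> labels P'" for e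
    using that ref keys_push[of p e] unfolding refines_def by blast
  let ?w = "\<lambda>P d. signed_pow (bil (form P) d d + lin (shift P) d) * inv_qfacts d"
  have exponent: "bil (form P') e e + lin (shift P') e
      = (bil (form P) (push p e) (push p e) + lin (shift P) (push p e)) + (bil K e e + lin s e)"
    if e: "keys e \<subseteq> labels P'" for e
  proof -
    have "bil (form P') e e = bil (\<lambda>x y. bil (form P) (p x) (p y) + K x y) e e"
    proof (rule bil_cong)
      fix x y assume "x \<in> keys e" "y \<in> keys e"
      then have "x \<in> labels P'" "y \<in> labels P'" using e by auto
      then show "form P' x y = bil (form P) (p x) (p y) + K x y"
        using ref unfolding refines_def by blast
    qed
    also have "\<dots> = bil (form P) (push p e) (push p e) + bil K e e"
      by (simp only: lin_fun_add bil_push)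
    finally have "bil (form P') e e = bil (form P) (push p e) (push p e) + bil K e e" .
    moreover have "lin (shift P') e = lin (\<lambda>x. lin (shift P) (p x) + s x) e"
      using e ref by (intro lin_cong) (auto simp: refines_def)
    ultimately show ?thesis by (simp add: lin_fun_add lin_push)
  qed
  have "partition_fun P' \<gamma> = (\<Sum>d\<in>configs P \<gamma>. \<Sum>e | e \<in> configs P' \<gamma> \<and> push p e = d. ?w P' e)"
    unfolding partition_fun_def
  proof (rule sum.group[symmetric])
    show "push p ` configs P' \<gamma> \<subseteq> configs P \<gamma>"
      using charge keys by (auto simp: configs_def)
  qed (use fin finite_configs in blast)+
  also have "\<dots> = (\<Sum>d\<in>configs P \<gamma>. ?w P d)"
  proof (rule sum.cong[OF refl])
    fix d assume d: "d \<in> configs P \<gamma>"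
    have "{e \<in> configs P' \<gamma>. push p e = d} = {e. keys e \<subseteq> labels P' \<and> push p e = d}"
      using d charge by (auto simp: configs_def)
    then have "(\<Sum>e | e \<in> configs P' \<gamma> \<and> push p e = d. ?w P' e)
        = (\<Sum>e | keys e \<subseteq> labels P' \<and> push p e = d.
             signed_pow (bil (form P) d d + lin (shift P) d) * (signed_pow (bil K e e + lin s e) * inv_qfacts e))"
      by (intro sum.cong) (auto simp: exponent signed_pow_add mult_ac)
    also have "\<dots> = ?w P d"
      unfolding sum_distrib_left[symmetric] using ref d by (simp add: refines_def configs_def)
    finally show "(\<Sum>e | e \<in> configs P' \<gamma> \<and> push p e = d. ?w P' e) = ?w P d" .
  qed
  finally show ?thesis by (simp add: partition_fun_def)
qed

section \<open>Unlinking and splitting\<close>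

lemma lin_sum: "lin f (sum h A) = (\<Sum>x\<in>A. lin f (h x))"
  by (induction A rule: infinite_finite_induct) (auto simp: lin_add)

lemma lin_delta: "lin (\<lambda>x. if x = a then c else 0) d = int (lookup d a) * c"
proof -
  have "lin (\<lambda>x. if x = a then c else 0) d
      = (\<Sum>x\<in>insert a (keys d). int (lookup d x) * (if x = a then c else 0))"
    by (rule lin_superset) auto
  also have "\<dots> = (\<Sum>x\<in>insert a (keys d). if x = a then int (lookup d a) * c else 0)"
    by (rule sum.cong) auto
  finally show ?thesis by (simp add: sum.delta)
qed

lemma push_sum: "push g (sum h A) = (\<Sum>x\<in>A. push g (h x))"
  by (induction A rule: infinite_finite_induct) (auto simp: push_add)

lemma push_id:
  assumes "\<And>x. x \<in> keys d \<Longrightarrow> p x = single x 1"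
  shows "push p d = d"
proof (rule push_eqI)
  fix v
  have "lin (\<lambda>x. int (lookup (p x) v)) d = lin (\<lambda>x. if x = v then 1 else 0) d"
    by (rule lin_cong) (simp add: assms lookup_single when_def)
  then show "int (lookup d v) = lin (\<lambda>x. int (lookup (p x) v)) d"
    by (simp add: lin_delta)
qed

lemma inv_qfacts_add:
  assumes "keys d \<inter> keys e = {}"
  shows "inv_qfacts (d + e) = inv_qfacts d * inv_qfacts e"
proof -
  have eq: "lookup d x = 0" if "x \<in> keys e" for x
    using that assms in_keys_iff[of x d] by blast
  have eq': "lookup e x = 0" if "x \<in> keys d" for x
    using that assms in_keys_iff[of x e] by blast
  have "inv_qfacts (d + e) = (\<Prod>x\<in>keys d \<union> keys e.
      inv_qfact (int (lookup (d + e) x)))"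
    by (rule inv_qfacts_superset) (auto dest: Poly_Mapping.keys_add[THEN subsetD])
  also have "\<dots> = (\<Prod>x\<in>keys d. inv_qfact (int (lookup (d + e) x)))
      * (\<Prod>x\<in>keys e. inv_qfact (int (lookup (d + e) x)))"
    using assms by (intro prod.union_disjoint) auto
  finally show ?thesis by (simp add: inv_qfacts_def lookup_add eq eq' cong: prod.cong)
qed

lemma inv_qfacts_0 [simp]: "inv_qfacts 0 = 1"
  by (simp add: inv_qfacts_def)

lemma inv_qfacts_single [simp]: "inv_qfacts (single x n) = inv_qfact (int n)"
  by (cases "n = 0") (auto simp: inv_qfacts_def)

lemma inv_qfacts_sum_singles:
  assumes "inj_on h A"
  shows "inv_qfacts (\<Sum>k\<in>A. single (h k) (m k)) = (\<Prod>k\<in>A. inv_qfact (int (m k)))"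
  using assms
proof (induction A rule: infinite_finite_induct)
  case (insert k A)
  have "keys (\<Sum>k\<in>A. single (h k) (m k)) \<subseteq> h ` A"
  proof
    fix x assume "x \<in> keys (\<Sum>k\<in>A. single (h k) (m k))"
    then have "(\<Sum>k\<in>A. lookup (single (h k) (m k)) x) \<noteq> 0"
      by (simp add: in_keys_iff lookup_sum)
    then obtain k where "k \<in> A" "lookup (single (h k) (m k)) x \<noteq> 0"
      by (meson sum.neutral)
    then show "x \<in> h ` A" by (auto simp: lookup_single when_def split: if_splits)
  qed
  then have "inv_qfacts (single (h k) (m k) + (\<Sum>k\<in>A. single (h k) (m k)))
      = inv_qfact (int (m k)) * inv_qfacts (\<Sum>k\<in>A. single (h k) (m k))"
    using insert by (subst inv_qfacts_add) auto
  then show ?case using insert by simp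
qed auto

subsection \<open>Unlinking\<close>

definition link :: "'l \<Rightarrow> 'l \<Rightarrow> 'l \<Rightarrow> 'l \<Rightarrow> int" where
  "link i j x y = (if x = i then (if y = j then 1 else 0) else 0) + (if x = j then (if y = i then 1 else 0) else 0)"

lemma bil_link: "bil (link i j) d e =
  int (lookup d i) * int (lookup e j) + int (lookup d j) * int (lookup e i)"
proof -
  have "lin (link i j x) e = (if x = i then int (lookup e j) else 0) + (if x = j then int (lookup e i) else 0)" for x
    unfolding link_def lin_fun_add by (auto simp: lin_delta) (auto simp: lin_def)
  then show ?thesis
    by (simp add: lin_fun_add lin_delta)
qed

definition pair_content :: "'l \<Rightarrow> 'l \<Rightarrow> 'l \<Rightarrow> 'l \<Rightarrow> 'l \<Rightarrow>\<^sub>0 nat" where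
  "pair_content i j n x = (if x = n then single i 1 + single j 1 else single x 1)"

text \<open>
  The new label \<open>n\<close> is a pair made of \<open>i\<close> and \<open>j\<close>, and the entry of the form at \<open>i, j\<close> is raised by
  one, that is, one arrow between \<open>i\<close> and \<open>j\<close> is removed in each direction.
\<close>

definition unlink :: "'l \<Rightarrow> 'l \<Rightarrow> 'l \<Rightarrow> ('l, 'v) particle_system \<Rightarrow> ('l, 'v) particle_system" where
  "unlink i j n P = \<lparr>labels = insert n (labels P),
     charge = (\<lambda>x. push (charge P) (pair_content i j n x)),
     form = (\<lambda>x y. bil (form P) (pair_content i j n x) (pair_content i j n y) + link i j x y),
     shift = (\<lambda>x. lin (shift P) (pair_content i j n x))\<rparr>"

lemma lookup_push_pair_content:
  assumes "i \<noteq> j" "n \<noteq> i" "n \<noteq> j"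
  shows "lookup (push (pair_content i j n) e) v
    = (if v = n then 0 else lookup e v + (if v = i \<or> v = j then lookup e n else 0))"
proof -
  have "int (lookup (push (pair_content i j n) e) v)
      = lin (\<lambda>x. (if x = v then (if v = n then 0 else 1) else 0) + (if x = n then (if v = i \<or> v = j then 1 else 0) else 0)) e"
    unfolding lookup_push
    by (rule lin_cong) (use assms in \<open>auto simp: pair_content_def lookup_add lookup_single when_def\<close>)
  also have "\<dots> = int (if v = n then 0 else lookup e v + (if v = i \<or> v = j then lookup e n else 0))"
    using assms by (auto simp: lin_fun_add lin_delta)
  finally show ?thesis by linarith
qed

text \<open>
  A configuration \<open>d\<close> arises from those with \<open>r\<close> pairs, \<open>d i - r\<close> single \<open>i\<close> and \<open>d j - r\<close> single
  \<open>j\<close>, so the identity required is \<open>durfee_identity\<close>.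
\<close>

lemma unlink_refines:
  assumes i: "i \<in> labels P" and j: "j \<in> labels P" and ij: "i \<noteq> j" and n: "n \<notin> labels P"
  shows "refines P (pair_content i j n) (link i j) (\<lambda>_. 0) (unlink i j n P)"
proof -
  have ni: "n \<noteq> i" "n \<noteq> j" using assms by auto
  have local_identity: "(\<Sum>e | keys e \<subseteq> insert n (labels P) \<and> push (pair_content i j n) e = d.
        signed_pow (bil (link i j) e e + lin (\<lambda>_. 0) e) * inv_qfacts e) = inv_qfacts d" (is "?S = _")
    if d: "keys d \<subseteq> labels P" for d
  proof -
    let ?a = "lookup d i" and ?b = "lookup d j"
    define d0 where "d0 = Poly_Mapping.update i 0 (Poly_Mapping.update j 0 d)"
    have d0: "lookup d0 x = (if x = i \<or> x = j then 0 else lookup d x)" for x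
      by (simp add: d0_def lookup_update)
    have dn: "lookup d n = 0" using d n by (auto simp: in_keys_iff)
    have keys_d0: "i \<notin> keys d0" "j \<notin> keys d0" "n \<notin> keys d0"
      using dn by (simp_all add: in_keys_iff d0)
    \<comment> \<open>\<open>E r\<close> has \<open>r\<close> pairs and otherwise the particles of \<open>d\<close> that are not used up by them.\<close>
    define E where "E r = single n r + (single i (?a - r) + (single j (?b - r) + d0))" for r
    have E: "lookup (E r) x = (if x = n then r else if x = i then ?a - r else if x = j then ?b - r else lookup d x)" for r x
      using ij ni dn by (simp add: E_def lookup_add lookup_single d0 when_def)
    have E_qfacts: "inv_qfacts (E r) = inv_qfact (int r) * (inv_qfact (int (?a - r)) * (inv_qfact (int (?b - r)) * inv_qfacts d0))" for r
    proof -
      let ?s = "single :: 'a \<Rightarrow> nat \<Rightarrow> _"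
      have k1: "keys (?s j (?b - r)) \<inter> keys d0 = {}"
        using keys_d0 by (auto split: if_splits)
      have k2: "keys (?s i (?a - r)) \<inter> keys (?s j (?b - r) + d0) = {}"
        using keys_d0 ij Poly_Mapping.keys_add[of "?s j (?b - r)" d0] by (auto split: if_splits)
      have k3: "keys (?s n r) \<inter> keys (?s i (?a - r) + (?s j (?b - r) + d0)) = {}"
        using keys_d0 ni Poly_Mapping.keys_add[of "?s j (?b - r)" d0]
          Poly_Mapping.keys_add[of "?s i (?a - r)" "?s j (?b - r) + d0"] by (auto split: if_splits)
      show ?thesis
        unfolding E_def inv_qfacts_add[OF k3] inv_qfacts_add[OF k2] inv_qfacts_add[OF k1] by simp
    qed
    have d_qfacts: "inv_qfacts d = inv_qfact (int ?a) * inv_qfact (int ?b) * inv_qfacts d0"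
    proof -
      have "d = E 0" by (rule poly_mapping_eqI) (simp add: E dn)
      then show ?thesis using E_qfacts[of 0] by (simp add: mult.assoc)
    qed
    have "?S = (\<Sum>r\<in>{..min ?a ?b}. qpow ((int ?a - int r) * (int ?b - int r))
          * inv_qfact (int r) * inv_qfact (int ?a - int r) * inv_qfact (int ?b - int r) * inv_qfacts d0)"
    proof (rule sum.reindex_bij_witness[where i = E and j = "\<lambda>e. lookup e n"])
      fix e assume "e \<in> {e. keys e \<subseteq> insert n (labels P) \<and> push (pair_content i j n) e = d}"
      then have keys: "keys e \<subseteq> insert n (labels P)" and push: "push (pair_content i j n) e = d" by auto
      have de: "lookup d v
          = (if v = n then 0 else lookup e v + (if v = i \<or> v = j then lookup e n else 0))" for v
        using lookup_push_pair_content[OF ij ni, of e v] unfolding push .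
      show E_e: "E (lookup e n) = e"
        by (rule poly_mapping_eqI) (use de ni ij in \<open>simp add: E\<close>)
      show "lookup e n \<in> {..min ?a ?b}"
        using de[of i] de[of j] ni by simp
      then have le: "lookup e n \<le> ?a" "lookup e n \<le> ?b" by auto
      have lookups: "lookup e i = ?a - lookup e n" "lookup e j = ?b - lookup e n"
        using de[of i] de[of j] ni by auto
      have "inv_qfacts e = inv_qfacts (E (lookup e n))" by (simp only: E_e)
      moreover have "bil (link i j) e e + lin (\<lambda>_. 0) e = 2 * ((int ?a - int (lookup e n)) * (int ?b - int (lookup e n)))"
        unfolding bil_link lookups using le by (simp add: of_nat_diff lin_def)
      ultimately show "qpow ((int ?a - int (lookup e n)) * (int ?b - int (lookup e n)))
          * inv_qfact (int (lookup e n)) * inv_qfact (int ?a - int (lookup e n))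
          * inv_qfact (int ?b - int (lookup e n)) * inv_qfacts d0
          = signed_pow (bil (link i j) e e + lin (\<lambda>_. 0) e) * inv_qfacts e"
        unfolding E_qfacts using le by (simp add: of_nat_diff mult_ac)
    next
      fix r assume r: "r \<in> {..min ?a ?b}"
      show "lookup (E r) n = r" by (simp add: E)
      have "keys (E r) \<subseteq> insert n (labels P)"
      proof
        fix x assume "x \<in> keys (E r)"
        then have "x = n \<or> x = i \<or> x = j \<or> x \<in> keys d"
          by (auto simp: in_keys_iff E split: if_splits)
        then show "x \<in> insert n (labels P)" using i j d by auto
      qed
      moreover have "push (pair_content i j n) (E r) = d"
        by (rule poly_mapping_eqI) (use r ni ij dn in \<open>auto simp: lookup_push_pair_content[OF ij ni] E\<close>)
      ultimately show "E r \<in> {e. keys e \<subseteq> insert n (labels P) \<and> push (pair_content i j n) e = d}"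
        by simp
    qed
    \<comment> \<open>More than \<open>?b\<close> pairs cannot be formed; the added terms vanish.\<close>
    also have "\<dots> = (\<Sum>r\<le>?a. qpow ((int ?a - int r) * (int ?b - int r))
          * inv_qfact (int r) * inv_qfact (int ?a - int r) * inv_qfact (int ?b - int r) * inv_qfacts d0)"
      by (rule sum.mono_neutral_left) auto
    also have "\<dots> = inv_qfacts d"
      unfolding sum_distrib_right[symmetric] durfee_identity d_qfacts ..
    finally show ?thesis .
  qed
  have keys: "keys (pair_content i j n x) \<subseteq> labels P" if "x \<in> insert n (labels P)" for x
    using that i j Poly_Mapping.keys_add[of "single i 1" "single j 1 :: 'a \<Rightarrow>\<^sub>0 nat"]
    by (auto simp: pair_content_def split: if_splits)
  show ?thesis
    unfolding refines_def unlink_def particle_system.simps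
    using local_identity keys by auto
qed

subsection \<open>Splitting\<close>

text \<open>
  \<open>Bound t k\<close> is the \<open>k\<close>-th label introduced at time \<open>t\<close>.  The times serve to have infinitely many
  fresh labels at hand in every move.
\<close>

datatype 'v label = Vertex 'v | Bound nat nat

fun member_index :: "nat \<Rightarrow> 'v label \<Rightarrow> nat" where
  "member_index t (Bound u k) = (if u = t then k else 0)"
| "member_index t (Vertex v) = 0"

definition split_content :: "nat \<Rightarrow> 'v label \<Rightarrow> 'v label \<Rightarrow> 'v label \<Rightarrow>\<^sub>0 nat" where
  "split_content t n x =
     (if member_index t x = 0 then single x 1 else single n (member_index t x))"

text \<open>
  The label \<open>n\<close> is replaced by clusters \<open>Bound t 1, Bound t 2, \<dots>\<close>, where \<open>Bound t k\<close> consists of \<open>k\<close>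
  particles \<open>n\<close>.  The first cluster has the charge of \<open>n\<close> and a diagonal entry of the form that is larger by
  two, so it is \<open>n\<close> with two loops removed; its shift is smaller by two, so that its degree is that of \<open>n\<close>.
\<close>

definition split_label :: "nat \<Rightarrow> 'v label \<Rightarrow> ('v label, 'v) particle_system \<Rightarrow> ('v label, 'v) particle_system" where
  "split_label t n P = \<lparr>labels = (labels P - {n}) \<union> {x. member_index t x > 0},
     charge = (\<lambda>x. push (charge P) (split_content t n x)),
     form = (\<lambda>x y. bil (form P) (split_content t n x) (split_content t n y)
                   + 2 * int (min (member_index t x) (member_index t y))),
     shift = (\<lambda>x. lin (shift P) (split_content t n x) + - 2 * int (member_index t x))\<rparr>"

lemma member_index_pos: "member_index t x > 0 \<longleftrightarrow> (\<exists>k. x = Bound t (Suc k))"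
  by (cases x) (auto simp: gr0_conv_Suc)

text \<open>
  The clusters that contain \<open>a\<close> particles altogether are the partitions of \<open>a\<close>, and the identity
  required is \<open>hall_identity\<close>.
\<close>

lemma split_refines:
  fixes P :: "('v label, 'v) particle_system"
  assumes n: "n \<in> labels P" and fresh: "\<And>x. x \<in> labels P \<Longrightarrow> member_index t x = 0"
  shows "refines P (split_content t n) (\<lambda>x y. 2 * int (min (member_index t x) (member_index t y)))
           (\<lambda>x. - 2 * int (member_index t x)) (split_label t n P)"
proof -
  let ?L = "(labels P - {n}) \<union> {x. member_index t x > 0}"
  let ?p = "split_content t n"
  let ?K = "\<lambda>x y :: 'v label. 2 * int (min (member_index t x) (member_index t y)) :: int"
  let ?s = "\<lambda>x :: 'v label. - 2 * int (member_index t x)"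
  have local_identity: "(\<Sum>e | keys e \<subseteq> ?L \<and> push ?p e = d.
        signed_pow (bil ?K e e + lin ?s e) * inv_qfacts e) = inv_qfacts d" (is "?S = _")
    if d: "keys d \<subseteq> labels P" for d
  proof -
    define a where "a = lookup d n"
    define d0 where "d0 = Poly_Mapping.update n 0 d"
    have d0: "lookup d0 x = (if x = n then 0 else lookup d x)" for x
      by (simp add: d0_def lookup_update)
    have keys_d0: "keys d0 \<subseteq> labels P - {n}"
      using d by (auto simp: in_keys_iff d0 split: if_splits)
    have idx_d0: "member_index t x = 0" if "x \<in> keys d0" for x
      using that keys_d0 fresh by auto
    have d_split: "d = single n a + d0"
      by (rule poly_mapping_eqI) (simp add: lookup_add lookup_single d0 a_def when_def)
    have d_qfacts: "inv_qfacts d = inv_qfact (int a) * inv_qfacts d0"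
      unfolding d_split using keys_d0 by (subst inv_qfacts_add) (auto split: if_splits)
    have fresh_d: "lookup d x = 0" if "member_index t x > 0" for x
      using that fresh[of x] d by (auto simp: in_keys_iff)
    \<comment> \<open>\<open>F m\<close> consists of the clusters, \<open>m k\<close> of them with \<open>k + 1\<close> members each.  No cluster has more than \<open>a\<close>
      members, so partitions with parts up to \<open>a\<close> suffice.\<close>
    define F :: "(nat \<Rightarrow> nat) \<Rightarrow> 'v label \<Rightarrow>\<^sub>0 nat"
      where "F m = (\<Sum>k<a. single (Bound t (Suc k)) (m k))" for m
    define E where "E m = F m + d0" for m :: "nat \<Rightarrow> nat"
    have F_lookup: "lookup (F m) x = (if member_index t x \<in> {1..a} then m (member_index t x - 1) else 0)" for m x
    proof -
      have "lookup (F m) x = (\<Sum>k<a. if k = member_index t x - 1 \<and> member_index t x > 0 then m k else 0)"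
        unfolding F_def lookup_sum
        by (rule sum.cong[OF refl]) (cases x; auto simp: lookup_single when_def)
      also have "\<dots> = (if member_index t x \<in> {1..a} then m (member_index t x - 1) else 0)"
      proof (cases "member_index t x > 0")
        case True
        then show ?thesis by (auto simp: sum.delta)
      qed auto
      finally show ?thesis .
    qed
    have F_keys: "keys (F m) \<subseteq> {x. member_index t x > 0}" for m
      by (auto simp: in_keys_iff F_lookup split: if_splits)
    have E_qfacts: "inv_qfacts (E m) = (\<Prod>k<a. inv_qfact (int (m k))) * inv_qfacts d0" for m
    proof -
      have "keys (F m) \<inter> keys d0 = {}"
        using F_keys[of m] idx_d0 by fastforce
      moreover have "inv_qfacts (F m) = (\<Prod>k<a. inv_qfact (int (m k)))"
        unfolding F_def by (rule inv_qfacts_sum_singles) (auto intro: inj_onI)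
      ultimately show ?thesis by (simp add: E_def inv_qfacts_add)
    qed
    have E_push: "push ?p (E m) = single n (\<Sum>k<a. Suc k * m k) + d0" for m
    proof -
      have "push ?p (F m) = (\<Sum>k<a. single n (Suc k * m k))"
        unfolding F_def push_sum by (simp add: split_content_def scale_single mult.commute)
      also have "\<dots> = single n (\<Sum>k<a. Suc k * m k)"
        by (rule poly_mapping_eqI) (simp add: lookup_sum lookup_single when_def)
      finally show ?thesis
        unfolding E_def push_add by (subst push_id[of d0]) (auto simp: split_content_def idx_d0)
    qed
    have lin_E: "lin f (E m) = (\<Sum>k<a. int (m k) * f (Bound t (Suc k)))"
      if "\<And>x. member_index t x = 0 \<Longrightarrow> f x = 0" for f m
    proof -
      have "lin f d0 = 0" using that idx_d0 by (simp add: lin_def)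
      then show ?thesis by (simp add: E_def F_def lin_add lin_sum)
    qed
    have E_form: "bil ?K (E m) (E m) = 2 * min_form a m" for m
    proof -
      have "bil ?K (E m) (E m) = (\<Sum>k<a. int (m k) * (\<Sum>l<a. int (m l) * ?K (Bound t (Suc k) :: 'v label) (Bound t (Suc l))))"
        by (subst lin_E, simp add: lin_def, subst lin_E) auto
      also have "\<dots> = 2 * min_form a m"
        unfolding min_form_def sum_distrib_left by (intro sum.cong refl) (simp add: mult_ac)
      finally show ?thesis .
    qed
    have E_shift: "lin ?s (E m) = - 2 * int (\<Sum>k<a. Suc k * m k)" for m
      by (subst lin_E) (auto simp: sum_distrib_left algebra_simps intro!: sum.cong)
    have "?S = (\<Sum>m\<in>part_mults a a. signed_pow (- 2 * int a) * hall_term a m * inv_qfacts d0)"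
    proof (rule sum.reindex_bij_witness[where i = E and j = "\<lambda>e k. lookup e (Bound t (Suc k))"])
      fix e assume "e \<in> {e. keys e \<subseteq> ?L \<and> push ?p e = d}"
      then have keys: "keys e \<subseteq> ?L" and push: "push ?p e = d" by auto
      let ?m = "\<lambda>k. lookup e (Bound t (Suc k))"
      have de: "int (lookup d v) = lin (\<lambda>x. int (lookup (?p x) v)) e" for v
        using lookup_push[of ?p e v] unfolding push .
      have le: "member_index t x * lookup e x \<le> a" if x: "x \<in> keys e" for x
      proof -
        have "int (lookup e x) * int (lookup (?p x) n) \<le> int a"
          unfolding a_def de lin_def by (rule member_le_sum) (use x in auto)
        then have "int (member_index t x * lookup e x) \<le> int a"
          by (simp add: split_content_def mult.commute split: if_splits)
        then show ?thesis by linarith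
      qed
      have zero: "?m k = 0" if "k \<ge> a" for k
      proof (rule ccontr)
        assume nz: "?m k \<noteq> 0"
        then have "Suc k * ?m k \<le> a" using le[of "Bound t (Suc k)"] by (simp add: in_keys_iff)
        moreover have "Suc k * 1 \<le> Suc k * ?m k" using nz by (intro mult_le_mono2) simp
        ultimately have "Suc k * 1 \<le> a" by (rule order.trans[rotated])
        then show False using that by simp
      qed
      have old: "lookup d x = lookup e x" if "member_index t x = 0" "x \<noteq> n" for x
      proof -
        have "int (lookup d x) = lin (\<lambda>y. if y = x then 1 else 0) e"
          unfolding de by (rule lin_cong) (use that in \<open>auto simp: split_content_def lookup_single when_def\<close>)
        then show ?thesis by (simp add: lin_delta)
      qed
      have "n \<notin> ?L" using fresh n by auto
      then have en: "lookup e n = 0" using keys by (auto simp: in_keys_iff)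
      show E_e: "E ?m = e"
      proof (rule poly_mapping_eqI)
        fix x
        show "lookup (E ?m) x = lookup e x"
        proof (cases "member_index t x = 0")
          case True
          then show ?thesis using old[of x] en by (simp add: E_def lookup_add F_lookup d0)
        next
          case False
          then obtain k where k: "x = Bound t (Suc k)" using member_index_pos by blast
          have "x \<noteq> n" using False fresh n by auto
          then show ?thesis using k zero[of k] fresh_d[of x] by (simp add: E_def lookup_add F_lookup d0)
        qed
      qed
      have sum_m: "(\<Sum>k<a. Suc k * ?m k) = a"
        using arg_cong[OF E_push[of ?m], of "\<lambda>f. lookup f n"]
        unfolding E_e push by (simp add: lookup_add d0 a_def)
      then show "?m \<in> part_mults a a" using zero by (simp add: part_mults_def)
      have "signed_pow (bil ?K e e + lin ?s e) * inv_qfacts e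
          = signed_pow (bil ?K (E ?m) (E ?m) + lin ?s (E ?m)) * inv_qfacts (E ?m)"
        unfolding E_e ..
      also have "\<dots> = signed_pow (- 2 * int a) * hall_term a ?m * inv_qfacts d0"
        unfolding E_form E_shift sum_m E_qfacts signed_pow_add hall_term_def by (simp only: mult_ac)
      finally show "signed_pow (- 2 * int a) * hall_term a ?m * inv_qfacts d0
          = signed_pow (bil ?K e e + lin ?s e) * inv_qfacts e" ..
    next
      fix m assume m: "m \<in> part_mults a a"
      have keys: "keys (E m) \<subseteq> ?L"
        using Poly_Mapping.keys_add[of "F m" d0] F_keys[of m] keys_d0 unfolding E_def by blast
      moreover have "push ?p (E m) = d"
        unfolding E_push using m d_split by (simp add: part_mults_def)
      ultimately show "E m \<in> {e. keys e \<subseteq> ?L \<and> push ?p e = d}" by simp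
      show "(\<lambda>k. lookup (E m) (Bound t (Suc k))) = m"
      proof
        fix k
        have "lookup d0 (Bound t (Suc k)) = 0"
          using fresh_d[of "Bound t (Suc k)"] by (simp add: d0)
        then show "lookup (E m) (Bound t (Suc k)) = m k"
          using m by (auto simp: E_def lookup_add F_lookup part_mults_def)
      qed
    qed
    also have "\<dots> = signed_pow (- 2 * int a) * (\<Sum>m\<in>part_mults a a. hall_term a m) * inv_qfacts d0"
      by (simp only: sum_distrib_left sum_distrib_right)
    also have "\<dots> = (signed_pow (- 2 * int a) * qpow (int a)) * (inv_qfact (int a) * inv_qfacts d0)"
      by (subst hall_identity) (simp_all add: mult_ac)
    also have "\<dots> = inv_qfacts d"
      by (simp add: d_qfacts flip: signed_pow_add)
    finally show ?thesis .
  qed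
  have keys: "keys (?p x) \<subseteq> labels P" if "x \<in> ?L" for x
    using that n by (auto simp: split_content_def split: if_splits)
  show ?thesis
    unfolding refines_def split_label_def particle_system.simps
    using local_identity keys by auto
qed

section \<open>Bounds preserved by the moves\<close>

abbreviation label_weight :: "('l, 'v) particle_system \<Rightarrow> 'l \<Rightarrow> nat" where
  "label_weight P x \<equiv> weight (charge P x)"

text \<open>
  These properties hold for the vertices of a symmetric quiver with Euler form \<open>chi\<close> and survive both
  moves.  The number \<open>form P x x + shift P x\<close> will be the degree \<open>k\<close> of the generators that \<open>x\<close>
  contributes.  The lower bound for it comes from the comparison of \<open>form\<close> with \<open>chi\<close>; the upper bound says that
  \<open>k - 2\<close> is at most an additive function of the charge, and is preserved because neither move lets
  \<open>k - 2\<close> grow faster than additively.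
\<close>

definition admissible :: "'v set \<Rightarrow> ('v \<Rightarrow> 'v \<Rightarrow> int) \<Rightarrow> ('l, 'v) particle_system \<Rightarrow> bool" where
  "admissible V chi P \<longleftrightarrow> locally_finite P \<and>
     (\<forall>x\<in>labels P. keys (charge P x) \<subseteq> V) \<and>
     (\<forall>x\<in>labels P. \<forall>y\<in>labels P. form P x y = form P y x \<and>
        bil chi (charge P x) (charge P y) \<le> form P x y \<and> (x \<noteq> y \<longrightarrow> form P x y \<le> 0)) \<and>
     (\<forall>x\<in>labels P. form P x x \<le> 1 \<and> even (form P x x - bil chi (charge P x) (charge P x)) \<and>
        even (shift P x) \<and> shift P x \<le> 0 \<and>
        bil chi (charge P x) (charge P x) \<le> form P x x + shift P x \<and>
        form P x x + shift P x - 2 \<le> lin (\<lambda>v. chi v v - 2) (charge P x))"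

lemma admissibleD:
  assumes "admissible V chi P"
  shows "locally_finite P" "\<And>x. x \<in> labels P \<Longrightarrow> keys (charge P x) \<subseteq> V"
    "\<And>x y. x \<in> labels P \<Longrightarrow> y \<in> labels P \<Longrightarrow> form P x y = form P y x"
    "\<And>x y. x \<in> labels P \<Longrightarrow> y \<in> labels P \<Longrightarrow> bil chi (charge P x) (charge P y) \<le> form P x y"
    "\<And>x y. x \<in> labels P \<Longrightarrow> y \<in> labels P \<Longrightarrow> x \<noteq> y \<Longrightarrow> form P x y \<le> 0"
    "\<And>x. x \<in> labels P \<Longrightarrow> form P x x \<le> 1"
    "\<And>x. x \<in> labels P \<Longrightarrow> even (form P x x - bil chi (charge P x) (charge P x))"
    "\<And>x. x \<in> labels P \<Longrightarrow> even (shift P x)" "\<And>x. x \<in> labels P \<Longrightarrow> shift P x \<le> 0"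
    "\<And>x. x \<in> labels P \<Longrightarrow> bil chi (charge P x) (charge P x) \<le> form P x x + shift P x"
    "\<And>x. x \<in> labels P \<Longrightarrow> form P x x + shift P x - 2 \<le> lin (\<lambda>v. chi v v - 2) (charge P x)"
  using assms unfolding admissible_def by blast+

lemma admissible_pos: "admissible V chi P \<Longrightarrow> x \<in> labels P \<Longrightarrow> label_weight P x > 0"
  using weight_eq_0_iff by (auto simp: admissible_def locally_finite_def simp del: weight_eq_0_iff)

lemma unlink_simps:
  assumes "i \<in> labels P" "j \<in> labels P" "n \<notin> labels P"
  shows "labels (unlink i j n P) = insert n (labels P)"
    "charge (unlink i j n P) n = charge P i + charge P j"
    "form (unlink i j n P) n n = form P i i + form P i j + (form P j i + form P j j)"
    "shift (unlink i j n P) n = shift P i + shift P j"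
    "x \<in> labels P \<Longrightarrow> charge (unlink i j n P) x = charge P x"
    "x \<in> labels P \<Longrightarrow> shift (unlink i j n P) x = shift P x"
    "x \<in> labels P \<Longrightarrow> form (unlink i j n P) x n = form P x i + form P x j"
    "x \<in> labels P \<Longrightarrow> form (unlink i j n P) n x = form P i x + form P j x"
    "x \<in> labels P \<Longrightarrow> y \<in> labels P \<Longrightarrow> form (unlink i j n P) x y = form P x y + link i j x y"
  using assms
  by (auto simp: unlink_def pair_content_def push_add lin_add link_def)

lemma link_simps: "i \<noteq> j \<Longrightarrow> link i j x x = 0" "link i j x y = link i j y x" "0 \<le> link i j x y"
  "link i j x y \<noteq> 0 \<Longrightarrow> i \<noteq> j \<Longrightarrow> link i j x y = 1 \<and> (x = i \<and> y = j \<or> x = j \<and> y = i)"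
  by (auto simp: link_def split: if_splits)

text \<open>
  For the new label, \<open>k = k\<^sub>i + k\<^sub>j + 2 form i j\<close>.  As \<open>form i j \<le> -1\<close>, this gives
  \<open>k - 2 \<le> (k\<^sub>i - 2) + (k\<^sub>j - 2)\<close>.  Its entry with \<open>i\<close> is \<open>form i i + form i j \<le> 1 - 1\<close>, so the
  off-diagonal entries stay non-positive.
\<close>

lemma unlink_admissible:
  assumes adm: "admissible V chi P" and i: "i \<in> labels P" and j: "j \<in> labels P" and n: "n \<notin> labels P"
    and ij: "i \<noteq> j" and neg: "form P i j < 0"
    and chi: "\<And>u v. u \<in> V \<Longrightarrow> v \<in> V \<Longrightarrow> chi u v = chi v u"
  shows "admissible V chi (unlink i j n P)"
proof -
  let ?U = "unlink i j n P"
  let ?c = "\<lambda>x y. bil chi (charge P x) (charge P y)"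
  note S = unlink_simps[OF i j n]
  note A = admissibleD[OF adm]
  have c_sym: "?c x y = ?c y x" if "x \<in> labels P" "y \<in> labels P" for x y
    by (rule bil_sym) (use A(2)[OF that(1)] A(2)[OF that(2)] chi in auto)
  have c_n: "bil chi (charge ?U n) (charge ?U n) = ?c i i + ?c i j + (?c j i + ?c j j)"
    by (simp add: S lin_add lin_fun_add)
  have c_nx: "bil chi (charge ?U n) (charge ?U x) = ?c i x + ?c j x"
      "bil chi (charge ?U x) (charge ?U n) = ?c x i + ?c x j" if "x \<in> labels P" for x
    using that by (simp_all add: S lin_add lin_fun_add)
  have f_n: "form P x i + form P x j \<le> 0" if "x \<in> labels P" for x
  proof (cases "x = i \<or> x = j")
    case True
    then show ?thesis using A(6)[OF i] A(6)[OF j] A(3)[OF i j] neg by auto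
  next
    case False
    then show ?thesis using A(5)[OF that i] A(5)[OF that j] by auto
  qed
  have "locally_finite ?U"
    unfolding locally_finite_def
  proof (intro conjI ballI allI)
    fix x assume "x \<in> labels ?U"
    then consider "x \<in> labels P" | "x = n" by (auto simp: S)
    then show "charge ?U x \<noteq> 0"
    proof cases
      case 1
      then show ?thesis using A(1) by (simp add: S locally_finite_def)
    next
      case 2
      have "label_weight P i > 0" by (rule admissible_pos[OF adm i])
      then have "weight (charge P i + charge P j) > 0" by (simp add: weight_add)
      then show ?thesis using 2 S(2) weight_eq_0_iff by (metis less_numeral_extra(3))
    qed
  next
    fix N
    have "{x \<in> labels ?U. label_weight ?U x \<le> N} \<subseteq> insert n {x \<in> labels P. label_weight P x \<le> N}"
      by (auto simp: S)
    then show "finite {x \<in> labels ?U. label_weight ?U x \<le> N}"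
      by (rule finite_subset) (use A(1) in \<open>simp add: locally_finite_def\<close>)
  qed
  moreover have "keys (charge ?U x) \<subseteq> V" if "x \<in> labels ?U" for x
  proof (cases "x = n")
    case True
    then show ?thesis using Poly_Mapping.keys_add[of "charge P i" "charge P j"] A(2)[OF i] A(2)[OF j] by (auto simp: S)
  qed (use that A(2) in \<open>auto simp: S\<close>)
  moreover have "form ?U x y = form ?U y x \<and> bil chi (charge ?U x) (charge ?U y) \<le> form ?U x y \<and>
      (x \<noteq> y \<longrightarrow> form ?U x y \<le> 0)" if xy: "x \<in> labels ?U" "y \<in> labels ?U" for x y
  proof -
    consider "x = n" "y = n" | "x = n" "y \<in> labels P" | "x \<in> labels P" "y = n" | "x \<in> labels P" "y \<in> labels P"
      using xy unfolding S by blast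
    then show ?thesis
    proof cases
      case 1
      show ?thesis unfolding 1 c_n using A(4)[OF i j] A(4)[OF j i] A(4)[OF i i] A(4)[OF j j] by (simp add: S)
    next
      case 2
      show ?thesis unfolding 2(1) c_nx[OF 2(2)]
        using A(4)[OF i 2(2)] A(4)[OF j 2(2)] f_n[OF 2(2)] A(3)[OF i 2(2)] A(3)[OF j 2(2)] 2(2) by (simp add: S)
    next
      case 3
      show ?thesis unfolding 3(2) c_nx[OF 3(1)]
        using A(4)[OF 3(1) i] A(4)[OF 3(1) j] f_n[OF 3(1)] A(3)[OF i 3(1)] A(3)[OF j 3(1)] 3(1) by (simp add: S)
    next
      case 4
      have "form P x y + link i j x y \<le> 0" if "x \<noteq> y"
        using link_simps(4)[of i j x y] ij neg A(3)[OF i j] A(5)[OF 4 that] by (cases "link i j x y = 0") auto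
      then show ?thesis using A(3)[OF 4] A(4)[OF 4] link_simps(3)[of i j x y] 4 by (simp add: S link_simps(2)[of i j y x])
    qed
  qed
  moreover have "form ?U x x \<le> 1 \<and> even (form ?U x x - bil chi (charge ?U x) (charge ?U x)) \<and>
        even (shift ?U x) \<and> shift ?U x \<le> 0 \<and>
        bil chi (charge ?U x) (charge ?U x) \<le> form ?U x x + shift ?U x \<and>
        form ?U x x + shift ?U x - 2 \<le> lin (\<lambda>v. chi v v - 2) (charge ?U x)" if "x \<in> labels ?U" for x
  proof (cases "x = n")
    case True
    have "form ?U n n - bil chi (charge ?U n) (charge ?U n)
        = (form P i i - ?c i i) + (form P j j - ?c j j) + 2 * (form P i j - ?c i j)"
      unfolding c_n S(3) using A(3)[OF i j] c_sym[OF i j] by simp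
    moreover have "even ((form P i i - ?c i i) + (form P j j - ?c j j) + 2 * (form P i j - ?c i j))"
      using A(7)[OF i] A(7)[OF j] by simp
    ultimately have "even (form ?U n n - bil chi (charge ?U n) (charge ?U n))" by simp
    moreover have "lin (\<lambda>v. chi v v - 2) (charge ?U n) = lin (\<lambda>v. chi v v - 2) (charge P i) + lin (\<lambda>v. chi v v - 2) (charge P j)"
      by (simp add: S lin_add)
    ultimately show ?thesis
      unfolding True c_n S(3) S(4)
      using A(3,4)[OF i j] c_sym[OF i j] neg A(6,8-11)[OF i] A(6,8-11)[OF j] by simp
  next
    case False
    then have "x \<in> labels P" using that by (simp add: S)
    then show ?thesis using A(6-11) ij by (simp add: S link_simps)
  qed
  ultimately show ?thesis unfolding admissible_def by blast
qed

text \<open>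
  Every label of the split system is a multiple of an old one: \<open>split_mult t x\<close> copies of
  \<open>split_base t n x\<close>.
\<close>

definition split_base :: "nat \<Rightarrow> 'v label \<Rightarrow> 'v label \<Rightarrow> 'v label" where
  "split_base t n x = (if member_index t x = 0 then x else n)"

definition split_mult :: "nat \<Rightarrow> 'v label \<Rightarrow> nat" where
  "split_mult t x = (if member_index t x = 0 then 1 else member_index t x)"

lemma split_simps:
  "labels (split_label t n P) = (labels P - {n}) \<union> {x. member_index t x > 0}"
  "charge (split_label t n P) x = nscale (split_mult t x) (charge P (split_base t n x))"
  "form (split_label t n P) x y = int (split_mult t x) * int (split_mult t y) * form P (split_base t n x) (split_base t n y)
     + 2 * int (min (member_index t x) (member_index t y))"
  "shift (split_label t n P) x = int (split_mult t x) * shift P (split_base t n x) - 2 * int (member_index t x)"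
proof -
  have c: "split_content t n x = single (split_base t n x) (split_mult t x)" for x
    by (simp add: split_content_def split_base_def split_mult_def)
  show "labels (split_label t n P) = (labels P - {n}) \<union> {x. member_index t x > 0}"
    by (simp add: split_label_def)
  show "charge (split_label t n P) x = nscale (split_mult t x) (charge P (split_base t n x))"
    by (simp add: split_label_def c)
  show "form (split_label t n P) x y = int (split_mult t x) * int (split_mult t y) * form P (split_base t n x) (split_base t n y)
     + 2 * int (min (member_index t x) (member_index t y))"
    by (simp add: split_label_def c)
  show "shift (split_label t n P) x = int (split_mult t x) * shift P (split_base t n x) - 2 * int (member_index t x)"
    by (simp add: split_label_def c)
qed

text \<open>
  Here \<open>B\<close> and \<open>s\<close> are the diagonal entry and the shift of the label that is split, and \<open>k\<close>, \<open>l\<close> are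
  cluster sizes.  The \<open>k\<close>-th cluster has degree \<open>k\<^sup>2 B + k s\<close>: the term \<open>2 k\<close> of its form is compensated by
  its shift.  The last two inequalities keep this degree within the bounds of \<open>admissible\<close>.
\<close>

lemma split_form_bounds:
  fixes B s c L :: int and k l :: nat
  assumes B: "B < 0"
  shows "k \<noteq> l \<Longrightarrow> int k * int l * B + 2 * int (min k l) \<le> 0"
    and "int k * int k * B + 2 * int k \<le> 1"
    and "s \<le> 0 \<Longrightarrow> c \<le> B + s \<Longrightarrow> int k * int k * c \<le> int k * int k * B + int k * s"
    and "k > 0 \<Longrightarrow> B + s - 2 \<le> L \<Longrightarrow> int k * int k * B + int k * s - 2 \<le> int k * L"
proof -
  have *: "int k * int l * B + 2 * int k \<le> 0" if "k < l" for k l :: nat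
  proof (cases "k = 0")
    case False
    then have "int l * B \<le> int l * (-1)" using B by (intro mult_left_mono) auto
    then have "int l * B + 2 \<le> 0" using that False by linarith
    then have "int k * (int l * B + 2) \<le> 0" by (simp add: mult_nonneg_nonpos)
    then show ?thesis by (simp add: algebra_simps)
  qed simp
  show "int k * int l * B + 2 * int (min k l) \<le> 0" if "k \<noteq> l"
    using *[of k l] *[of l k] that by (cases "k < l") (auto simp: min_def mult.commute)
  show "int k * int k * B + 2 * int k \<le> 1"
  proof -
    have "int k * int k * B \<le> int k * int k * (-1)" using B by (intro mult_left_mono) auto
    moreover have "0 \<le> (int k - 1) * (int k - 1)" by simp
    ultimately show ?thesis by (simp add: algebra_simps)
  qed
  show "int k * int k * c \<le> int k * int k * B + int k * s" if "s \<le> 0" "c \<le> B + s"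
  proof -
    have "int k * int k * c \<le> int k * int k * (B + s)" using that by (intro mult_left_mono) auto
    moreover have "int k * int k * s \<le> int k * s"
    proof (cases "k = 0")
      case False
      then have "int k * s \<le> 1 * s" using that by (intro mult_right_mono_neg) auto
      then have "int k * (int k * s) \<le> int k * s" by (intro mult_left_mono) auto
      then show ?thesis by (simp add: mult.assoc)
    qed simp
    ultimately show ?thesis by (simp add: algebra_simps)
  qed
  show "int k * int k * B + int k * s - 2 \<le> int k * L" if "k > 0" "B + s - 2 \<le> L"
  proof -
    have "int k * (B + s - 2) \<le> int k * L" using that by (intro mult_left_mono) auto
    moreover have "int k * int k * B - int k * B \<le> 2 - 2 * int k"
    proof (cases "k = 1")
      case False
      then have k: "2 \<le> int k" using that by linarith
      have "int k * B \<le> int k * (-1)" using B by (intro mult_left_mono) auto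
      then have "int k * B \<le> - 2" using k by linarith
      then have "(int k - 1) * (int k * B) \<le> (int k - 1) * (- 2)" using k by (intro mult_left_mono) auto
      then show ?thesis by (simp add: algebra_simps)
    qed simp
    ultimately show ?thesis by (simp add: algebra_simps)
  qed
qed

lemma split_admissible:
  assumes adm: "admissible V chi P" and n: "n \<in> labels P" and neg: "form P n n < 0"
    and fresh: "\<And>x. x \<in> labels P \<Longrightarrow> member_index t x = 0"
  shows "admissible V chi (split_label t n P)"
proof -
  let ?U = "split_label t n P"
  let ?c = "\<lambda>x y. bil chi (charge P x) (charge P y)"
  let ?b = "split_base t n" and ?m = "split_mult t" and ?i = "member_index t"
  note S = split_simps[of t n P]
  note A = admissibleD[OF adm]
  have b: "?b x \<in> labels P" "?m x > 0" if "x \<in> labels ?U" for x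
    using that n by (auto simp: S split_base_def split_mult_def)
  have c: "bil chi (charge ?U x) (charge ?U y) = int (?m x) * int (?m y) * ?c (?b x) (?b y)" for x y
    by (simp add: S lin_fun_scale)
  have "locally_finite ?U"
    unfolding locally_finite_def
  proof (intro conjI ballI allI)
    fix x assume "x \<in> labels ?U"
    then show "charge ?U x \<noteq> 0" using b[of x] A(1) by (simp add: S locally_finite_def)
  next
    fix N
    have "{x \<in> labels ?U. label_weight ?U x \<le> N} \<subseteq> {x \<in> labels P. label_weight P x \<le> N} \<union> Bound t ` {..N}"
    proof
      fix x assume x: "x \<in> {x \<in> labels ?U. label_weight ?U x \<le> N}"
      show "x \<in> {x \<in> labels P. label_weight P x \<le> N} \<union> Bound t ` {..N}"
      proof (cases "?i x = 0")
        case True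
        then show ?thesis using x by (simp add: S split_base_def split_mult_def)
      next
        case False
        then obtain k where k: "x = Bound t (Suc k)" using member_index_pos by blast
        have "Suc k * 1 \<le> Suc k * label_weight P n"
          using admissible_pos[OF adm n] by (intro mult_le_mono) auto
        also have "\<dots> \<le> N" using x by (simp add: S k split_base_def split_mult_def weight_scale)
        finally show ?thesis using k by auto
      qed
    qed
    then show "finite {x \<in> labels ?U. label_weight ?U x \<le> N}"
      by (rule finite_subset) (use A(1) in \<open>simp add: locally_finite_def\<close>)
  qed
  moreover have "keys (charge ?U x) \<subseteq> V" if "x \<in> labels ?U" for x
    using keys_scale[of "?m x" "charge P (?b x)"] A(2)[OF b(1)[OF that]] by (simp add: S)
  moreover have "form ?U x y = form ?U y x \<and> bil chi (charge ?U x) (charge ?U y) \<le> form ?U x y \<and>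
      (x \<noteq> y \<longrightarrow> form ?U x y \<le> 0)" if x: "x \<in> labels ?U" and y: "y \<in> labels ?U" for x y
  proof -
    have "form ?U x y = form ?U y x"
      using A(3)[OF b(1)[OF x] b(1)[OF y]] by (simp add: S min.commute mult.commute)
    moreover have "bil chi (charge ?U x) (charge ?U y) \<le> form ?U x y"
    proof -
      have "int (?m x) * int (?m y) * ?c (?b x) (?b y) \<le> int (?m x) * int (?m y) * form P (?b x) (?b y)"
        using A(4)[OF b(1)[OF x] b(1)[OF y]] by (intro mult_left_mono) auto
      then show ?thesis unfolding c S(3) by linarith
    qed
    moreover have "form ?U x y \<le> 0" if ne: "x \<noteq> y"
    proof (cases "?i x > 0 \<and> ?i y > 0")
      case True
      then have "?i x \<noteq> ?i y" using ne member_index_pos[of t x] member_index_pos[of t y] by auto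
      then show ?thesis
        using split_form_bounds(1)[OF neg, of "?i x" "?i y"] True by (simp add: S split_base_def split_mult_def)
    next
      case False
      have "?b x \<noteq> ?b y"
        using False ne x y fresh n by (auto simp: S split_base_def)
      then have "form P (?b x) (?b y) \<le> 0" using A(5) b(1)[OF x] b(1)[OF y] by blast
      then have "int (?m x) * int (?m y) * form P (?b x) (?b y) \<le> 0"
        by (simp add: mult_nonneg_nonpos)
      then show ?thesis using False by (auto simp: S)
    qed
    ultimately show ?thesis by blast
  qed
  moreover have "form ?U x x \<le> 1 \<and> even (form ?U x x - bil chi (charge ?U x) (charge ?U x)) \<and>
        even (shift ?U x) \<and> shift ?U x \<le> 0 \<and>
        bil chi (charge ?U x) (charge ?U x) \<le> form ?U x x + shift ?U x \<and>
        form ?U x x + shift ?U x - 2 \<le> lin (\<lambda>v. chi v v - 2) (charge ?U x)" if x: "x \<in> labels ?U" for x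
  proof (cases "?i x = 0")
    case True
    then have "x \<in> labels P" using x by (simp add: S)
    then show ?thesis using A(6-11) True by (simp add: S split_base_def split_mult_def)
  next
    case False
    define k where "k = ?i x"
    have k: "?m x = k" "?b x = n" "?i x = k" "k > 0"
      using False by (simp_all add: k_def split_mult_def split_base_def)
    have "form ?U x x - bil chi (charge ?U x) (charge ?U x)
        = int k * int k * (form P n n - ?c n n) + 2 * int k"
      unfolding c S(3) k by (simp add: algebra_simps)
    moreover have "even (int k * int k * (form P n n - ?c n n) + 2 * int k)"
      using A(7)[OF n] by simp
    ultimately have "even (form ?U x x - bil chi (charge ?U x) (charge ?U x))" by simp
    moreover have "shift ?U x \<le> 0"
    proof -
      have "int k * shift P n \<le> 0" using A(9)[OF n] by (simp add: mult_nonneg_nonpos)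
      then show ?thesis unfolding S(4) k by simp
    qed
    moreover have "even (shift ?U x)" unfolding S(4) k using A(8)[OF n] by simp
    moreover have "form ?U x x \<le> 1" unfolding S(3) k using split_form_bounds(2)[OF neg, of k] by simp
    moreover have "bil chi (charge ?U x) (charge ?U x) \<le> form ?U x x + shift ?U x"
      unfolding c S(3,4) k using split_form_bounds(3)[OF neg A(9)[OF n] A(10)[OF n], of k] by simp
    moreover have "form ?U x x + shift ?U x - 2 \<le> lin (\<lambda>v. chi v v - 2) (charge ?U x)"
      unfolding S(2,3,4) k lin_scale using split_form_bounds(4)[OF neg k(4) A(11)[OF n]] by simp
    ultimately show ?thesis by blast
  qed
  ultimately show ?thesis unfolding admissible_def by blast
qed

section \<open>Decoupling degree by degree\<close>

definition bounded_labels :: "('v label, 'w) particle_system \<Rightarrow> bool" where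
  "bounded_labels P \<longleftrightarrow> (\<exists>t. \<forall>u k. Bound u k \<in> labels P \<longrightarrow> u < t)"

definition unlinked_upto :: "nat \<Rightarrow> ('l, 'v) particle_system \<Rightarrow> bool" where
  "unlinked_upto s P \<longleftrightarrow> (\<forall>x\<in>labels P. \<forall>y\<in>labels P. x \<noteq> y \<longrightarrow>
     label_weight P x + label_weight P y \<le> s \<longrightarrow> form P x y = 0)"

definition split_upto :: "nat \<Rightarrow> ('l, 'v) particle_system \<Rightarrow> bool" where
  "split_upto s P \<longleftrightarrow> (\<forall>x\<in>labels P. label_weight P x \<le> s \<longrightarrow> 0 \<le> form P x x)"

text \<open>
  Only diagonal entries are compared: labels that are already decoupled from each other may still be
  linked to heavier ones and be affected by later moves in this way.
\<close>

definition agree_upto :: "nat \<Rightarrow> ('l, 'v) particle_system \<Rightarrow> ('l, 'v) particle_system \<Rightarrow> bool" where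
  "agree_upto s P P' \<longleftrightarrow>
     {x \<in> labels P'. label_weight P' x \<le> s} = {x \<in> labels P. label_weight P x \<le> s} \<and>
     (\<forall>x\<in>labels P. label_weight P x \<le> s \<longrightarrow>
        charge P' x = charge P x \<and> form P' x x = form P x x \<and> shift P' x = shift P x)"

lemma agree_upto_refl: "agree_upto s P P"
  by (simp add: agree_upto_def)

lemma agree_upto_trans: "agree_upto s P P' \<Longrightarrow> agree_upto s P' P'' \<Longrightarrow> agree_upto s P P''"
  unfolding agree_upto_def by (auto simp: set_eq_iff)

lemma agree_upto_mono: "agree_upto s P P' \<Longrightarrow> r \<le> s \<Longrightarrow> agree_upto r P P'"
  unfolding agree_upto_def set_eq_iff mem_Collect_eq by (metis le_trans)

lemma agree_upto_split: "agree_upto s P P' \<Longrightarrow> split_upto s P \<Longrightarrow> split_upto s P'"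
  unfolding agree_upto_def split_upto_def set_eq_iff mem_Collect_eq by metis

lemma ex_fresh:
  fixes P :: "('v label, 'w) particle_system"
  assumes "bounded_labels P"
  obtains t where "\<And>x. x \<in> labels P \<Longrightarrow> member_index t x = 0" "\<And>k. Bound t k \<notin> labels P"
    "\<And>u k. Bound u k \<in> labels P \<Longrightarrow> u < t"
proof -
  obtain t where t: "\<And>u k. Bound u k \<in> labels P \<Longrightarrow> u < t"
    using assms unfolding bounded_labels_def by blast
  have "member_index t x = 0" if "x \<in> labels P" for x
    using that t by (cases x) force+
  then show ?thesis using t that by blast
qed

text \<open>
  Each unlinking raises one pair of negative entries among the finitely many pairs of joint weight
  \<open>s + 1\<close>.  The new label has weight \<open>s + 1\<close> itself, so all pairs that involve it are heavier.
\<close>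

lemma unlink_level:
  fixes P :: "('v label, 'v) particle_system"
  assumes chi: "\<And>u v. u \<in> V \<Longrightarrow> v \<in> V \<Longrightarrow> chi u v = chi v u"
    and "admissible V chi P" "bounded_labels P" "unlinked_upto s P"
  shows "\<exists>P'. admissible V chi P' \<and> bounded_labels P' \<and> unlinked_upto (Suc s) P' \<and> agree_upto s P P' \<and>
     partition_fun P' = partition_fun P"
proof -
  define pairs where "pairs P = {(x, y). x \<in> labels P \<and> y \<in> labels P \<and> x \<noteq> y \<and>
     label_weight P x + label_weight P y = Suc s}" for P :: "('v label, 'v) particle_system"
  define mu where "mu P = (\<Sum>(x, y)\<in>pairs P. nat (- form P x y))" for P
  show ?thesis
    using assms(2-4)
  proof (induction "mu P" arbitrary: P rule: less_induct)
    case less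
    note adm = less.prems(1)
    have lf: "locally_finite P" using adm by (simp add: admissible_def)
    show ?case
    proof (cases "\<exists>(i, j)\<in>pairs P. form P i j < 0")
      case False
      have "unlinked_upto (Suc s) P"
        unfolding unlinked_upto_def
      proof (intro ballI impI)
        fix x y assume xy: "x \<in> labels P" "y \<in> labels P" "x \<noteq> y" "label_weight P x + label_weight P y \<le> Suc s"
        show "form P x y = 0"
        proof (cases "label_weight P x + label_weight P y = Suc s")
          case True
          then have "(x, y) \<in> pairs P" using xy by (simp add: pairs_def)
          then have "\<not> form P x y < 0" using False by blast
          moreover have "form P x y \<le> 0" using adm xy unfolding admissible_def by blast
          ultimately show ?thesis by simp
        next
          case False
          then show ?thesis using less.prems(3) xy by (simp add: unlinked_upto_def)
        qed
      qed
      then show ?thesis using less.prems agree_upto_refl by blast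
    next
      case True
      then obtain i j where ij: "i \<in> labels P" "j \<in> labels P" "i \<noteq> j" "form P i j < 0"
        "label_weight P i + label_weight P j = Suc s"
        by (auto simp: pairs_def)
      obtain t where t: "\<And>k. Bound t k \<notin> labels P" "\<And>u k. Bound u k \<in> labels P \<Longrightarrow> u < t"
        using ex_fresh[OF less.prems(2)] by metis
      define n :: "'v label" where "n = Bound t 0"
      have n: "n \<notin> labels P" using t(1) by (simp add: n_def)
      let ?U = "unlink i j n P"
      note S = unlink_simps[OF ij(1,2) n]
      have admU: "admissible V chi ?U"
        by (rule unlink_admissible[OF adm ij(1,2) n ij(3,4) chi])
      have w_n: "label_weight ?U n = Suc s" using ij(5) by (simp add: S weight_add)
      have pos: "label_weight P x > 0" if "x \<in> labels P" for x
        by (rule admissible_pos[OF adm that])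
      have "bounded_labels ?U"
        unfolding bounded_labels_def S using t(2) by (intro exI[of _ "Suc t"]) (auto simp: n_def less_Suc_eq)
      moreover have agree: "agree_upto s P ?U"
        using ij(3) w_n by (auto simp: agree_upto_def S link_simps)
      moreover have "unlinked_upto s ?U"
        unfolding unlinked_upto_def
      proof (intro ballI impI)
        fix x y assume xy: "x \<in> labels ?U" "y \<in> labels ?U" "x \<noteq> y" "label_weight ?U x + label_weight ?U y \<le> s"
        then have "x \<noteq> n" "y \<noteq> n" using w_n by auto
        then have xy': "x \<in> labels P" "y \<in> labels P" using xy by (auto simp: S)
        then have le: "label_weight P x + label_weight P y \<le> s" using xy by (simp add: S)
        then have "link i j x y = 0"
          using link_simps(4)[of i j x y] ij(3,5) by fastforce
        moreover have "form P x y = 0" using less.prems(3) xy xy' le by (simp add: unlinked_upto_def)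
        ultimately show "form ?U x y = 0" using xy' by (simp add: S)
      qed
      moreover have "mu ?U < mu P"
      proof -
        have eq: "pairs ?U = pairs P"
        proof -
          have "x \<noteq> n \<and> y \<noteq> n" if "(x, y) \<in> pairs ?U" for x y
          proof -
            have "label_weight ?U x > 0" "label_weight ?U y > 0"
              using that admissible_pos[OF admU] by (auto simp: pairs_def)
            moreover have "label_weight ?U x + label_weight ?U y = Suc s" using that by (simp add: pairs_def)
            ultimately have "label_weight ?U x \<noteq> Suc s" "label_weight ?U y \<noteq> Suc s" by linarith+
            then show ?thesis using w_n by blast
          qed
          then show ?thesis unfolding pairs_def using n by (auto simp: S)
        qed
        have fin: "finite (pairs P)"
        proof (rule finite_subset)
          show "pairs P \<subseteq> {x \<in> labels P. label_weight P x \<le> Suc s} \<times> {x \<in> labels P. label_weight P x \<le> Suc s}"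
            by (auto simp: pairs_def)
        qed (use lf in \<open>simp add: locally_finite_def\<close>)
        have "form P x y \<le> form ?U x y" if "(x, y) \<in> pairs P" for x y
          using that link_simps(3)[of i j x y] by (simp add: pairs_def S)
        then have "\<forall>(x, y)\<in>pairs P. nat (- form ?U x y) \<le> nat (- form P x y)" by force
        moreover have "(i, j) \<in> pairs P" using ij by (simp add: pairs_def)
        moreover have "nat (- form ?U i j) < nat (- form P i j)"
          using ij by (simp add: S link_def)
        ultimately show ?thesis
          unfolding mu_def eq
          by (intro sum_strict_mono_ex1 fin bexI[of _ "(i, j)"]) auto
      qed
      ultimately obtain P' where P': "admissible V chi P'" "bounded_labels P'" "unlinked_upto (Suc s) P'"
          "agree_upto s ?U P'" "partition_fun P' = partition_fun ?U"
        using less.hyps[of ?U] admU by blast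
      have "partition_fun ?U = partition_fun P"
        by (rule ext, rule partition_fun_refines[OF unlink_refines[OF ij(1-3) n] lf])
           (use admU in \<open>simp add: admissible_def\<close>)
      then show ?thesis using P' agree agree_upto_trans by metis
    qed
  qed
qed

text \<open>
  Among the labels of weight \<open>s + 1\<close>, splitting replaces one diagonal entry by one that is larger by two.
  All other clusters, and all pairs that involve a new label, are heavier.
\<close>

lemma split_level:
  fixes P :: "('v label, 'v) particle_system"
  assumes "admissible V chi P" "bounded_labels P" "unlinked_upto (Suc s) P" "split_upto s P"
  shows "\<exists>P'. admissible V chi P' \<and> bounded_labels P' \<and> unlinked_upto (Suc s) P' \<and> split_upto (Suc s) P' \<and>
     agree_upto s P P' \<and> partition_fun P' = partition_fun P"
proof -
  define level where "level P = {x \<in> labels P. label_weight P x = Suc s}" for P :: "('v label, 'v) particle_system"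
  define mu where "mu P = (\<Sum>x\<in>level P. nat (- form P x x))" for P
  show ?thesis
    using assms
  proof (induction "mu P" arbitrary: P rule: less_induct)
    case less
    note adm = less.prems(1)
    have lf: "locally_finite P" using adm by (simp add: admissible_def)
    show ?case
    proof (cases "\<exists>n\<in>level P. form P n n < 0")
      case False
      then have "split_upto (Suc s) P"
        using less.prems(4) by (auto simp: split_upto_def level_def le_Suc_eq not_less)
      then show ?thesis using less.prems agree_upto_refl by blast
    next
      case True
      then obtain n where n: "n \<in> labels P" "label_weight P n = Suc s" "form P n n < 0"
        by (auto simp: level_def)
      obtain t where t: "\<And>x. x \<in> labels P \<Longrightarrow> member_index t x = 0" "\<And>u k. Bound u k \<in> labels P \<Longrightarrow> u < t"
        using ex_fresh[OF less.prems(2)] by metis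
      let ?U = "split_label t n P"
      note S = split_simps[of t n P]
      have admU: "admissible V chi ?U"
        by (rule split_admissible[OF adm n(1,3) t(1)])
      have old: "x \<noteq> n" "charge ?U x = charge P x" "shift ?U x = shift P x"
        if "x \<in> labels ?U" "member_index t x = 0" for x
        using that by (auto simp: S split_base_def split_mult_def)
      have old_form: "form ?U x y = form P x y" if "member_index t x = 0" "member_index t y = 0" for x y
        using that by (auto simp: S split_base_def split_mult_def)
      have new: "label_weight ?U x = member_index t x * Suc s" if "member_index t x > 0" for x
        using that n(2) by (simp add: S split_base_def split_mult_def weight_scale)
      have new_ge: "Suc s \<le> label_weight ?U x" if "member_index t x > 0" for x
      proof -
        have "1 * Suc s \<le> member_index t x * Suc s" using that by (intro mult_le_mono1) simp
        then show ?thesis using new[OF that] by simp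
      qed
      have le_s: "x \<in> labels P \<and> x \<noteq> n \<and> member_index t x = 0" if "x \<in> labels ?U" "label_weight ?U x \<le> s" for x
      proof -
        have "member_index t x = 0" using new_ge[of x] that(2) by (metis gr0I not_less_eq_eq)
        then show ?thesis using that by (auto simp: S)
      qed
      have oldP: "x \<in> labels ?U \<and> member_index t x = 0" if "x \<in> labels P" "x \<noteq> n" for x
        using that t(1) by (simp add: S)
      have "bounded_labels ?U"
        unfolding bounded_labels_def S
      proof (intro exI[of _ "Suc t"] allI impI)
        fix u k assume "Bound u k \<in> labels P - {n} \<union> {x. 0 < member_index t x}"
        then show "u < Suc t" using t(2)[of u k] by (auto split: if_splits)
      qed
      moreover have agree: "agree_upto s P ?U"
        unfolding agree_upto_def
      proof (intro conjI set_eqI ballI impI)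
        fix x
        show "x \<in> {x \<in> labels ?U. label_weight ?U x \<le> s} \<longleftrightarrow> x \<in> {x \<in> labels P. label_weight P x \<le> s}"
        proof (cases "x \<in> labels ?U \<and> member_index t x = 0")
          case True
          then show ?thesis using le_s[of x] old(2)[of x] by auto
        next
          case False
          have "x \<noteq> n" if "label_weight P x \<le> s" using that n(2) by auto
          then show ?thesis using False le_s[of x] oldP[of x] by blast
        qed
      next
        fix x assume x: "x \<in> labels P" "label_weight P x \<le> s"
        then have "x \<noteq> n" using n(2) by auto
        then have "x \<in> labels ?U" "member_index t x = 0" using oldP x by blast+
        then show "charge ?U x = charge P x" "shift ?U x = shift P x" "form ?U x x = form P x x"
          using old old_form by blast+
      qed
      moreover have "unlinked_upto (Suc s) ?U"
        unfolding unlinked_upto_def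
      proof (intro ballI impI)
        fix x y assume xy: "x \<in> labels ?U" "y \<in> labels ?U" "x \<noteq> y" "label_weight ?U x + label_weight ?U y \<le> Suc s"
        have "label_weight ?U x > 0" "label_weight ?U y > 0"
          using xy admissible_pos[OF admU] by auto
        then have "label_weight ?U x \<le> s" "label_weight ?U y \<le> s" using xy(4) by linarith+
        then have x: "x \<in> labels P" "member_index t x = 0" and y: "y \<in> labels P" "member_index t y = 0"
          using le_s xy by blast+
        then have "label_weight P x + label_weight P y \<le> Suc s"
          using xy old by auto
        then show "form ?U x y = 0"
          using less.prems(3) x y xy(3) old_form by (simp add: unlinked_upto_def)
      qed
      moreover have "split_upto s ?U" by (rule agree_upto_split[OF agree less.prems(4)])
      moreover have "mu ?U < mu P"
      proof -
        have fin: "finite (level P)"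
          by (rule finite_subset[of _ "{x \<in> labels P. label_weight P x \<le> Suc s}"])
             (use lf in \<open>auto simp: level_def locally_finite_def\<close>)
        have "level ?U = insert (Bound t 1) (level P - {n})"
        proof (rule set_eqI)
          fix x
          show "x \<in> level ?U \<longleftrightarrow> x \<in> insert (Bound t 1) (level P - {n})"
          proof (cases "member_index t x = 0")
            case True
            then show ?thesis using old[of x] oldP[of x] by (auto simp: level_def S(1))
          next
            case False
            then obtain k where k: "x = Bound t (Suc k)" using member_index_pos by blast
            have "x \<notin> labels P" using False t(1) by auto
            moreover have "x \<in> level ?U \<longleftrightarrow> k = 0"
              using new[of x] by (auto simp: level_def S(1) k)
            ultimately show ?thesis using k by (auto simp: level_def)
          qed
        qed
        moreover have "Bound t 1 \<notin> labels P" using t(1)[of "Bound t 1"] by auto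
        ultimately have "mu ?U = nat (- form ?U (Bound t 1) (Bound t 1)) + (\<Sum>x\<in>level P - {n}. nat (- form ?U x x))"
          unfolding mu_def using fin by (auto simp: level_def)
        also have "(\<Sum>x\<in>level P - {n}. nat (- form ?U x x)) = (\<Sum>x\<in>level P - {n}. nat (- form P x x))"
          by (rule sum.cong) (use old_form t(1) in \<open>auto simp: level_def\<close>)
        also have "nat (- form ?U (Bound t 1) (Bound t 1)) < nat (- form P n n)"
          using n(3) by (simp add: S split_base_def split_mult_def)
        also have "nat (- form P n n) + (\<Sum>x\<in>level P - {n}. nat (- form P x x)) = mu P"
          unfolding mu_def using fin n by (subst sum.remove[of _ n]) (auto simp: level_def)
        finally show ?thesis by simp
      qed
      ultimately obtain P' where P': "admissible V chi P'" "bounded_labels P'" "unlinked_upto (Suc s) P'"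
          "split_upto (Suc s) P'" "agree_upto s ?U P'" "partition_fun P' = partition_fun ?U"
        using less.hyps[of ?U] admU by blast
      have "partition_fun ?U = partition_fun P"
        by (rule ext, rule partition_fun_refines[OF split_refines[OF n(1) t(1)] lf])
           (use admU in \<open>simp_all add: admissible_def\<close>)
      then show ?thesis using P' agree agree_upto_trans by metis
    qed
  qed
qed

text \<open>
  The pairs of joint weight \<open>s + 1\<close> must be unlinked before the labels of weight \<open>s + 1\<close> are split,
  since unlinking creates labels of that weight.  Each stage keeps the labels of smaller weight, so their number
  with a given charge and degree stabilises.
\<close>

lemma decoupling_sequence:
  fixes P :: "('v label, 'v) particle_system"
  assumes chi: "\<And>u v. u \<in> V \<Longrightarrow> v \<in> V \<Longrightarrow> chi u v = chi v u"
    and P: "admissible V chi P" "bounded_labels P"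
  obtains R :: "nat \<Rightarrow> ('v label, 'v) particle_system"
    where "\<And>s. admissible V chi (R s)" "\<And>s. unlinked_upto s (R s)" "\<And>s. split_upto s (R s)"
    "\<And>r s. r \<le> s \<Longrightarrow> agree_upto r (R r) (R s)" "\<And>s. partition_fun (R s) = partition_fun P"
proof -
  let ?inv = "\<lambda>s (R :: ('v label, 'v) particle_system). admissible V chi R \<and> bounded_labels R \<and> unlinked_upto s R \<and> split_upto s R \<and>
      partition_fun R = partition_fun P"
  have start: "\<exists>R. ?inv 0 R"
  proof (intro exI[of _ P] conjI P refl)
    show "unlinked_upto 0 P" "split_upto 0 P"
      using admissible_pos[OF P(1)] by (force simp: unlinked_upto_def split_upto_def)+
  qed
  have step: "\<exists>R'. ?inv (Suc s) R' \<and> agree_upto s R R'" if R: "?inv s R" for s R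
  proof -
    have inv: "admissible V chi R" "bounded_labels R" "unlinked_upto s R" "split_upto s R"
        "partition_fun R = partition_fun P" using R by auto
    obtain R1 where R1: "admissible V chi R1" "bounded_labels R1" "unlinked_upto (Suc s) R1" "agree_upto s R R1"
        "partition_fun R1 = partition_fun R"
      using unlink_level[OF chi inv(1-3)] by auto
    obtain R2 where "admissible V chi R2" "bounded_labels R2" "unlinked_upto (Suc s) R2" "split_upto (Suc s) R2"
        "agree_upto s R1 R2" "partition_fun R2 = partition_fun R1"
      using split_level[OF R1(1-3) agree_upto_split[OF R1(4) inv(4)]] by auto
    then show ?thesis using inv R1 agree_upto_trans by metis
  qed
  have "\<exists>R. \<forall>s. ?inv s (R s) \<and> agree_upto s (R s) (R (Suc s))"
    by (rule dependent_nat_choice[where P = ?inv and Q = agree_upto, OF start step])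
  then obtain R where *: "\<forall>s. ?inv s (R s) \<and> agree_upto s (R s) (R (Suc s))" ..
  have R: "?inv s (R s)" "agree_upto s (R s) (R (Suc s))" for s
    using *[rule_format, of s] by (rule conjunct1, rule conjunct2)
  have "agree_upto r (R r) (R s)" if "r \<le> s" for r s
    using that
  proof (induction rule: dec_induct)
    case base
    show ?case by (rule agree_upto_refl)
  next
    case (step s)
    then show ?case using agree_upto_trans agree_upto_mono R(2) by blast
  qed
  moreover have "admissible V chi (R s)" "unlinked_upto s (R s)" "split_upto s (R s)"
    "partition_fun (R s) = partition_fun P" for s
    using R(1)[of s] by blast+
  ultimately show ?thesis using that[of R] by blast
qed

section \<open>Graded dimensions of spaces of symmetric polynomials\<close>

definition multiset_families :: "'v set \<Rightarrow> ('v \<Rightarrow> nat) \<Rightarrow> nat \<Rightarrow> ('v \<Rightarrow> nat multiset) set" where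
  "multiset_families I n j = {T. (\<forall>i\<in>I. size (T i) = n i) \<and> (\<forall>i. i \<notin> I \<longrightarrow> T i = {#}) \<and>
     2 * (\<Sum>i\<in>I. sum_mset (T i)) = j}"

text \<open>
  The induction adds one vertex at a time: the coefficients of a product are convolutions, and a family on
  \<open>insert i I\<close> is a multiset at \<open>i\<close> together with a family on \<open>I\<close>.
\<close>

lemma card_multiset_families:
  assumes "finite I"
  shows "finite (multiset_families I n j) \<and>
    fps_nth (\<Prod>i\<in>I. Abs_fps (\<lambda>j. int (num_multisets (n i) j))) j = int (card (multiset_families I n j))"
  using assms
proof (induction I arbitrary: j rule: finite_induct)
  case empty
  have "multiset_families {} n j = (if j = 0 then {\<lambda>_. {#}} else {})"
    by (auto simp: multiset_families_def)
  then show ?case by simp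
next
  case (insert i I)
  let ?A = "\<lambda>k. {M :: nat multiset. size M = n i \<and> 2 * sum_mset M = k}"
  let ?S = "SIGMA k:{0..j}. ?A k \<times> multiset_families I n (j - k)"
  have bij: "bij_betw (\<lambda>T. (2 * sum_mset (T i), T i, T(i := {#}))) (multiset_families (insert i I) n j) ?S"
  proof (rule bij_betw_byWitness[where f' = "\<lambda>(k, M, T). T(i := M)"])
    have eq: "(\<Sum>x\<in>I. sum_mset (if x = i then M else T x)) = (\<Sum>x\<in>I. sum_mset (T x))" for T M
      using insert.hyps(2) by (intro sum.cong) auto
    show "(\<lambda>T. (2 * sum_mset (T i), T i, T(i := {#}))) ` multiset_families (insert i I) n j \<subseteq> ?S"
      using insert.hyps by (auto simp: multiset_families_def eq)
    show "(\<lambda>(k, M, T). T(i := M)) ` ?S \<subseteq> multiset_families (insert i I) n j"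
      using insert.hyps by (auto simp: multiset_families_def eq)
    show "\<forall>a\<in>?S. (\<lambda>T. (2 * sum_mset (T i), T i, T(i := {#}))) ((\<lambda>(k, M, T). T(i := M)) a) = a"
      using insert.hyps by (auto simp: multiset_families_def)
  qed auto
  have fin: "finite ?S"
    using insert.IH finite_multisets_size_sum by (intro finite_SigmaI finite_cartesian_product) auto
  have "fps_nth (\<Prod>i\<in>insert i I. Abs_fps (\<lambda>j. int (num_multisets (n i) j))) j
      = (\<Sum>k=0..j. int (num_multisets (n i) k) * int (card (multiset_families I n (j - k))))"
    using insert by (simp add: fps_mult_nth)
  also have "\<dots> = int (card ?S)"
    using insert.IH finite_multisets_size_sum
    by (subst card_SigmaI) (auto simp: num_multisets_def card_cartesian_product)
  also have "card ?S = card (multiset_families (insert i I) n j)"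
    using bij_betw_same_card[OF bij] by simp
  finally show ?case using bij_betw_finite[OF bij] fin by simp
qed

lemma inv_qfacts_nth:
  "fls_nth (inv_qfacts \<gamma>) j = (if j < 0 then 0
     else int (card (multiset_families (keys \<gamma>) (lookup \<gamma>) (nat j))))"
proof -
  let ?N = "\<lambda>n. Abs_fps (\<lambda>j. int (num_multisets n j))"
  have "inv_qfacts \<gamma> = (\<Prod>i\<in>keys \<gamma>. fps_to_fls (?N (lookup \<gamma> i)))"
    by (simp add: inv_qfacts_def inv_qfact_def)
  also have "\<dots> = fps_to_fls (\<Prod>i\<in>keys \<gamma>. ?N (lookup \<gamma> i))"
  proof -
    have "(\<Prod>i\<in>A. fps_to_fls (?N (lookup \<gamma> i))) = fps_to_fls (\<Prod>i\<in>A. ?N (lookup \<gamma> i))"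
      if "finite A" for A
      using that by (induction A) (auto simp: fls_times_fps_to_fls)
    then show ?thesis by simp
  qed
  finally show ?thesis
    using card_multiset_families[of "keys \<gamma>" "lookup \<gamma>" "nat j"] by simp
qed

definition positions :: "('v \<Rightarrow>\<^sub>0 nat) \<Rightarrow> ('v \<times> nat) set" where
  "positions \<gamma> = {(i, \<alpha>). 1 \<le> \<alpha> \<and> \<alpha> \<le> lookup \<gamma> i}"

lemma positions_Sigma: "positions \<gamma> = (SIGMA i:keys \<gamma>. {1..lookup \<gamma> i})"
  by (auto simp: positions_def in_keys_iff)

lemma finite_positions [simp]: "finite (positions \<gamma>)"
  by (simp add: positions_Sigma)

definition monomials :: "('v \<Rightarrow>\<^sub>0 nat) \<Rightarrow> nat \<Rightarrow> ('v \<times> nat \<Rightarrow>\<^sub>0 nat) set" where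
  "monomials \<gamma> d = {m. keys m \<subseteq> positions \<gamma> \<and> monom_degree m = d}"

lemma monom_degree_weight: "monom_degree m = weight m"
  by (simp add: monom_degree_def weight_def)

lemma finite_monomials [simp]: "finite (monomials \<gamma> d)"
  by (rule finite_subset[OF _ weight_le_finite[OF finite_positions, of \<gamma> d]])
     (auto simp: monomials_def monom_degree_weight)

text \<open>
  The orbit of a monomial under the permutations of the variables: for each vertex, the multiset of the
  exponents of its variables.
\<close>

definition exponent_type :: "('v \<Rightarrow>\<^sub>0 nat) \<Rightarrow> ('v \<times> nat \<Rightarrow>\<^sub>0 nat) \<Rightarrow> 'v \<Rightarrow> nat multiset" where
  "exponent_type \<gamma> m i = image_mset (\<lambda>\<alpha>. lookup m (i, \<alpha>)) (mset_set {1..lookup \<gamma> i})"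

lemma exponent_type_image:
  "exponent_type \<gamma> ` monomials \<gamma> d = multiset_families (keys \<gamma>) (lookup \<gamma>) (2 * d)"
proof
  have deg: "(\<Sum>i\<in>keys \<gamma>. sum_mset (exponent_type \<gamma> m i)) = monom_degree m"
    if "keys m \<subseteq> positions \<gamma>" for m
  proof -
    have "monom_degree m = (\<Sum>x\<in>positions \<gamma>. lookup m x)"
      unfolding monom_degree_def using that by (intro sum.mono_neutral_left) (auto simp: in_keys_iff)
    also have "\<dots> = (\<Sum>i\<in>keys \<gamma>. \<Sum>\<alpha>=1..lookup \<gamma> i. lookup m (i, \<alpha>))"
      unfolding positions_Sigma by (subst sum.Sigma) auto
    finally show ?thesis by (simp add: exponent_type_def sum_unfold_sum_mset)
  qed
  show "exponent_type \<gamma> ` monomials \<gamma> d \<subseteq> multiset_families (keys \<gamma>) (lookup \<gamma>) (2 * d)"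
    using deg by (auto simp: multiset_families_def monomials_def in_keys_iff) (auto simp: exponent_type_def)
  show "multiset_families (keys \<gamma>) (lookup \<gamma>) (2 * d) \<subseteq> exponent_type \<gamma> ` monomials \<gamma> d"
  proof
    fix T assume T: "T \<in> multiset_families (keys \<gamma>) (lookup \<gamma>) (2 * d)"
    have size: "size (T i) = lookup \<gamma> i" for i
      using T by (cases "i \<in> keys \<gamma>") (auto simp: multiset_families_def in_keys_iff)
    have "\<forall>i. \<exists>x. mset x = T i" using ex_mset by blast
    then obtain xs where xs: "\<And>i. mset (xs i) = T i" by metis
    have len: "length (xs i) = lookup \<gamma> i" for i
      using size[of i] xs[of i] by (metis size_mset)
    define f where "f x = (if x \<in> positions \<gamma> then xs (fst x) ! (snd x - 1) else 0)" for x
    define m where "m = Abs_poly_mapping f"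
    have "finite {x. f x \<noteq> 0}"
      by (rule finite_subset[OF _ finite_positions[of \<gamma>]]) (auto simp: f_def)
    then have m: "lookup m = f" by (simp add: m_def)
    have keys: "keys m \<subseteq> positions \<gamma>"
      by (auto simp: in_keys_iff m f_def split: if_splits)
    have type: "exponent_type \<gamma> m = T"
    proof
      fix i
      have "exponent_type \<gamma> m i = image_mset (\<lambda>\<alpha>. xs i ! (\<alpha> - 1)) (mset_set {1..lookup \<gamma> i})"
        unfolding exponent_type_def m by (rule image_mset_cong) (auto simp: f_def positions_def)
      also have "mset_set {1..lookup \<gamma> i} = mset [1..<Suc (length (xs i))]"
        by (simp only: len mset_upt atLeastLessThanSuc_atLeastAtMost)
      also have "image_mset (\<lambda>\<alpha>. xs i ! (\<alpha> - 1)) (mset [1..<Suc (length (xs i))]) = mset (map (\<lambda>\<alpha>. xs i ! (\<alpha> - 1)) [1..<Suc (length (xs i))])"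
        by (simp only: mset_map)
      also have "map (\<lambda>\<alpha>. xs i ! (\<alpha> - 1)) [1..<Suc (length (xs i))] = xs i"
        by (rule nth_equalityI) (simp_all add: nth_upt del: upt_Suc)
      finally show "exponent_type \<gamma> m i = T i" by (simp add: xs)
    qed
    have "monom_degree m = d"
      using deg[OF keys] T unfolding type by (simp add: multiset_families_def)
    then show "T \<in> exponent_type \<gamma> ` monomials \<gamma> d"
      using keys type by (auto simp: monomials_def)
  qed
qed

definition permute_positions :: "('v \<Rightarrow> nat \<Rightarrow> nat) \<Rightarrow> 'v \<times> nat \<Rightarrow> 'v \<times> nat" where
  "permute_positions s = (\<lambda>(i, \<alpha>). (i, s i \<alpha>))"

abbreviation permute ::
  "('v \<Rightarrow> nat \<Rightarrow> nat) \<Rightarrow> ('v \<times> nat \<Rightarrow>\<^sub>0 nat) \<Rightarrow> ('v \<times> nat \<Rightarrow>\<^sub>0 nat)" where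
  "permute s \<equiv> Poly_Mapping.map_key (permute_positions s)"

lemma
  assumes s: "\<And>i. s i permutes {1..lookup \<gamma> i}"
  shows bij_permute_positions: "bij (permute_positions s)"
    and permute_positions_iff: "permute_positions s x \<in> positions \<gamma> \<longleftrightarrow> x \<in> positions \<gamma>"
    and lookup_permute: "lookup (permute s m) x
          = lookup m (permute_positions s x)"
    and permute_monomials: "permute s m \<in> monomials \<gamma> d \<longleftrightarrow> m \<in> monomials \<gamma> d"
    and permute_type: "exponent_type \<gamma> (permute s m) = exponent_type \<gamma> m"
proof -
  let ?f = "permute_positions s"
  have bij_s: "bij (s i)" for i using s by (rule permutes_bij)
  show bij: "bij ?f"
  proof (rule o_bij)
    show "permute_positions (\<lambda>i. inv (s i)) \<circ> ?f = id"
      using bij_s by (auto simp: permute_positions_def fun_eq_iff bij_is_inj)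
    show "?f \<circ> permute_positions (\<lambda>i. inv (s i)) = id"
      using bij_s by (auto simp: permute_positions_def fun_eq_iff bij_is_surj surj_f_inv_f)
  qed
  show pos: "?f x \<in> positions \<gamma> \<longleftrightarrow> x \<in> positions \<gamma>" for x
    using permutes_in_image[OF s] by (auto simp: positions_def permute_positions_def split: prod.splits)
  show lookup: "lookup (Poly_Mapping.map_key ?f m) x = lookup m (?f x)" for x
    using bij_is_inj[OF bij] by (simp add: map_key.rep_eq)
  have keys: "keys m = ?f ` keys (Poly_Mapping.map_key ?f m)"
    unfolding keys_map_key[OF bij_is_inj[OF bij]] using bij by (simp add: bij_is_surj surj_image_vimage_eq)
  have "monom_degree m = monom_degree (Poly_Mapping.map_key ?f m)"
    unfolding monom_degree_def keys using bij_is_inj[OF bij]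
    by (subst sum.reindex) (auto simp: lookup inj_on_def)
  moreover have "keys m \<subseteq> positions \<gamma> \<longleftrightarrow> keys (Poly_Mapping.map_key ?f m) \<subseteq> positions \<gamma>"
    unfolding keys using pos by auto
  ultimately show "Poly_Mapping.map_key ?f m \<in> monomials \<gamma> d \<longleftrightarrow> m \<in> monomials \<gamma> d"
    by (simp add: monomials_def)
  show "exponent_type \<gamma> (Poly_Mapping.map_key ?f m) = exponent_type \<gamma> m"
  proof
    fix i
    have "exponent_type \<gamma> (Poly_Mapping.map_key ?f m) i
        = image_mset (\<lambda>\<alpha>. lookup m (i, \<alpha>)) (image_mset (s i) (mset_set {1..lookup \<gamma> i}))"
      unfolding exponent_type_def lookup multiset.map_comp by (simp add: permute_positions_def comp_def)
    also have "image_mset (s i) (mset_set {1..lookup \<gamma> i}) = mset_set {1..lookup \<gamma> i}"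
      using s by (rule permutes_image_mset)
    finally show "exponent_type \<gamma> (Poly_Mapping.map_key ?f m) i = exponent_type \<gamma> m i"
      by (simp add: exponent_type_def)
  qed
qed

lemma same_type_permute:
  fixes m m' :: "('v \<times> nat) \<Rightarrow>\<^sub>0 nat"
  assumes "m \<in> monomials \<gamma> d" "m' \<in> monomials \<gamma> d" "exponent_type \<gamma> m = exponent_type \<gamma> m'"
  obtains s where "\<And>i. s i permutes {1..lookup \<gamma> i}" "permute s m' = m"
proof -
  have "\<exists>p. p permutes {1..lookup \<gamma> i} \<and>
      (\<forall>\<alpha>\<in>{1..lookup \<gamma> i}. lookup m (i, \<alpha>) = lookup m' (i, p \<alpha>))" for i
    using image_mset_eq_implies_permutes[of "{1..lookup \<gamma> i}" "\<lambda>\<alpha>. lookup m (i, \<alpha>)" "\<lambda>\<alpha>. lookup m' (i, \<alpha>)"]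
      fun_cong[OF assms(3), of i] unfolding exponent_type_def by (metis finite_atLeastAtMost)
  then obtain s where s: "\<And>i. s i permutes {1..lookup \<gamma> i}"
      "\<And>i \<alpha>. \<alpha> \<in> {1..lookup \<gamma> i} \<Longrightarrow> lookup m (i, \<alpha>) = lookup m' (i, s i \<alpha>)"
    by metis
  have "permute s m' = m"
  proof (rule poly_mapping_eqI)
    fix x :: "'v \<times> nat"
    obtain i \<alpha> where x: "x = (i, \<alpha>)" by (cases x)
    have "lookup m' (permute_positions s x) = lookup m x"
    proof (cases "x \<in> positions \<gamma>")
      case True
      then show ?thesis using s(2)[of \<alpha> i] by (simp add: x positions_def permute_positions_def)
    next
      case False
      moreover have "permute_positions s x \<notin> positions \<gamma>" using False permute_positions_iff[of s, OF s(1)] by blast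
      ultimately have "x \<notin> keys m" "permute_positions s x \<notin> keys m'"
        using assms(1,2) by (auto simp: monomials_def)
      then show ?thesis by (simp add: in_keys_iff)
    qed
    then show "lookup (permute s m') x = lookup m x"
      by (simp add: lookup_permute[of s, OF s(1)])
  qed
  then show ?thesis using that s(1) by blast
qed

definition monomial_symmetric :: "('v \<Rightarrow>\<^sub>0 nat) \<Rightarrow> nat \<Rightarrow> ('v \<Rightarrow> nat multiset) \<Rightarrow> 'v coha_poly" where
  "monomial_symmetric \<gamma> d T = (\<Sum>m | m \<in> monomials \<gamma> d \<and> exponent_type \<gamma> m = T. single m 1)"

lemma lookup_monomial_symmetric:
  "lookup (monomial_symmetric \<gamma> d T) m = (if m \<in> monomials \<gamma> d \<and> exponent_type \<gamma> m = T then 1 else 0)"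
proof -
  have "finite {m \<in> monomials \<gamma> d. exponent_type \<gamma> m = T}" by simp
  then show ?thesis
    unfolding monomial_symmetric_def lookup_sum by (simp add: lookup_single when_def sum.delta)
qed

text \<open>
  Invariance under all permutations means that the coefficients depend only on the exponent type.
\<close>

lemma coha_bigraded_iff:
  "p \<in> coha_bigraded Q \<gamma> (2 * int d + euler_form Q \<gamma> \<gamma>) \<longleftrightarrow> keys p \<subseteq> monomials \<gamma> d \<and>
     (\<forall>m\<in>monomials \<gamma> d. \<forall>m'\<in>monomials \<gamma> d. exponent_type \<gamma> m = exponent_type \<gamma> m' \<longrightarrow>
        lookup p m = lookup p m')" (is "?L \<longleftrightarrow> ?R")
proof -
  have L: "?L \<longleftrightarrow> keys p \<subseteq> monomials \<gamma> d \<and>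
     (\<forall>s. (\<forall>i. s i permutes {1..lookup \<gamma> i}) \<longrightarrow>
        (\<forall>m. lookup p (permute s m) = lookup p m))"
    unfolding coha_bigraded_def coha_comp_def monomials_def positions_def permute_positions_def by auto
  show ?thesis
  proof
    assume ?L
    then show ?R unfolding L using same_type_permute by metis
  next
    assume R: ?R
    have "lookup p (permute s m) = lookup p m"
      if s: "\<forall>i. s i permutes {1..lookup \<gamma> i}" for s m
    proof (cases "m \<in> monomials \<gamma> d")
      case True
      then show ?thesis
        using R permute_monomials[of s \<gamma>] permute_type[of s \<gamma>] s by blast
    next
      case False
      moreover have "permute s m \<notin> monomials \<gamma> d"
        using False permute_monomials[of s \<gamma>] s by blast
      ultimately show ?thesis using R in_keys_iff[of _ p] by (metis subsetD)
    qed
    then show ?L unfolding L using R by blast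
  qed
qed

text \<open>
  The monomial symmetric functions form a basis.
\<close>

lemma coha_dim_eq_card:
  "coha_dim Q \<gamma> (2 * int d + euler_form Q \<gamma> \<gamma>)
     = card (multiset_families (keys \<gamma>) (lookup \<gamma>) (2 * d))"
proof -
  let ?k = "2 * int d + euler_form Q \<gamma> \<gamma>"
  let ?T = "exponent_type \<gamma> ` monomials \<gamma> d"
  let ?s = "monomial_symmetric \<gamma> d"
  let ?B = "?s ` ?T"
  have lookup_scale: "lookup (Poly_Mapping.map ((*) c) p) m = c * lookup p m" for c :: rat and p m
    by (simp add: map.rep_eq when_def)
  have inj: "inj_on ?s ?T"
  proof (rule inj_onI, clarify)
    fix m m' assume m: "m \<in> monomials \<gamma> d" and eq: "?s (exponent_type \<gamma> m) = ?s (exponent_type \<gamma> m')"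
    then have "lookup (?s (exponent_type \<gamma> m)) m = lookup (?s (exponent_type \<gamma> m')) m" by simp
    then show "exponent_type \<gamma> m = exponent_type \<gamma> m'"
      using m by (simp add: lookup_monomial_symmetric split: if_splits)
  qed
  have lookup_comb: "lookup (\<Sum>b\<in>?B. Poly_Mapping.map ((*) (f b)) b) m
      = (if m \<in> monomials \<gamma> d then f (?s (exponent_type \<gamma> m)) else 0)" for f m
  proof -
    have "lookup (\<Sum>b\<in>?B. Poly_Mapping.map ((*) (f b)) b) m
        = (\<Sum>T\<in>?T. f (?s T) * lookup (?s T) m)"
      by (simp add: lookup_sum lookup_scale sum.reindex[OF inj])
    also have "\<dots> = (\<Sum>T\<in>?T. if T = exponent_type \<gamma> m then (if m \<in> monomials \<gamma> d then f (?s T) else 0) else 0)"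
      by (rule sum.cong) (auto simp: lookup_monomial_symmetric)
    also have "\<dots> = (if m \<in> monomials \<gamma> d then f (?s (exponent_type \<gamma> m)) else 0)"
      by (auto simp: sum.delta)
    finally show ?thesis .
  qed
  have "coha.dim (coha_bigraded Q \<gamma> ?k) = card ?B"
  proof (rule coha.dim_unique)
    show "?B \<subseteq> coha_bigraded Q \<gamma> ?k"
      unfolding coha_bigraded_iff[of _ Q \<gamma> d] subset_iff
      by (auto simp: lookup_monomial_symmetric in_keys_iff split: if_splits)
    show "coha_bigraded Q \<gamma> ?k \<subseteq> coha.span ?B"
    proof
      fix p assume "p \<in> coha_bigraded Q \<gamma> ?k"
      then have keys: "keys p \<subseteq> monomials \<gamma> d"
        and const: "\<And>m m'. m \<in> monomials \<gamma> d \<Longrightarrow> m' \<in> monomials \<gamma> d \<Longrightarrow> exponent_type \<gamma> m = exponent_type \<gamma> m' \<Longrightarrow>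
          lookup p m = lookup p m'"
        unfolding coha_bigraded_iff by blast+
      define f where "f b = lookup p (SOME m. m \<in> monomials \<gamma> d \<and> ?s (exponent_type \<gamma> m) = b)" for b
      have f: "f (?s (exponent_type \<gamma> m)) = lookup p m" if m: "m \<in> monomials \<gamma> d" for m
      proof -
        let ?m = "SOME m'. m' \<in> monomials \<gamma> d \<and> ?s (exponent_type \<gamma> m') = ?s (exponent_type \<gamma> m)"
        have "?m \<in> monomials \<gamma> d \<and> ?s (exponent_type \<gamma> ?m) = ?s (exponent_type \<gamma> m)"
          by (rule someI[of _ m]) (use m in simp)
        then have "?m \<in> monomials \<gamma> d" "exponent_type \<gamma> ?m = exponent_type \<gamma> m"
          using inj m by (auto dest: inj_onD)
        then show ?thesis unfolding f_def using const m by blast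
      qed
      have "p = (\<Sum>b\<in>?B. Poly_Mapping.map ((*) (f b)) b)"
      proof (rule poly_mapping_eqI)
        fix m
        show "lookup p m = lookup (\<Sum>b\<in>?B. Poly_Mapping.map ((*) (f b)) b) m"
          unfolding lookup_comb using f keys by (auto simp: in_keys_iff)
      qed
      then show "p \<in> coha.span ?B"
        by (simp only:) (intro coha.span_sum coha.span_scale coha.span_base)
    qed
    show "coha.independent ?B"
    proof (rule coha.independent_if_scalars_zero)
      fix f b assume "(\<Sum>b\<in>?B. Poly_Mapping.map ((*) (f b)) b) = 0" "b \<in> ?B"
      then obtain m where m: "m \<in> monomials \<gamma> d" "b = ?s (exponent_type \<gamma> m)"
        and zero: "(\<Sum>b\<in>?B. Poly_Mapping.map ((*) (f b)) b) = 0" by blast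
      show "f b = 0"
        using lookup_comb[of f m] m unfolding zero by simp
    qed simp
  qed simp
  also have "card ?B = card ?T" using inj by (rule card_image)
  finally show ?thesis by (simp add: coha_dim_def exponent_type_image)
qed

lemma coha_dim_odd:
  assumes "odd (k - euler_form Q \<gamma> \<gamma>)"
  shows "coha_dim Q \<gamma> k = 0"
proof -
  have "coha_bigraded Q \<gamma> k \<subseteq> {0}"
  proof
    fix p assume p: "p \<in> coha_bigraded Q \<gamma> k"
    have "m \<notin> keys p" for m
    proof
      assume "m \<in> keys p"
      then have "k - euler_form Q \<gamma> \<gamma> = 2 * int (monom_degree m)"
        using p by (auto simp: coha_bigraded_def)
      then show False using assms by simp
    qed
    then show "p \<in> {0}" by (auto intro!: poly_mapping_eqI simp: in_keys_iff)
  qed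
  then have "coha_bigraded Q \<gamma> k \<subseteq> coha.span {}" by simp
  then have "coha.dim (coha_bigraded Q \<gamma> k) \<le> card ({} :: 'a coha_poly set)"
    by (intro coha.dim_le_card) auto
  then show ?thesis by (simp add: coha_dim_def)
qed

lemma coha_series_coeff:
  assumes "\<gamma> \<in> dim_vectors Q"
  shows "mfps_coeff (coha_series Q) \<gamma> = signed_pow (euler_form Q \<gamma> \<gamma>) * inv_qfacts \<gamma>"
proof (rule fls_eqI)
  fix k
  let ?e = "euler_form Q \<gamma> \<gamma>"
  show "fls_nth (mfps_coeff (coha_series Q) \<gamma>) k = fls_nth (signed_pow ?e * inv_qfacts \<gamma>) k"
  proof (cases "odd (k - ?e)")
    case True
    have "multiset_families (keys \<gamma>) (lookup \<gamma>) (nat (k - ?e)) = {}" if "k \<ge> ?e"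
    proof -
      have "2 * n \<noteq> nat (k - ?e)" for n
      proof
        assume "2 * n = nat (k - ?e)"
        then have "k - ?e = 2 * int n" using that by linarith
        then show False using True by simp
      qed
      then show ?thesis by (simp add: multiset_families_def)
    qed
    then show ?thesis
      using True by (simp add: coha_series_nth[OF assms] coha_dim_odd signed_pow_nth inv_qfacts_nth)
  next
    case False
    then have parity: "even k \<longleftrightarrow> even ?e" by presburger
    show ?thesis
    proof (cases "k < ?e")
      case True
      then show ?thesis by (simp add: coha_series_nth[OF assms] coha_dim_eq_0 signed_pow_nth inv_qfacts_nth)
    next
      case f: False
      define d where "d = nat ((k - ?e) div 2)"
      have k: "k = 2 * int d + ?e" using False f by (auto simp: d_def)
      then have "nat (k - ?e) = 2 * d" by simp
      then show ?thesis
        using f parity coha_dim_eq_card[of Q \<gamma> d]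
        by (simp add: coha_series_nth[OF assms] signed_pow_nth inv_qfacts_nth k[symmetric])
    qed
  qed
qed

section \<open>Power series in one monomial\<close>

text \<open>
  The series \<open>\<Sum>\<^sub>m a\<^sub>m t\<^sup>m\<^sup>g\<close>.  The sum in the definition has at most one term if \<open>g \<noteq> 0\<close>.
\<close>

definition ray_series :: "(nat \<Rightarrow> 'a :: comm_ring_1) \<Rightarrow> ('v \<Rightarrow>\<^sub>0 nat) \<Rightarrow> ('v, 'a) mfps" where
  "ray_series a g = Abs_mfps (\<lambda>\<gamma>. \<Sum>m | nscale m g = \<gamma>. a m)"

lemma scale_inject: "g \<noteq> 0 \<Longrightarrow> nscale m g = nscale n g \<longleftrightarrow> m = n"
  by (metis weight_eq_0_iff weight_scale mult_cancel2)

lemma ray_fibre: "g \<noteq> 0 \<Longrightarrow> {m. nscale m g = nscale n g} = {n}"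
  using scale_inject by blast

lemma finite_ray_fibre: "g \<noteq> 0 \<Longrightarrow> finite {m. nscale m g = \<gamma>}"
proof (cases "\<exists>n. \<gamma> = nscale n g")
  case False
  then have "{m. nscale m g = \<gamma>} = {}" by auto
  then show ?thesis by simp
qed (auto simp: ray_fibre)

lemma ray_series_scale [simp]: "g \<noteq> 0 \<Longrightarrow> mfps_coeff (ray_series a g) (nscale n g) = a n"
  by (simp add: ray_series_def ray_fibre)

lemma ray_series_other: "(\<And>m. \<gamma> \<noteq> nscale m g) \<Longrightarrow> mfps_coeff (ray_series a g) \<gamma> = 0"
  unfolding ray_series_def by (auto intro!: sum.neutral)

lemma scale_add_eq:
  assumes "g \<noteq> 0" "\<alpha> + \<beta> = nscale n g" "\<alpha> = nscale m g"
  shows "m \<le> n \<and> \<beta> = nscale (n - m) g"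
proof -
  have eq: "m * lookup g x + lookup \<beta> x = n * lookup g x" for x
    using arg_cong[OF assms(2), of "\<lambda>d. lookup d x"] assms(3) by (simp add: lookup_add)
  obtain x where x: "lookup g x \<noteq> 0"
    using assms(1) by (metis lookup_zero poly_mapping_eqI)
  have "m * lookup g x \<le> n * lookup g x" using eq[of x] by linarith
  then have "m \<le> n" using x by simp
  moreover have "\<beta> = nscale (n - m) g"
  proof (rule poly_mapping_eqI)
    fix x
    show "lookup \<beta> x = lookup (nscale (n - m) g) x"
      using eq[of x] \<open>m \<le> n\<close> by (simp add: diff_mult_distrib)
  qed
  ultimately show ?thesis ..
qed

lemma ray_series_mult:
  assumes "g \<noteq> 0"
  shows "ray_series a g * ray_series b g = ray_series (\<lambda>n. \<Sum>m\<le>n. a m * b (n - m)) g" (is "?L = ?R")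
proof (rule mfps_eqI)
  fix \<gamma>
  have L: "mfps_coeff ?L \<gamma> = (\<Sum>(\<alpha>, \<beta>)\<in>exponent_splits \<gamma>. mfps_coeff (ray_series a g) \<alpha> * mfps_coeff (ray_series b g) \<beta>)"
    by (simp add: times_mfps_def)
  show "mfps_coeff ?L \<gamma> = mfps_coeff ?R \<gamma>"
  proof (cases "\<exists>n. \<gamma> = nscale n g")
    case True
    then obtain n where n: "\<gamma> = nscale n g" ..
    let ?S = "(\<lambda>m. (nscale m g, nscale (n - m) g)) ` {..n}"
    have "mfps_coeff ?L \<gamma> = (\<Sum>(\<alpha>, \<beta>)\<in>?S. mfps_coeff (ray_series a g) \<alpha> * mfps_coeff (ray_series b g) \<beta>)"
      unfolding L
    proof (rule sum.mono_neutral_right)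
      show "?S \<subseteq> exponent_splits \<gamma>"
        by (auto simp: exponent_splits_def n scale_add[symmetric])
      show "\<forall>p\<in>exponent_splits \<gamma> - ?S. (case p of (\<alpha>, \<beta>) \<Rightarrow> mfps_coeff (ray_series a g) \<alpha> * mfps_coeff (ray_series b g) \<beta>) = 0"
      proof clarify
        fix \<alpha> \<beta> assume p: "(\<alpha>, \<beta>) \<in> exponent_splits \<gamma>" "(\<alpha>, \<beta>) \<notin> ?S"
        have "\<alpha> \<noteq> nscale m g" for m
          using scale_add_eq[OF assms, of \<alpha> \<beta> n m] p by (auto simp: exponent_splits_def n)
        then show "mfps_coeff (ray_series a g) \<alpha> * mfps_coeff (ray_series b g) \<beta> = 0"
          by (simp add: ray_series_other)
      qed
    qed simp
    also have "\<dots> = (\<Sum>m\<le>n. a m * b (n - m))"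
      by (subst sum.reindex) (auto simp: inj_on_def scale_inject[OF assms] assms)
    finally show ?thesis using assms n by simp
  next
    case False
    have "mfps_coeff (ray_series a g) \<alpha> * mfps_coeff (ray_series b g) \<beta> = 0" if "\<alpha> + \<beta> = \<gamma>" for \<alpha> \<beta>
    proof (rule ccontr)
      assume "\<not> ?thesis"
      then obtain m n where "\<alpha> = nscale m g" "\<beta> = nscale n g"
        using ray_series_other by (metis mult_zero_left mult_zero_right)
      then show False using that False scale_add[of m n g] by metis
    qed
    then have "mfps_coeff ?L \<gamma> = 0"
      unfolding L by (auto simp: exponent_splits_def intro!: sum.neutral)
    then show ?thesis using False ray_series_other by metis
  qed
qed

lemma ray_series_0: "ray_series (\<lambda>n. if n = 0 then 1 else 0) g = 1" if "g \<noteq> 0"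
proof (rule mfps_eqI)
  fix \<gamma>
  show "mfps_coeff (ray_series (\<lambda>n. if n = 0 then 1 else 0) g) \<gamma> = mfps_coeff 1 \<gamma>"
  proof (cases "\<exists>n. \<gamma> = nscale n g")
    case True
    then obtain n where n: "\<gamma> = nscale n g" ..
    show ?thesis
      unfolding n ray_series_scale[OF that] by (simp add: one_mfps_def that)
  next
    case False
    then have "\<gamma> \<noteq> 0" using scale_0[of g] by metis
    then show ?thesis using False ray_series_other[of \<gamma> g] by (auto simp: one_mfps_def)
  qed
qed

lemma prod_ray_series:
  assumes "finite T" "\<And>x. x \<in> T \<Longrightarrow> g x \<noteq> 0"
  shows "mfps_coeff (\<Prod>x\<in>T. ray_series (a x) (g x)) \<gamma> =
     (\<Sum>d | keys d \<subseteq> T \<and> push g d = \<gamma>. \<Prod>x\<in>T. a x (lookup d x))"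
  using assms
proof (induction T arbitrary: \<gamma> rule: finite_induct)
  case empty
  have "{d. keys d \<subseteq> {} \<and> push g d = \<gamma>} = (if \<gamma> = 0 then {0} else {})" by auto
  then show ?case by (simp add: one_mfps_def)
next
  case (insert x T)
  let ?C = "\<lambda>T \<gamma>. {d. keys d \<subseteq> T \<and> push g d = \<gamma>}"
  have finC: "finite (?C T \<gamma>)" for \<gamma>
  proof -
    let ?P = "\<lparr>labels = T, charge = g, form = (\<lambda>_ _. 0), shift = (\<lambda>_. 0)\<rparr>"
    have "locally_finite ?P" using insert by (simp add: locally_finite_def)
    then have "finite (configs ?P \<gamma>)" by (rule finite_configs)
    then show ?thesis by (simp add: configs_def)
  qed
  let ?Z = "SIGMA p:exponent_splits \<gamma>. {m. nscale m (g x) = fst p} \<times> ?C T (snd p)"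
  let ?split = "\<lambda>d. ((nscale (lookup d x) (g x), push g (Poly_Mapping.update x 0 d)),
      lookup d x, Poly_Mapping.update x 0 d)"
  let ?join = "\<lambda>(p, m, d). single x m + d"
  let ?f = "\<lambda>(p, m, d). a x m * (\<Prod>y\<in>T. a y (lookup d y))"
  have "mfps_coeff (\<Prod>x\<in>insert x T. ray_series (a x) (g x)) \<gamma>
      = (\<Sum>p\<in>exponent_splits \<gamma>. (\<Sum>m | nscale m (g x) = fst p. a x m) *
           (\<Sum>d\<in>?C T (snd p). \<Prod>y\<in>T. a y (lookup d y)))"
    using insert by (simp add: times_mfps_def case_prod_beta ray_series_def)
  also have "\<dots> = (\<Sum>p\<in>exponent_splits \<gamma>. \<Sum>(m, d)\<in>{m. nscale m (g x) = fst p} \<times> ?C T (snd p).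
           a x m * (\<Prod>y\<in>T. a y (lookup d y)))"
    by (simp only: sum_product sum.cartesian_product)
  also have "\<dots> = (\<Sum>z\<in>?Z. ?f z)"
    using finC finite_ray_fibre[of "g x"] insert.prems by (subst sum.Sigma) auto
  also have "\<dots> = (\<Sum>d\<in>?C (insert x T) \<gamma>. \<Prod>y\<in>insert x T. a y (lookup d y))"
  proof (rule sum.reindex_bij_witness[where i = ?split and j = ?join])
    fix z assume "z \<in> ?Z"
    then obtain \<alpha> \<beta> m d where z: "z = ((\<alpha>, \<beta>), m, d)" "\<alpha> + \<beta> = \<gamma>" "nscale m (g x) = \<alpha>"
        "keys d \<subseteq> T" "push g d = \<beta>"
      by (auto simp: exponent_splits_def)
    have dx: "lookup d x = 0" using z(4) insert.hyps by (auto simp: in_keys_iff)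
    have upd: "Poly_Mapping.update x 0 (single x m + d) = d"
      by (rule poly_mapping_eqI) (auto simp: lookup_update lookup_add lookup_single dx when_def)
    show "?split
         (?join z) = z"
      using z dx upd by (simp add: lookup_add)
    show "?join z \<in> ?C (insert x T) \<gamma>"
      using z Poly_Mapping.keys_add[of "single x m" d]
      by (auto simp: push_add split: if_splits)
    have "(\<Prod>y\<in>T. a y (lookup (single x m + d) y)) = (\<Prod>y\<in>T. a y (lookup d y))"
      using insert.hyps by (intro prod.cong) (auto simp: lookup_add lookup_single when_def)
    then show "(\<Prod>y\<in>insert x T. a y (lookup (?join z) y)) = ?f z"
      using insert.hyps z dx by (simp add: lookup_add)
  next
    fix d assume d: "d \<in> ?C (insert x T) \<gamma>"
    have split: "single x (lookup d x) + Poly_Mapping.update x 0 d = d"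
      by (rule poly_mapping_eqI) (simp add: lookup_update lookup_add lookup_single when_def)
    then show "?join (?split d) = d"
      by simp
    have "nscale (lookup d x) (g x) + push g (Poly_Mapping.update x 0 d) = \<gamma>"
      using d arg_cong[OF split, of "push g"] by (simp add: push_add)
    moreover have "keys (Poly_Mapping.update x 0 d) \<subseteq> T"
    proof
      fix y assume "y \<in> keys (Poly_Mapping.update x 0 d)"
      then have "y \<noteq> x \<and> y \<in> keys d"
        by (auto simp: in_keys_iff lookup_update split: if_splits)
      then show "y \<in> T" using d by auto
    qed
    ultimately show "?split d \<in> ?Z"
      by (auto simp: exponent_splits_def)
  qed
  finally show ?case .
qed

section \<open>The \<open>q\<close>-Pochhammer symbol\<close>

abbreviation pochhammer_monom :: "int \<Rightarrow> ('v \<Rightarrow>\<^sub>0 nat) \<Rightarrow> nat \<Rightarrow> ('v, int fls) mfps" where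
  "pochhammer_monom k g n \<equiv> mfps_monom (fls_X ^ 2) 0 ^ n * qhalf_monom k g"

lemma mfps_coeff_minus:
  "mfps_coeff (f - g) \<gamma> = mfps_coeff f \<gamma> - mfps_coeff g \<gamma>"
  by (simp add: minus_mfps_def)

lemma mfps_monom_mult: "mfps_monom (a :: 'a :: comm_ring_1) \<alpha> * mfps_monom b \<beta> = mfps_monom (a * b) (\<alpha> + \<beta>)"
proof (rule mfps_eqI)
  fix \<gamma>
  have "mfps_coeff (mfps_monom a \<alpha> * mfps_monom b \<beta>) \<gamma>
      = (\<Sum>p\<in>exponent_splits \<gamma>. if p = (\<alpha>, \<beta>) then a * b else 0)"
    unfolding times_mfps_def mfps_coeff_Abs mfps_monom_def case_prod_beta by (rule sum.cong) (auto split: prod.splits)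
  then show "mfps_coeff (mfps_monom a \<alpha> * mfps_monom b \<beta>) \<gamma> = mfps_coeff (mfps_monom (a * b) (\<alpha> + \<beta>)) \<gamma>"
    unfolding sum.delta[OF finite_exponent_splits] by (auto simp: exponent_splits_def mfps_monom_def)
qed

lemma q_power_monom:
  "pochhammer_monom k g n = mfps_monom (fls_X_intpow (2 * int n + k)) g"
proof -
  have "mfps_monom (fls_X ^ 2) 0 ^ n = (mfps_monom (fls_X_intpow (2 * int n)) 0 :: ('a, int fls) mfps)"
  proof (induction n)
    case 0
    then show ?case by (auto intro!: mfps_eqI simp: mfps_monom_def one_mfps_def)
  next
    case (Suc n)
    have "fls_X ^ 2 = (fls_X_intpow 2 :: int fls)"
      by (simp add: fls_X_conv_shift_1 fls_X_intpow_power)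
    then show ?case using Suc by (simp add: mfps_monom_mult fls_X_intpow_times_fls_X_intpow algebra_simps)
  qed
  then show ?thesis by (simp add: qhalf_monom_def mfps_monom_mult fls_X_intpow_times_fls_X_intpow)
qed

text \<open>
  By Euler's expansion, these are the coefficients of \<open>(z; q)\<^sub>\<infinity>\<close> at \<open>z = q\<^sup>k\<^sup>/\<^sup>2 t\<^sup>g\<close>, and
  \<open>euler_series k g n\<close> is the expansion of \<open>(q\<^sup>n z; q)\<^sub>\<infinity>\<close>.  The exponent of \<open>q\<close> is
  \<open>m (m - 1) / 2\<close>, and \<open>m (m - 1)\<close> is even, so \<open>signed_pow\<close> brings no sign here.
\<close>

definition euler_coeff :: "int \<Rightarrow> nat \<Rightarrow> int fls" where
  "euler_coeff k m = (- 1) ^ m * fls_X_intpow (k * int m) * signed_pow (int m * (int m - 1)) * inv_qfact (int m)"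

definition euler_series :: "int \<Rightarrow> ('v \<Rightarrow>\<^sub>0 nat) \<Rightarrow> nat \<Rightarrow> ('v, int fls) mfps" where
  "euler_series k g n = ray_series (\<lambda>m. euler_coeff k m * signed_pow (2 * int n * int m)) g"

lemma signed_pow_even: "even k \<Longrightarrow> signed_pow k = fls_X_intpow k"
  by (simp add: signed_pow_def)

lemma euler_coeff_Suc:
  "euler_coeff k (Suc m) * (1 - signed_pow (2 * int (Suc m)))
     = - (fls_X_intpow k * signed_pow (2 * int m) * euler_coeff k m)"
proof -
  have 1: "inv_qfact (int (Suc m)) * (1 - signed_pow (2 * int (Suc m))) = inv_qfact (int m)"
    using inv_qfact_rec[of "int (Suc m)"] by (simp add: mult.commute)
  have 2: "signed_pow (int (Suc m) * (int (Suc m) - 1)) = signed_pow (2 * int m) * signed_pow (int m * (int m - 1))"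
    by (simp add: algebra_simps flip: signed_pow_add)
  have 3: "fls_X_intpow (k * int (Suc m)) = (fls_X_intpow k * fls_X_intpow (k * int m) :: int fls)"
    by (simp add: fls_X_intpow_times_fls_X_intpow algebra_simps)
  have "euler_coeff k (Suc m) * (1 - signed_pow (2 * int (Suc m)))
      = (- 1) ^ Suc m * fls_X_intpow (k * int (Suc m)) * signed_pow (int (Suc m) * (int (Suc m) - 1))
        * (inv_qfact (int (Suc m)) * (1 - signed_pow (2 * int (Suc m))))"
    unfolding euler_coeff_def by (simp only: mult.assoc)
  also have "\<dots> = - (fls_X_intpow k * signed_pow (2 * int m) * euler_coeff k m)"
    unfolding 1 2 3 euler_coeff_def power_Suc by (simp only: mult_ac mult_minus_left mult_minus_right mult_1)
  finally show ?thesis .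
qed

lemma euler_series_rec:
  assumes "g \<noteq> 0"
  shows "euler_series k g n = (1 - pochhammer_monom k g n) * euler_series k g (Suc n)"
proof -
  let ?b = "\<lambda>n m. euler_coeff k m * signed_pow (2 * int n * int m)"
  let ?x = "fls_X_intpow (2 * int n + k) :: int fls"
  let ?a = "\<lambda>m::nat. if m = 0 then 1 else if m = 1 then - ?x else 0"
  have "1 - mfps_monom ?x g = ray_series ?a g"
  proof (rule mfps_eqI)
    fix \<gamma>
    show "mfps_coeff (1 - mfps_monom ?x g) \<gamma> = mfps_coeff (ray_series ?a g) \<gamma>"
    proof (cases "\<exists>m. \<gamma> = nscale m g")
      case True
      then obtain m where m: "\<gamma> = nscale m g" ..
      have "nscale m g = g \<longleftrightarrow> m = 1" using scale_inject[OF assms, of m 1] by simp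
      then show ?thesis using assms m by (simp add: mfps_coeff_minus one_mfps_def mfps_monom_def)
    next
      case False
      then have "\<gamma> \<noteq> 0" "\<gamma> \<noteq> g" using scale_0[of g] scale_1[of g] by metis+
      moreover have "mfps_coeff (ray_series ?a g) \<gamma> = 0" using False by (intro ray_series_other) auto
      ultimately show ?thesis by (simp add: mfps_coeff_minus one_mfps_def mfps_monom_def)
    qed
  qed
  then have "(1 - pochhammer_monom k g n) * euler_series k g (Suc n)
      = ray_series (\<lambda>N. \<Sum>m\<le>N. ?a m * ?b (Suc n) (N - m)) g"
    unfolding q_power_monom euler_series_def by (simp add: ray_series_mult[OF assms])
  also have "(\<lambda>N. \<Sum>m\<le>N. ?a m * ?b (Suc n) (N - m)) = ?b n"
  proof
    fix N
    show "(\<Sum>m\<le>N. ?a m * ?b (Suc n) (N - m)) = ?b n N"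
    proof (cases N)
      case 0
      then show ?thesis by simp
    next
      case (Suc M)
      have "(\<Sum>m\<le>N. ?a m * ?b (Suc n) (N - m)) = (\<Sum>m\<in>{0, 1}. ?a m * ?b (Suc n) (N - m))"
        by (rule sum.mono_neutral_right) (auto simp: Suc)
      also have "\<dots> = ?b (Suc n) N - ?x * ?b (Suc n) M" by (simp add: Suc)
      also have "?x * ?b (Suc n) M
          = (fls_X_intpow k * signed_pow (2 * int M) * euler_coeff k M) * signed_pow (2 * int n * int N)"
      proof -
        have x: "?x = fls_X_intpow k * signed_pow (2 * int n)"
          by (simp add: signed_pow_even fls_X_intpow_times_fls_X_intpow add.commute)
        have "signed_pow (2 * int n) * signed_pow (2 * int (Suc n) * int M) = signed_pow (2 * int M) * signed_pow (2 * int n * int N)"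
          by (simp add: Suc algebra_simps flip: signed_pow_add)
        then show ?thesis unfolding x by (simp add: mult_ac)
      qed
      also have "\<dots> = - (euler_coeff k N * (1 - signed_pow (2 * int N))) * signed_pow (2 * int n * int N)"
        using euler_coeff_Suc[of k M] by (simp add: Suc)
      also have "?b (Suc n) N = euler_coeff k N * signed_pow (2 * int N) * signed_pow (2 * int n * int N)"
        by (simp add: algebra_simps flip: signed_pow_add)
      finally show ?thesis by (simp add: algebra_simps)
    qed
  qed
  finally show ?thesis by (simp add: euler_series_def)
qed

text \<open>
  In the metric of Laurent series, small distance means agreement of all coefficients below some degree.
\<close>

lemma fls_tendstoI:
  fixes f :: "'b \<Rightarrow> 'a :: group_add fls"
  assumes "\<And>c. \<forall>\<^sub>F x in F. \<forall>n<c. fls_nth (f x) n = fls_nth L n"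
  shows "(f \<longlongrightarrow> L) F"
proof (rule tendstoI)
  fix e :: real assume e: "e > 0"
  obtain N where N: "inverse (2 ^ N) < e"
    using real_arch_pow_inv[of e "1 / 2"] e by (auto simp: power_divide inverse_eq_divide)
  show "\<forall>\<^sub>F x in F. dist (f x) L < e"
  proof (rule eventually_mono[OF assms[of "int N"]])
    fix x assume x: "\<forall>n<int N. fls_nth (f x) n = fls_nth L n"
    show "dist (f x) L < e"
    proof (cases "f x = L")
      case False
      have sub: "fls_subdegree (f x - L) \<ge> int N"
        using False x by (intro fls_subdegree_geI) auto
      then have "dist (f x) L = inverse (2 ^ nat (fls_subdegree (f x - L)))"
        using False by (simp add: dist_fls_def)
      also have "\<dots> \<le> inverse (2 ^ N)"
        using sub by (intro le_imp_inverse_le power_increasing) auto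
      finally show ?thesis using N by simp
    qed (use e in simp)
  qed
qed

text \<open>
  A filtration that is compatible with products: the series has only monomials \<open>t\<^sup>m\<^sup>g\<close>, with
  coefficients of order at least \<open>k m + c\<close> in \<open>q\<^sup>1\<^sup>/\<^sup>2\<close>.  The factors of the
  Pochhammer symbol belong to \<open>c = 0\<close>, even if \<open>k\<close> is negative.
\<close>

definition ray_order_ge :: "int \<Rightarrow> ('v \<Rightarrow>\<^sub>0 nat) \<Rightarrow> int \<Rightarrow> ('v, int fls) mfps \<Rightarrow> bool" where
  "ray_order_ge k g c f \<longleftrightarrow> (\<forall>\<gamma> n. fls_nth (mfps_coeff f \<gamma>) n \<noteq> 0 \<longrightarrow> (\<exists>m. \<gamma> = nscale m g \<and> k * int m + c \<le> n))"

lemma fls_times_nth_nonzero: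
  fixes a b :: "int fls"
  assumes "fls_nth (a * b) n \<noteq> 0"
  obtains i j where "i + j = n" "fls_nth a i \<noteq> 0" "fls_nth b j \<noteq> 0"
proof -
  from assms obtain i where "fls_nth a i * fls_nth b (n - i) \<noteq> 0"
    unfolding fls_times_nth(2) by (metis (no_types, lifting) sum.neutral)
  then show ?thesis using that[of i "n - i"] by auto
qed

lemma ray_order_mult:
  assumes "ray_order_ge k g c f" "ray_order_ge k g c' h"
  shows "ray_order_ge k g (c + c') (f * h)"
  unfolding ray_order_ge_def
proof (intro allI impI)
  fix \<gamma> n assume nz: "fls_nth (mfps_coeff (f * h) \<gamma>) n \<noteq> 0"
  have "fls_nth (mfps_coeff (f * h) \<gamma>) n = (\<Sum>p\<in>exponent_splits \<gamma>. fls_nth (mfps_coeff f (fst p) * mfps_coeff h (snd p)) n)"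
    by (simp add: times_mfps_def case_prod_beta fls_nth_sum)
  then obtain p where p: "p \<in> exponent_splits \<gamma>" "fls_nth (mfps_coeff f (fst p) * mfps_coeff h (snd p)) n \<noteq> 0"
    using nz by (metis (no_types, lifting) sum.neutral)
  obtain i j where ij: "i + j = n" "fls_nth (mfps_coeff f (fst p)) i \<noteq> 0" "fls_nth (mfps_coeff h (snd p)) j \<noteq> 0"
    using fls_times_nth_nonzero[OF p(2)] by metis
  obtain m where m: "fst p = nscale m g" "k * int m + c \<le> i"
    using assms(1) ij(2) unfolding ray_order_ge_def by blast
  obtain m' where m': "snd p = nscale m' g" "k * int m' + c' \<le> j"
    using assms(2) ij(3) unfolding ray_order_ge_def by blast
  have "\<gamma> = nscale (m + m') g"
    using p(1) m m' by (auto simp: exponent_splits_def scale_add)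
  moreover have "k * int (m + m') + (c + c') \<le> n"
    using m(2) m'(2) ij(1) by (simp add: algebra_simps)
  ultimately show "\<exists>m. \<gamma> = nscale m g \<and> k * int m + (c + c') \<le> n" by blast
qed

lemma ray_order_add:
  assumes "ray_order_ge k g c f" "ray_order_ge k g c h"
  shows "ray_order_ge k g c (f + h)" "ray_order_ge k g c (f - h)"
proof -
  have "fls_nth (mfps_coeff f \<gamma>) n \<noteq> 0 \<or> fls_nth (mfps_coeff h \<gamma>) n \<noteq> 0"
    if "fls_nth (mfps_coeff (f + h) \<gamma>) n \<noteq> 0 \<or> fls_nth (mfps_coeff (f - h) \<gamma>) n \<noteq> 0" for \<gamma> n
    using that by (auto simp: plus_mfps_def minus_mfps_def)
  then show "ray_order_ge k g c (f + h)" "ray_order_ge k g c (f - h)"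
    using assms unfolding ray_order_ge_def by blast+
qed

lemma ray_order_mono: "ray_order_ge k g c f \<Longrightarrow> c' \<le> c \<Longrightarrow> ray_order_ge k g c' f"
  unfolding ray_order_ge_def by (meson add_left_mono order_trans)

lemma ray_order_1: "ray_order_ge k g 0 1"
  unfolding ray_order_ge_def one_mfps_def by (auto split: if_splits intro!: exI[of _ 0])

lemma ray_order_factor: "ray_order_ge k g (2 * int n) (pochhammer_monom k g n)"
  unfolding q_power_monom unfolding ray_order_ge_def mfps_monom_def
  by (auto split: if_splits intro!: exI[of _ 1])

lemma ray_order_prod:
  assumes "finite F" "F \<subseteq> {n. N \<le> n}"
  shows "ray_order_ge k g (2 * int N) ((\<Prod>n\<in>F. 1 - pochhammer_monom k g n) - 1)"
  using assms
proof (induction F rule: finite_induct)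
  case empty
  then show ?case by (simp add: ray_order_ge_def zero_mfps_def)
next
  case (insert n F)
  let ?y = "pochhammer_monom k g"
  have y: "ray_order_ge k g (2 * int N) (?y n)"
    by (rule ray_order_mono[OF ray_order_factor]) (use insert.prems in simp)
  have "ray_order_ge k g 0 (1 - ?y n)"
    using ray_order_add(2)[OF ray_order_1 ray_order_mono[OF y]] by simp
  then have "ray_order_ge k g (0 + 2 * int N) ((1 - ?y n) * ((\<Prod>n\<in>F. 1 - ?y n) - 1))"
    using insert by (intro ray_order_mult) auto
  then have "ray_order_ge k g (2 * int N) ((1 - ?y n) * ((\<Prod>n\<in>F. 1 - ?y n) - 1) - ?y n)"
    using ray_order_add(2)[OF _ y] by simp
  moreover have "(1 - ?y n) * ((\<Prod>n\<in>F. 1 - ?y n) - 1) - ?y n = (\<Prod>n\<in>insert n F. 1 - ?y n) - 1"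
    using insert.hyps by (simp add: algebra_simps)
  ultimately show ?case by simp
qed

lemma euler_series_order:
  assumes "g \<noteq> 0"
  shows "ray_order_ge k g (2 * int N) (euler_series k g N - 1)"
  unfolding ray_order_ge_def
proof (intro allI impI)
  fix \<gamma> n assume nz: "fls_nth (mfps_coeff (euler_series k g N - 1) \<gamma>) n \<noteq> 0"
  have 1: "1 = ray_series (\<lambda>n. if n = 0 then 1 else 0) g" using ray_series_0[OF assms] by simp
  have "\<exists>m. \<gamma> = nscale m g"
  proof (rule ccontr)
    assume "\<not> ?thesis"
    then have "mfps_coeff (ray_series a g) \<gamma> = 0" for a :: "nat \<Rightarrow> int fls"
      by (intro ray_series_other) blast
    then show False using nz unfolding 1 euler_series_def mfps_coeff_minus by simp
  qed
  then obtain m where m: "\<gamma> = nscale m g" ..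
  have m0: "m \<noteq> 0"
  proof
    assume "m = 0"
    then show False
      using nz unfolding 1 euler_series_def mfps_coeff_minus m ray_series_scale[OF assms]
      by (simp add: euler_coeff_def)
  qed
  define e where "e = k * int m + int m * (int m - 1) + 2 * int N * int m"
  have "euler_coeff k m * signed_pow (2 * int N * int m)
      = (- 1) ^ m * (fls_X_intpow e * inv_qfact (int m))"
  proof -
    have "signed_pow (int m * (int m - 1)) = fls_X_intpow (int m * (int m - 1))"
        "signed_pow (2 * int N * int m) = fls_X_intpow (2 * int N * int m)"
      by (rule signed_pow_even, simp)+
    moreover have "fls_X_intpow e
        = (fls_X_intpow (k * int m) * fls_X_intpow (int m * (int m - 1)) * fls_X_intpow (2 * int N * int m) :: int fls)"
      by (simp only: e_def fls_X_intpow_times_fls_X_intpow)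
    ultimately show ?thesis unfolding euler_coeff_def by (simp only: mult_ac)
  qed
  then have "fls_nth ((- 1) ^ m * (fls_X_intpow e * inv_qfact (int m))) n \<noteq> 0"
    using nz m0 unfolding 1 euler_series_def mfps_coeff_minus m ray_series_scale[OF assms] by simp
  then have "fls_nth (inv_qfact (int m)) (n - e) \<noteq> 0"
    by (cases "even m") (auto simp: fls_X_intpow_times_conv_shift)
  then have "e \<le> n" by (auto simp: inv_qfact_nth split: if_splits)
  moreover have "2 * int N \<le> int m * (int m - 1) + 2 * int N * int m"
  proof -
    have "2 * int N * 1 \<le> 2 * int N * int m" using m0 by (intro mult_left_mono) auto
    moreover have "0 \<le> int m * (int m - 1)" using m0 by simp
    ultimately show ?thesis by linarith
  qed
  ultimately show "\<exists>m. \<gamma> = nscale m g \<and> k * int m + 2 * int N \<le> n"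
    using m unfolding e_def by (intro exI[of _ m]) linarith
qed

lemma euler_product:
  assumes "g \<noteq> 0"
  shows "euler_series k g 0 = (\<Prod>n<N. 1 - pochhammer_monom k g n) * euler_series k g N"
proof (induction N)
  case (Suc N)
  then show ?case using euler_series_rec[OF assms, of k N] by (simp add: mult_ac)
qed simp

text \<open>
  A finite product over \<open>F \<supseteq> {..<N}\<close> differs from \<open>(q\<^sup>N z; q)\<^sub>\<infinity> \<Prod>\<^sub>n\<^sub><\<^sub>N (1 - q\<^sup>n z)\<close> by a term
  of filtration degree at least \<open>2 N\<close>, since both \<open>(q\<^sup>N z; q)\<^sub>\<infinity>\<close> and the remaining factors are \<open>1\<close> up to such
  terms.
\<close>

lemma qpochhammer_euler:
  assumes "g \<noteq> 0"
  shows "qpochhammer_inf (qhalf_monom k g) = euler_series k g 0"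
proof -
  let ?y = "pochhammer_monom k g"
  have "has_mfps_prod (\<lambda>n. 1 - ?y n) (UNIV :: nat set) (euler_series k g 0)"
    unfolding has_mfps_prod_def
  proof (intro allI fls_tendstoI)
    fix \<gamma> c
    obtain N where N: "\<And>m. \<gamma> = nscale m g \<Longrightarrow> c \<le> k * int m + 2 * int N"
    proof (cases "\<exists>m. \<gamma> = nscale m g")
      case True
      then obtain m where m: "\<gamma> = nscale m g" ..
      show ?thesis
      proof (rule that[of "nat (c - k * int m)"])
        fix m' assume "\<gamma> = nscale m' g"
        then have m': "m' = m" using m scale_inject[OF assms] by metis
        show "c \<le> k * int m' + 2 * int (nat (c - k * int m))" unfolding m' by linarith
      qed
    qed (use that in blast)
    show "\<forall>\<^sub>F F in finite_subsets_at_top UNIV. \<forall>n<c.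
        fls_nth (mfps_coeff (\<Prod>n\<in>F. 1 - ?y n) \<gamma>) n = fls_nth (mfps_coeff (euler_series k g 0) \<gamma>) n"
      unfolding eventually_finite_subsets_at_top
    proof (intro exI[of _ "{..<N}"] conjI allI impI)
      fix F n assume F: "finite F \<and> {..<N} \<subseteq> F \<and> F \<subseteq> (UNIV :: nat set)" and n: "n < c"
      let ?P = "\<Prod>n<N. 1 - ?y n" and ?Q = "\<Prod>n\<in>F - {..<N}. 1 - ?y n"
      have "(\<Prod>n\<in>F. 1 - ?y n) = ?Q * ?P"
        using F by (intro prod.subset_diff) auto
      then have eq: "(\<Prod>n\<in>F. 1 - ?y n) - euler_series k g 0 = ?P * ((?Q - 1) - (euler_series k g N - 1))"
        using euler_product[OF assms, of k N] by (simp add: algebra_simps)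
      have "ray_order_ge k g 0 (?P - 1)"
        by (rule ray_order_mono[OF ray_order_prod[of "{..<N}" 0]]) auto
      then have "ray_order_ge k g 0 ?P"
        using ray_order_add(1)[OF _ ray_order_1, of k g "?P - 1"] by simp
      moreover have "ray_order_ge k g (2 * int N) (?Q - 1)"
        using F by (intro ray_order_prod) auto
      ultimately have "ray_order_ge k g (0 + 2 * int N) (?P * ((?Q - 1) - (euler_series k g N - 1)))"
        by (rule ray_order_mult[OF _ ray_order_add(2)[OF _ euler_series_order[OF assms]]])
      then have "fls_nth (mfps_coeff ((\<Prod>n\<in>F. 1 - ?y n) - euler_series k g 0) \<gamma>) n = 0"
        unfolding eq[symmetric] ray_order_ge_def using N n by fastforce
      then show "fls_nth (mfps_coeff (\<Prod>n\<in>F. 1 - ?y n) \<gamma>) n = fls_nth (mfps_coeff (euler_series k g 0) \<gamma>) n"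
        by (simp add: mfps_coeff_minus)
    qed auto
  qed
  then show ?thesis
    unfolding qpochhammer_inf_def by (intro the_equality) (auto intro: has_mfps_prod_unique)
qed

text \<open>
  The Cauchy product of Euler's two expansions.  Multiplied by
  \<open>1 - q\<^sup>N = (1 - q\<^sup>m) + q\<^sup>m (1 - q\<^sup>N\<^sup>-\<^sup>m)\<close>, the sum telescopes.
\<close>

lemma euler_inverse_sum:
  assumes "N > 0"
  shows "(\<Sum>m\<le>N. (- 1) ^ m * signed_pow (int m * (int m - 1)) * inv_qfact (int m) * inv_qfact (int (N - m))) = 0"
    (is "?S = 0")
proof -
  let ?s = "\<lambda>m. (- 1) ^ m * signed_pow (int m * (int m - 1)) :: int fls"
  let ?u = "\<lambda>m. (- 1) ^ m * signed_pow (int m * (int m - 1) + 2 * int m) * inv_qfact (int m) * inv_qfact (int N - int m - 1)"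
  have step: "(1 - qpow (int N)) * (?s m * inv_qfact (int m) * inv_qfact (int N - int m))
      = ?s m * inv_qfact (int m - 1) * inv_qfact (int N - int m) + ?u m" for m
  proof -
    have "1 - qpow (int N) = (1 - qpow (int m)) + qpow (int m) * (1 - qpow (int N - int m))"
      by (simp add: right_diff_distrib flip: signed_pow_add)
    then have "(1 - qpow (int N)) * (?s m * inv_qfact (int m) * inv_qfact (int N - int m))
        = ?s m * ((1 - qpow (int m)) * inv_qfact (int m)) * inv_qfact (int N - int m)
        + ?s m * qpow (int m) * inv_qfact (int m) * ((1 - qpow (int N - int m)) * inv_qfact (int N - int m))"
      by (simp only: distrib_left distrib_right mult_ac)
    then show ?thesis unfolding inv_qfact_rec signed_pow_add by (simp only: mult.assoc)
  qed
  have "(1 - qpow (int N)) * ?S = (\<Sum>m\<le>N. (1 - qpow (int N)) * (?s m * inv_qfact (int m) * inv_qfact (int N - int m)))"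
    by (simp add: sum_distrib_left of_nat_diff mult.assoc)
  also have "\<dots> = (\<Sum>m\<le>N. ?s m * inv_qfact (int m - 1) * inv_qfact (int N - int m)) + (\<Sum>m\<le>N. ?u m)"
    unfolding step by (rule sum.distrib)
  also have "(\<Sum>m\<le>N. ?u m) = (\<Sum>m<N. ?u m)"
    by (rule sum.mono_neutral_right) auto
  also have "(\<Sum>m\<le>N. ?s m * inv_qfact (int m - 1) * inv_qfact (int N - int m)) = - (\<Sum>m<N. ?u m)"
  proof -
    obtain M where M: "N = Suc M" using assms gr0_conv_Suc by blast
    have [simp]: "?s (Suc m) * inv_qfact (int (Suc m) - 1) * inv_qfact (int (Suc M) - int (Suc m))
        = - ((- 1) ^ m * signed_pow (int m * (int m - 1) + 2 * int m) * inv_qfact (int m) * inv_qfact (int (Suc M) - int m - 1))" for m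
    proof -
      have "int (Suc m) * (int (Suc m) - 1) = int m * (int m - 1) + 2 * int m" "int (Suc M) - int (Suc m) = int (Suc M) - int m - 1"
        "int (Suc m) - 1 = int m"
        by (simp_all add: algebra_simps)
      then show ?thesis by (simp only: power_Suc mult_minus_left mult_1)
    qed
    then show ?thesis
      unfolding M lessThan_Suc_atMost sum.atMost_Suc_shift by (simp add: sum_negf del: of_nat_Suc power_Suc)
  qed
  finally have "(1 - qpow (int N)) * ?S = 0" by simp
  then show ?thesis using one_minus_signed_pow_nonzero[of "int N"] assms by simp
qed

text \<open>
  The generating function of a single vertex without interactions.  It is bosonic, \<open>1 / (z; q)\<^sub>\<infinity>\<close>, for
  even \<open>k\<close>, and fermionic, \<open>(z; q)\<^sub>\<infinity>\<close>, for odd \<open>k\<close>, where \<open>z = q\<^sup>k\<^sup>/\<^sup>2 t\<^sup>g\<close>.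
\<close>

definition tower :: "int \<Rightarrow> ('v \<Rightarrow>\<^sub>0 nat) \<Rightarrow> ('v, int fls) mfps" where
  "tower k g = ray_series (\<lambda>m. (if even k then 1 else signed_pow (int m * (int m - 1))) * signed_pow (k * int m) * inv_qfact (int m)) g"

lemma qpochhammer_powi:
  assumes "g \<noteq> 0"
  shows "qpochhammer_inf (qhalf_monom k g) powi ((if even k then - 1 else 1) * int c) = tower k g ^ c"
proof (cases "even k")
  case False
  have "euler_series k g 0 = tower k g"
    unfolding euler_series_def tower_def euler_coeff_def
    using False by (intro arg_cong[where f = "\<lambda>a. ray_series a g"] ext) (simp add: signed_pow_def mult_ac)
  then show ?thesis using False by (simp add: qpochhammer_euler[OF assms])
next
  case True
  have "euler_series k g 0 * tower k g
      = ray_series (\<lambda>N. \<Sum>m\<le>N. euler_coeff k m * (signed_pow (k * int (N - m)) * inv_qfact (int (N - m)))) g"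
    unfolding euler_series_def tower_def using True by (simp add: ray_series_mult[OF assms])
  also have "\<dots> = ray_series (\<lambda>n. if n = 0 then 1 else 0) g"
  proof (intro arg_cong[where f = "\<lambda>a. ray_series a g"] ext)
    fix N
    have "euler_coeff k m * (signed_pow (k * int (N - m)) * inv_qfact (int (N - m)))
        = signed_pow (k * int N) * ((- 1) ^ m * signed_pow (int m * (int m - 1)) * inv_qfact (int m) * inv_qfact (int (N - m)))"
      if "m \<le> N" for m
    proof -
      have "fls_X_intpow (k * int m) = signed_pow (k * int m)"
        using True by (simp add: signed_pow_even)
      then have e: "fls_X_intpow (k * int m) * signed_pow (k * int (N - m)) = signed_pow (k * int N)"
        using that by (simp add: of_nat_diff algebra_simps flip: signed_pow_add)
      show ?thesis unfolding euler_coeff_def e[symmetric] by (simp only: mult_ac)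
    qed
    then have "(\<Sum>m\<le>N. euler_coeff k m * (signed_pow (k * int (N - m)) * inv_qfact (int (N - m))))
        = signed_pow (k * int N) * (\<Sum>m\<le>N. (- 1) ^ m * signed_pow (int m * (int m - 1)) * inv_qfact (int m) * inv_qfact (int (N - m)))"
      unfolding sum_distrib_left by (intro sum.cong) auto
    also have "\<dots> = (if N = 0 then 1 else 0)"
      using euler_inverse_sum[of N] by (cases "N = 0") auto
    finally show "(\<Sum>m\<le>N. euler_coeff k m * (signed_pow (k * int (N - m)) * inv_qfact (int (N - m)))) = (if N = 0 then 1 else 0)" .
  qed
  also have "\<dots> = 1" by (rule ray_series_0[OF assms])
  finally have "inverse (euler_series k g 0) = tower k g" by (rule mfps_inverse_unique)
  then show ?thesis using True by (simp add: qpochhammer_euler[OF assms] power_int_def)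
qed

section \<open>The product over a decoupled system\<close>

lemma signed_pow_sum: "finite A \<Longrightarrow> signed_pow (\<Sum>x\<in>A. f x) = (\<Prod>x\<in>A. signed_pow (f x))"
  by (induction A rule: finite_induct) (auto simp: signed_pow_add)

text \<open>
  Congruent to \<open>1\<close> modulo all monomials of weight greater than \<open>D\<close>.
\<close>

definition low_trivial :: "nat \<Rightarrow> ('v, int fls) mfps \<Rightarrow> bool" where
  "low_trivial D f \<longleftrightarrow> (\<forall>\<gamma>. weight \<gamma> \<le> D \<longrightarrow> mfps_coeff f \<gamma> = mfps_coeff 1 \<gamma>)"

lemma low_trivial_mult_coeff:
  assumes "low_trivial D f" "weight \<gamma> \<le> D"
  shows "mfps_coeff (f * h) \<gamma> = mfps_coeff h \<gamma>"
proof -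
  have "mfps_coeff (f * h) \<gamma> = mfps_coeff (1 * h) \<gamma>"
    unfolding times_mfps_def mfps_coeff_Abs
  proof (rule sum.cong[OF refl], clarify)
    fix \<alpha> \<beta> assume "(\<alpha>, \<beta>) \<in> exponent_splits \<gamma>"
    then have "weight \<alpha> \<le> D" using assms(2) by (auto simp: exponent_splits_def weight_add)
    then show "mfps_coeff f \<alpha> * mfps_coeff h \<beta> = mfps_coeff 1 \<alpha> * mfps_coeff h \<beta>"
      using assms(1) by (simp add: low_trivial_def)
  qed
  then show ?thesis by simp
qed

lemma low_trivial_mult: "low_trivial D f \<Longrightarrow> low_trivial D h \<Longrightarrow> low_trivial D (f * h)"
  using low_trivial_mult_coeff unfolding low_trivial_def by metis

lemma low_trivial_1: "low_trivial D 1"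
  by (simp add: low_trivial_def)

lemma low_trivial_power: "low_trivial D f \<Longrightarrow> low_trivial D (f ^ n)"
  by (induction n) (auto intro: low_trivial_1 low_trivial_mult)

lemma low_trivial_prod: "(\<And>x. x \<in> A \<Longrightarrow> low_trivial D (f x)) \<Longrightarrow> low_trivial D (\<Prod>x\<in>A. f x)"
  by (induction A rule: infinite_finite_induct) (auto intro: low_trivial_1 low_trivial_mult)

lemma low_trivial_tower:
  assumes "D < weight g"
  shows "low_trivial D (tower k g)"
  unfolding low_trivial_def
proof (intro allI impI)
  fix \<gamma> :: "'a \<Rightarrow>\<^sub>0 nat" assume \<gamma>: "weight \<gamma> \<le> D"
  have g: "g \<noteq> 0" using assms by auto
  show "mfps_coeff (tower k g) \<gamma> = mfps_coeff 1 \<gamma>"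
  proof (cases "\<exists>m. \<gamma> = nscale m g")
    case True
    then obtain m where m: "\<gamma> = nscale m g" ..
    have "m = 0"
    proof (rule ccontr)
      assume "m \<noteq> 0"
      then have "1 * weight g \<le> m * weight g" by (intro mult_le_mono1) simp
      moreover have "weight \<gamma> = m * weight g" by (simp add: m weight_scale)
      ultimately show False using \<gamma> assms by linarith
    qed
    then show ?thesis unfolding m tower_def ray_series_scale[OF g] by (simp add: one_mfps_def)
  next
    case False
    then have "\<gamma> \<noteq> 0" using scale_0[of g] by metis
    moreover have "mfps_coeff (tower k g) \<gamma> = 0"
      unfolding tower_def using False by (intro ray_series_other) blast
    ultimately show ?thesis by (simp add: one_mfps_def)
  qed
qed

abbreviation label_degree :: "('l, 'v) particle_system \<Rightarrow> 'l \<Rightarrow> int" where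
  "label_degree P x \<equiv> form P x x + shift P x"

lemma pair_weight_le:
  assumes "x \<in> keys d" "y \<in> keys d" "x \<noteq> y"
  shows "weight (g x) + weight (g y) \<le> weight (push g d)"
proof -
  have pos: "1 \<le> int (lookup d z)" if "z \<in> keys d" for z
    using that by (simp add: in_keys_iff)
  have "int (weight (g x)) + int (weight (g y))
      \<le> int (lookup d x) * int (weight (g x)) + int (lookup d y) * int (weight (g y))"
    using mult_right_mono[OF pos[OF assms(1)], of "int (weight (g x))"]
      mult_right_mono[OF pos[OF assms(2)], of "int (weight (g y))"] by simp
  also have "\<dots> = (\<Sum>z\<in>{x, y}. int (lookup d z) * int (weight (g z)))"
    using assms(3) by simp
  also have "\<dots> \<le> int (weight (push g d))"
    unfolding int_weight_push lin_def by (rule sum_mono2) (use assms in auto)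
  finally show ?thesis by linarith
qed

text \<open>
  Two labels that occur together in a configuration of charge \<open>\<gamma>\<close> have joint weight at most \<open>D\<close> and hence
  do not interact, so the sum over configurations factors.  A diagonal entry is \<open>0\<close> or \<open>1\<close>, and its parity is that of
  the degree; the two values give the two kinds of \<open>tower\<close>.
\<close>

lemma decoupled_partition_fun:
  assumes adm: "admissible V chi P" and unl: "unlinked_upto D P" and spl: "split_upto D P" and \<gamma>: "weight \<gamma> \<le> D"
  shows "partition_fun P \<gamma>
    = mfps_coeff (\<Prod>x\<in>{x \<in> labels P. label_weight P x \<le> D}. tower (label_degree P x) (charge P x)) \<gamma>"
proof -
  let ?T = "{x \<in> labels P. label_weight P x \<le> D}"
  let ?a = "\<lambda>x m. (if even (label_degree P x) then 1 else signed_pow (int m * (int m - 1))) *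
      signed_pow (label_degree P x * int m) * inv_qfact (int m)"
  have lf: "locally_finite P" using adm by (simp add: admissible_def)
  have finT: "finite ?T" using lf by (simp add: locally_finite_def)
  have configs: "configs P \<gamma> = {d. keys d \<subseteq> ?T \<and> push (charge P) d = \<gamma>}"
  proof (rule set_eqI)
    fix d
    show "d \<in> configs P \<gamma> \<longleftrightarrow> d \<in> {d. keys d \<subseteq> ?T \<and> push (charge P) d = \<gamma>}"
      using configs_bounds(2)[OF lf, of d \<gamma>] \<gamma> by (fastforce simp: configs_def)
  qed
  have a: "?a x m = signed_pow (int m * (form P x x * int m) + int m * shift P x) * inv_qfact (int m)" if x: "x \<in> ?T" for x m
  proof -
    have "0 \<le> form P x x" using spl x by (simp add: split_upto_def)
    moreover have "form P x x \<le> 1" "even (shift P x)" using adm x unfolding admissible_def by blast+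
    ultimately consider "form P x x = 0" | "form P x x = 1" by linarith
    then show ?thesis
    proof cases
      case 1
      then show ?thesis using \<open>even (shift P x)\<close> by (simp add: mult.commute)
    next
      case 2
      then show ?thesis using \<open>even (shift P x)\<close> by (simp add: algebra_simps flip: signed_pow_add)
    qed
  qed
  have "mfps_coeff (\<Prod>x\<in>?T. tower (label_degree P x) (charge P x)) \<gamma>
      = (\<Sum>d | keys d \<subseteq> ?T \<and> push (charge P) d = \<gamma>. \<Prod>x\<in>?T. ?a x (lookup d x))"
    unfolding tower_def by (rule prod_ray_series[OF finT]) (use lf in \<open>simp add: locally_finite_def\<close>)
  also have "\<dots> = (\<Sum>d\<in>configs P \<gamma>. signed_pow (bil (form P) d d + lin (shift P) d) * inv_qfacts d)"
    unfolding configs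
  proof (rule sum.cong[OF refl], clarify)
    fix d assume d: "keys d \<subseteq> ?T" "\<gamma> = push (charge P) d"
    have diag: "lin (form P x) d = form P x x * int (lookup d x)" if x: "x \<in> keys d" for x
    proof -
      have "lin (form P x) d = lin (\<lambda>y. if y = x then form P x x else 0) d"
      proof (rule lin_cong)
        fix y assume y: "y \<in> keys d"
        show "form P x y = (if y = x then form P x x else 0)"
        proof (cases "y = x")
          case False
          have "label_weight P x + label_weight P y \<le> D"
            using pair_weight_le[OF x y, of "charge P"] False \<gamma> d(2) by simp
          moreover have "x \<in> labels P" "y \<in> labels P" using x y d(1) by auto
          ultimately show ?thesis using unl False by (simp add: unlinked_upto_def)
        qed simp
      qed
      then show ?thesis by (simp add: lin_delta)
    qed
    have "bil (form P) d d = lin (\<lambda>x. form P x x * int (lookup d x)) d"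
      by (rule lin_cong) (rule diag)
    then have "bil (form P) d d + lin (shift P) d
        = (\<Sum>x\<in>?T. int (lookup d x) * (form P x x * int (lookup d x))
              + int (lookup d x) * shift P x)"
      by (simp only: lin_superset[OF finT d(1)] sum.distrib)
    then have "signed_pow (bil (form P) d d + lin (shift P) d) * inv_qfacts d
        = (\<Prod>x\<in>?T. signed_pow (int (lookup d x) * (form P x x * int (lookup d x))
              + int (lookup d x) * shift P x) * inv_qfact (int (lookup d x)))"
      by (simp only: signed_pow_sum[OF finT] inv_qfacts_superset[OF finT d(1)] prod.distrib)
    also have "\<dots> = (\<Prod>x\<in>?T. ?a x (lookup d x))"
      by (rule prod.cong[OF refl]) (rule a[symmetric])
    finally show "(\<Prod>x\<in>?T. ?a x (lookup d x))
        = signed_pow (bil (form P) d d + lin (shift P) d) * inv_qfacts d" ..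
  qed
  finally show ?thesis by (simp add: partition_fun_def)
qed

section \<open>The particle system of a quiver\<close>

definition vertex_form :: "('v, 'e) pre_digraph \<Rightarrow> 'v \<Rightarrow> 'v \<Rightarrow> int" where
  "vertex_form Q u v = (if u = v then 1 else 0) - int (num_arrows Q u v)"

lemma euler_form_bil:
  assumes "finite (verts Q)" "\<gamma> \<in> dim_vectors Q" "\<delta> \<in> dim_vectors Q"
  shows "euler_form Q \<gamma> \<delta> = bil (vertex_form Q) \<gamma> \<delta>"
proof -
  let ?V = "verts Q"
  have keys: "keys \<gamma> \<subseteq> ?V" "keys \<delta> \<subseteq> ?V"
    using assms by (auto simp: dim_vectors_def)
  have "bil (vertex_form Q) \<gamma> \<delta> = (\<Sum>i\<in>?V. \<Sum>j\<in>?V. int (lookup \<gamma> i) * (int (lookup \<delta> j) * vertex_form Q i j))"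
    by (simp add: lin_superset[OF assms(1) keys(1)] lin_superset[OF assms(1) keys(2)] sum_distrib_left)
  also have "\<dots> = (\<Sum>i\<in>?V. \<Sum>j\<in>?V. (if j = i then int (lookup \<gamma> i) * int (lookup \<delta> i) else 0)
      - int (num_arrows Q i j) * int (lookup \<gamma> i) * int (lookup \<delta> j))"
    by (intro sum.cong refl) (auto simp: vertex_form_def algebra_simps)
  also have "\<dots> = euler_form Q \<gamma> \<delta>"
    by (simp add: euler_form_def sum_subtractf assms(1))
  finally show ?thesis ..
qed

fun vertex_charge :: "'v label \<Rightarrow> 'v \<Rightarrow>\<^sub>0 nat" where
  "vertex_charge (Vertex v) = single v 1"
| "vertex_charge (Bound u k) = 0"

fun label_form :: "('v \<Rightarrow> 'v \<Rightarrow> int) \<Rightarrow> 'v label \<Rightarrow> 'v label \<Rightarrow> int" where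
  "label_form chi (Vertex u) (Vertex v) = chi u v"
| "label_form chi _ _ = 0"

definition vertex_system :: "('v, 'e) pre_digraph \<Rightarrow> ('v label, 'v) particle_system" where
  "vertex_system Q = \<lparr>labels = Vertex ` verts Q, charge = vertex_charge, form = label_form (vertex_form Q), shift = (\<lambda>_. 0)\<rparr>"

lemma vertex_system_admissible:
  assumes "finite (verts Q)" "symmetric_quiver Q"
  shows "admissible (verts Q) (vertex_form Q) (vertex_system Q)" "bounded_labels (vertex_system Q)"
proof -
  have "single v (Suc 0) \<noteq> 0" for v :: 'a
    by (metis lookup_single_eq lookup_zero nat.distinct(1))
  then have "locally_finite (vertex_system Q)"
    using assms(1) by (auto simp: locally_finite_def vertex_system_def)
  then show "admissible (verts Q) (vertex_form Q) (vertex_system Q)"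
    using assms(2) by (auto simp: admissible_def vertex_system_def vertex_form_def symmetric_quiver_def)
  show "bounded_labels (vertex_system Q)"
    by (auto simp: bounded_labels_def vertex_system_def)
qed

lemma partition_fun_vertex_system:
  assumes "finite (verts Q)"
  shows "partition_fun (vertex_system Q) = mfps_coeff (coha_series Q)"
proof
  fix \<gamma> :: "'a \<Rightarrow>\<^sub>0 nat"
  let ?P = "vertex_system Q"
  define d where "d = push (\<lambda>v. single (Vertex v) 1) \<gamma>"
  have d_sum: "d = (\<Sum>v\<in>keys \<gamma>. single (Vertex v) (lookup \<gamma> v))"
    by (simp add: d_def push_def scale_single)
  have charge_d: "push vertex_charge d = \<gamma>"
    unfolding d_def push_push by (rule push_id) simp
  have unique: "e = d" if "e \<in> configs ?P \<gamma>" for e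
  proof -
    have "push (\<lambda>v. single (Vertex v) 1) (push vertex_charge e) = e"
      unfolding push_push using that by (intro push_id) (auto simp: configs_def vertex_system_def)
    then show ?thesis using that by (simp add: d_def configs_def vertex_system_def)
  qed
  show "partition_fun ?P \<gamma> = mfps_coeff (coha_series Q) \<gamma>"
  proof (cases "\<gamma> \<in> dim_vectors Q")
    case True
    have "keys d \<subseteq> Vertex ` keys \<gamma>"
      using keys_push[of "\<lambda>v. single (Vertex v) (1::nat)" \<gamma>] by (auto simp: d_def)
    then have "d \<in> configs ?P \<gamma>"
      using True charge_d by (auto simp: configs_def vertex_system_def dim_vectors_def)
    then have "configs ?P \<gamma> = {d}" using unique by blast
    moreover have "bil (label_form (vertex_form Q)) d d = euler_form Q \<gamma> \<gamma>"
      unfolding d_def bil_push euler_form_bil[OF assms True True] by simp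
    moreover have "inv_qfacts d = inv_qfacts \<gamma>"
      unfolding d_sum by (subst inv_qfacts_sum_singles) (auto simp: inj_on_def inv_qfacts_def)
    ultimately show ?thesis
      by (simp add: partition_fun_def coha_series_coeff[OF True]) (simp add: vertex_system_def lin_def)
  next
    case False
    have "configs ?P \<gamma> = {}"
    proof (rule ccontr)
      assume "configs ?P \<gamma> \<noteq> {}"
      then obtain e where e: "keys e \<subseteq> Vertex ` verts Q" "push vertex_charge e = \<gamma>"
        by (auto simp: configs_def vertex_system_def)
      then have "keys \<gamma> \<subseteq> verts Q"
        using keys_push[of vertex_charge e] by fastforce
      then show False using False by (simp add: dim_vectors_def)
    qed
    then show ?thesis using False by (simp add: partition_fun_def coha_series_def)
  qed
qed

text \<open>
  The arrows between different vertices cancel in \<open>euler_form Q \<gamma> \<gamma> + 2 * N_bound Q \<gamma>\<close>.  The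
  remaining sum is compared vertex by vertex; there is equality if the vertex has a loop, and for a vertex
  without loops the difference is \<open>\<gamma>\<^sub>i (\<gamma>\<^sub>i - 1)\<close>.
\<close>

lemma degree_bound:
  assumes "finite (verts Q)" "\<gamma> \<in> dim_vectors Q"
    and k: "k - 2 \<le> lin (\<lambda>v. vertex_form Q v v - 2) \<gamma>"
  shows "of_int k < of_int (euler_form Q \<gamma> \<gamma>) + 2 * N_bound Q \<gamma>"
proof -
  let ?V = "verts Q" and ?g = "\<lambda>i. int (lookup \<gamma> i)" and ?a = "\<lambda>i j. int (num_arrows Q i j)"
  have keys: "keys \<gamma> \<subseteq> ?V" using assms(2) by (simp add: dim_vectors_def)
  let ?off = "\<Sum>i\<in>?V. \<Sum>j\<in>?V - {i}. ?a i j * ?g i * ?g j"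
  let ?M = "\<Sum>i\<in>?V. max (?a i i - 1) 0 * ?g i * (?g i - 1)"
  have "(\<Sum>i\<in>?V. \<Sum>j\<in>?V. ?a i j * ?g i * ?g j) = (\<Sum>i\<in>?V. ?a i i * ?g i * ?g i) + ?off"
    using assms(1) by (simp add: sum.remove sum.distrib flip: sum.distrib)
  then have euler: "euler_form Q \<gamma> \<gamma> = (\<Sum>i\<in>?V. ?g i * ?g i) - ((\<Sum>i\<in>?V. ?a i i * ?g i * ?g i) + ?off)"
    by (simp add: euler_form_def)
  have "lin (\<lambda>v. vertex_form Q v v - 2) \<gamma> = (\<Sum>i\<in>?V. ?g i * (- 1 - ?a i i))"
    by (simp add: lin_superset[OF assms(1) keys] vertex_form_def algebra_simps)
  also have "\<dots> \<le> (\<Sum>i\<in>?V. ?g i * ?g i - ?a i i * ?g i * ?g i + max (?a i i - 1) 0 * ?g i * (?g i - 1) - 2 * ?g i)"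
  proof (rule sum_mono)
    fix i
    show "?g i * (- 1 - ?a i i) \<le> ?g i * ?g i - ?a i i * ?g i * ?g i + max (?a i i - 1) 0 * ?g i * (?g i - 1) - 2 * ?g i"
    proof (cases "num_arrows Q i i = 0")
      case True
      have "0 \<le> ?g i * (?g i - 1)" by (cases "lookup \<gamma> i = 0") auto
      then show ?thesis using True by (simp add: algebra_simps)
    next
      case False
      then have "max (?a i i - 1) 0 = ?a i i - 1" by simp
      then show ?thesis by (simp add: algebra_simps)
    qed
  qed
  also have "\<dots> = euler_form Q \<gamma> \<gamma> + ?off + ?M - 2 * (\<Sum>i\<in>?V. ?g i)"
    unfolding euler by (simp add: sum.distrib sum_subtractf sum_distrib_left)
  finally have "k < euler_form Q \<gamma> \<gamma> + ?off + ?M - 2 * (\<Sum>i\<in>?V. ?g i) + 4"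
    using k by linarith
  then have "(of_int k :: rat) < of_int (euler_form Q \<gamma> \<gamma> + ?off + ?M - 2 * (\<Sum>i\<in>?V. ?g i) + 4)"
    by (simp only: of_int_less_iff)
  then show ?thesis
    unfolding N_bound_def by (simp add: algebra_simps)
qed

theorem corollary4p1:
  fixes Q :: "('v, 'e) pre_digraph"
  assumes "fin_digraph Q" and "symmetric_quiver Q"
  shows "\<exists>c :: ('v \<Rightarrow>\<^sub>0 nat) \<Rightarrow> int \<Rightarrow> nat.
    has_mfps_prod
      (\<lambda>(\<gamma>, k). qpochhammer_inf (qhalf_monom k \<gamma>) powi ((if even k then - 1 else 1) * int (c \<gamma> k)))
      (dim_vectors Q \<times> UNIV) (coha_series Q) \<and>
    (\<forall>\<gamma>\<in>dim_vectors Q. \<forall>k. c \<gamma> k \<noteq> 0 \<longrightarrow>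
       \<gamma> \<noteq> 0 \<and>
       [k = euler_form Q \<gamma> \<gamma>] (mod 2) \<and>
       euler_form Q \<gamma> \<gamma> \<le> k \<and>
       of_int k < of_int (euler_form Q \<gamma> \<gamma>) + 2 * N_bound Q \<gamma>) \<and>
    (\<forall>\<gamma>\<in>dim_vectors Q. finite {k. c \<gamma> k \<noteq> 0})"
proof -
  let ?V = "verts Q" and ?chi = "vertex_form Q"
  have finV: "finite ?V" using assms(1) by (rule fin_digraph.finite_verts)
  have chi_sym: "?chi u v = ?chi v u" if "u \<in> ?V" "v \<in> ?V" for u v
    using that assms(2) by (auto simp: vertex_form_def symmetric_quiver_def)
  obtain R :: "nat \<Rightarrow> ('v label, 'v) particle_system"
    where adm: "\<And>s. admissible ?V ?chi (R s)" and unl: "\<And>s. unlinked_upto s (R s)" and spl: "\<And>s. split_upto s (R s)"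
      and agree: "\<And>r s. r \<le> s \<Longrightarrow> agree_upto r (R r) (R s)"
      and pf: "\<And>s. partition_fun (R s) = partition_fun (vertex_system Q)"
    using decoupling_sequence[OF chi_sym vertex_system_admissible[OF finV assms(2)]] by metis
  have lf: "locally_finite (R s)" for s using adm[of s] by (simp add: admissible_def)
  \<comment> \<open>From stage \<open>weight \<gamma>\<close> on, the labels of charge \<open>\<gamma>\<close> and their degrees do not change any more, so that stage
    may be used to count them.\<close>
  define S where "S s \<gamma> k = {x \<in> labels (R s). charge (R s) x = \<gamma> \<and> label_degree (R s) x = k}" for s \<gamma> k
  define c where "c \<gamma> k = card (S (weight \<gamma>) \<gamma> k)" for \<gamma> k
  have S_eq: "S (weight \<gamma>) \<gamma> k = S s \<gamma> k" if "weight \<gamma> \<le> s" for s \<gamma> k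
    using agree[OF that] unfolding agree_upto_def S_def set_eq_iff mem_Collect_eq by (metis order_refl)
  have finS: "finite {x \<in> labels (R s). charge (R s) x = \<gamma>}" for s \<gamma>
    by (rule finite_subset[of _ "{x \<in> labels (R s). label_weight (R s) x \<le> weight \<gamma>}"])
       (use lf[of s] in \<open>auto simp: locally_finite_def\<close>)
  have c_nonzero: "\<exists>x\<in>labels (R (weight \<gamma>)). charge (R (weight \<gamma>)) x = \<gamma> \<and> label_degree (R (weight \<gamma>)) x = k"
    if "c \<gamma> k \<noteq> 0" for \<gamma> k
    using that card_gt_0_iff[of "S (weight \<gamma>) \<gamma> k"] by (auto simp: c_def S_def)
  have properties: "\<gamma> \<noteq> 0 \<and> [k = euler_form Q \<gamma> \<gamma>] (mod 2) \<and> euler_form Q \<gamma> \<gamma> \<le> k \<and>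
       of_int k < of_int (euler_form Q \<gamma> \<gamma>) + 2 * N_bound Q \<gamma>"
    if \<gamma>: "\<gamma> \<in> dim_vectors Q" and nz: "c \<gamma> k \<noteq> 0" for \<gamma> k
  proof -
    let ?R = "R (weight \<gamma>)"
    obtain x where x: "x \<in> labels ?R" "charge ?R x = \<gamma>" "label_degree ?R x = k"
      using c_nonzero[OF nz] by blast
    let ?c = "charge ?R x"
    have "even (form ?R x x - bil ?chi ?c ?c)" "even (shift ?R x)" "bil ?chi ?c ?c \<le> label_degree ?R x"
        "label_degree ?R x - 2 \<le> lin (\<lambda>v. ?chi v v - 2) ?c"
      using adm[of "weight \<gamma>"] x(1) unfolding admissible_def by blast+
    then have *: "even (form ?R x x - bil ?chi \<gamma> \<gamma>)" "even (shift ?R x)" "bil ?chi \<gamma> \<gamma> \<le> k"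
        "k - 2 \<le> lin (\<lambda>v. ?chi v v - 2) \<gamma>"
      unfolding x(2,3) .
    have "k - euler_form Q \<gamma> \<gamma> = (form ?R x x - bil ?chi \<gamma> \<gamma>) + shift ?R x"
      using x(3) unfolding euler_form_bil[OF finV \<gamma> \<gamma>] by simp
    then have "even (k - euler_form Q \<gamma> \<gamma>)" using *(1,2) by simp
    then have "[k = euler_form Q \<gamma> \<gamma>] (mod 2)"
      by (simp add: cong_iff_dvd_diff)
    moreover have "\<gamma> \<noteq> 0" using lf x(1,2) by (auto simp: locally_finite_def)
    ultimately show ?thesis
      using *(3) degree_bound[OF finV \<gamma> *(4)] unfolding euler_form_bil[OF finV \<gamma> \<gamma>] by blast
  qed
  have finite_c: "finite {k. c \<gamma> k \<noteq> 0}" for \<gamma>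
  proof (rule finite_subset)
    show "{k. c \<gamma> k \<noteq> 0} \<subseteq> label_degree (R (weight \<gamma>)) ` {x \<in> labels (R (weight \<gamma>)). charge (R (weight \<gamma>)) x = \<gamma>}"
      using c_nonzero by blast
  qed (intro finite_imageI finS)
  let ?f = "\<lambda>(\<gamma>, k). qpochhammer_inf (qhalf_monom k \<gamma>) powi ((if even k then - 1 else 1) * int (c \<gamma> k))"
  have "has_mfps_prod ?f (dim_vectors Q \<times> UNIV) (coha_series Q)"
    unfolding has_mfps_prod_def
  proof (intro allI tendsto_eventually)
    fix \<gamma> :: "'v \<Rightarrow>\<^sub>0 nat"
    define D where "D = weight \<gamma>"
    let ?R = "R D"
    let ?T = "{x \<in> labels ?R. label_weight ?R x \<le> D}"
    let ?key = "\<lambda>x. (charge ?R x, label_degree ?R x)"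
    have finT: "finite ?T" using lf by (simp add: locally_finite_def)
    have f: "?f (\<delta>, k) = tower k \<delta> ^ c \<delta> k" for \<delta> k
    proof (cases "\<delta> = 0")
      case True
      have "c 0 k = 0"
        using c_nonzero[of 0 k] lf by (auto simp: locally_finite_def)
      then show ?thesis using True by simp
    next
      case False
      then show ?thesis by (simp only: prod.case qpochhammer_powi[OF False])
    qed
    have coeff: "mfps_coeff (\<Prod>p\<in>F. ?f p) \<gamma> = mfps_coeff (coha_series Q) \<gamma>"
      if F: "finite F" "?key ` ?T \<subseteq> F" for F
    proof -
      \<comment> \<open>Only the factors of weight at most \<open>D\<close> contribute to the coefficient of \<open>\<gamma>\<close>.  Grouping the labels of
        these weights by charge and degree gives exactly these factors.\<close>
      let ?F1 = "{p \<in> F. weight (fst p) \<le> D}" and ?F2 = "{p \<in> F. \<not> weight (fst p) \<le> D}"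
      have "low_trivial D (\<Prod>p\<in>?F2. ?f p)"
      proof (rule low_trivial_prod)
        fix p assume p: "p \<in> ?F2"
        obtain \<delta> k where "p = (\<delta>, k)" by (cases p)
        then show "low_trivial D (?f p)"
          using p unfolding \<open>p = (\<delta>, k)\<close> f by (intro low_trivial_power low_trivial_tower) simp
      qed
      moreover have "(\<Prod>p\<in>F. ?f p) = (\<Prod>p\<in>?F2. ?f p) * (\<Prod>p\<in>?F1. ?f p)"
      proof -
        have "F = ?F2 \<union> ?F1" by auto
        then show ?thesis using F(1) by (subst prod.union_disjoint[symmetric]) auto
      qed
      ultimately have "mfps_coeff (\<Prod>p\<in>F. ?f p) \<gamma> = mfps_coeff (\<Prod>p\<in>?F1. ?f p) \<gamma>"
        by (simp only: low_trivial_mult_coeff[of D _ \<gamma>] D_def order_refl)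
      also have "(\<Prod>p\<in>?F1. ?f p) = (\<Prod>p\<in>?key ` ?T. ?f p)"
      proof (rule prod.mono_neutral_right)
        show "\<forall>p\<in>?F1 - ?key ` ?T. ?f p = 1"
        proof
          fix p assume p: "p \<in> ?F1 - ?key ` ?T"
          obtain \<delta> k where \<delta>: "p = (\<delta>, k)" by (cases p)
          have "S D \<delta> k = {}" using p \<delta> by (auto simp: S_def)
          then have "c \<delta> k = 0" using S_eq[of \<delta> D k] p \<delta> by (simp add: c_def)
          then show "?f p = 1" by (simp add: \<delta>)
        qed
      qed (use F in auto)
      also have "\<dots> = (\<Prod>p\<in>?key ` ?T. \<Prod>x | x \<in> ?T \<and> ?key x = p. tower (label_degree ?R x) (charge ?R x))"
      proof (rule prod.cong[OF refl])
        fix p assume p: "p \<in> ?key ` ?T"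
        obtain \<delta> k where \<delta>: "p = (\<delta>, k)" by (cases p)
        have le: "weight \<delta> \<le> D" using p \<delta> by auto
        have set: "{x \<in> ?T. ?key x = p} = S D \<delta> k" using le \<delta> by (auto simp: S_def)
        have "(\<Prod>x\<in>S D \<delta> k. tower (label_degree ?R x) (charge ?R x)) = (\<Prod>x\<in>S D \<delta> k. tower k \<delta>)"
          by (rule prod.cong) (auto simp: S_def)
        then show "?f p = (\<Prod>x | x \<in> ?T \<and> ?key x = p. tower (label_degree ?R x) (charge ?R x))"
          unfolding set unfolding \<delta> f by (simp add: c_def S_eq[OF le])
      qed
      also have "\<dots> = (\<Prod>x\<in>?T. tower (label_degree ?R x) (charge ?R x))"
        using finT by (intro prod.group) auto
      also have "mfps_coeff \<dots> \<gamma> = mfps_coeff (coha_series Q) \<gamma>"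
        using decoupled_partition_fun[OF adm unl spl, of \<gamma> D]
        by (simp add: D_def pf partition_fun_vertex_system[OF finV])
      finally show ?thesis .
    qed
    show "\<forall>\<^sub>F F in finite_subsets_at_top (dim_vectors Q \<times> UNIV). mfps_coeff (\<Prod>p\<in>F. ?f p) \<gamma> = mfps_coeff (coha_series Q) \<gamma>"
      unfolding eventually_finite_subsets_at_top
    proof (intro exI[of _ "?key ` ?T"] conjI allI impI)
      show "?key ` ?T \<subseteq> dim_vectors Q \<times> UNIV"
        using adm[of D] by (auto simp: admissible_def dim_vectors_def)
    qed (use finT coeff in auto)
  qed
  then show ?thesis using properties finite_c by blast
qed

end
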